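(* Let $\mathcal T$ be a triangulated category linear over a field $k$ and let $\mathcal E=(E_0,E_1,\dots,E_n)$ be a full Ext-exceptional collection in $\mathcal T$. Let $0\le i<j\le n$ and denote $\mathcal E_{ij}=(E_i,E_{i+1},\dots,E_j)$, $\mathcal T_{ij}=\langle \mathcal E_{ij}\rangle\subset\mathcal T$. Let $\mathbb H^{\mathcal E_{ij}}\subset\mathrm{Stab}(\mathcal T_{ij})$ and $\mathbb H^{\mathcal E}\subset\mathrm{Stab}(\mathcal T)$ be the families defined in the context. Then the map $\pi_{ij}:\mathbb H^{\mathcal E}\to\mathbb H^{\mathcal E_{ij}}$, which assigns to $(\mathcal P,Z)\in\mathbb H^{\mathcal E}$ the unique $(\mathcal P',Z')\in\mathbb H^{\mathcal E_{ij}}$ with $Z'(E_l)=Z(E_l)$ for $i\le l\le j$, is surjective. Moreover, for any $(\mathcal P,Z)\in\mathbb H^{\mathcal E}$ and $(\mathcal P',Z')\in\mathbb H^{\mathcal E_{ij}}$, $$\pi_{ij}(\mathcal P,Z)=(\mathcal P',Z')\ \Rightarrow\ \mathcal P'(t)=\mathcal P(t)\cap\mathcal T_{ij}\ \text{ for all } t\in\mathbb R.$$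
   Context: $\mathrm{Stab}(\mathcal T)$ is the set of locally finite Bridgeland stability conditions $(\mathcal P,Z)$ on $\mathcal T$. $\langle S\rangle$ is the triangulated subcategory generated by $S$. An exceptional object $E$ satisfies $\mathrm{Hom}(E,E)=k$, $\mathrm{Hom}(E,E[p])=0$ for $p\ne0$. An exceptional collection $(E_0,\dots,E_n)$ consists of exceptional objects with $\mathrm{Hom}(E_i,E_j[p])=0$ for all $p\in\mathbb Z$, $i>j$; it is full if $\langle E_0,\dots,E_n\rangle=\mathcal T$, and Ext-exceptional if moreover $\mathrm{Hom}(E_i,E_j[p])=0$ for all $i\ne j$ and $p\le0$. For a full Ext-exceptional collection $\mathcal E$ in $\mathcal T$, its extension closure $\mathcal A_{\mathcal E}$ is (by Macrì) the heart of a bounded t-structure, of finite length, with simple objects $E_0,\dots,E_n$. $\mathbb H^{\mathcal E}$ is the set of stability conditions $(\mathcal P,Z)\in\mathrm{Stab}(\mathcal T)$ obtained via Bridgeland's construction from the heart $\mathcal A_{\mathcal E}$ and a stability function on it, i.e. those with $\mathcal P((0,1])=\mathcal A_{\mathcal E}$; these correspond bijectively to stability functions $Z:K(\mathcal A_{\mathcal E})\to\mathbb C$ (homomorphisms with $Z(X)\in\{r\exp(\mathrm i\pi t):r>0,0<t\le1\}$ for $0\neq X\in\mathcal A_{\mathcal E}$), equivalently to arbitrary choices of $Z(E_0),\dots,Z(E_n)$ in $\{r\exp(\mathrm i\pi t):r>0,0<t\le1\}$. $\mathbb H^{\mathcal E_{ij}}$ is defined in the same way for the collection $\mathcal E_{ij}$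 in $\mathcal T_{ij}$. *)

theory Defs
  imports Complex_Main "HOL-Algebra.Module" "HOL-Algebra.Generated_Groups"
    "HOL-Algebra.Free_Abelian_Groups"
begin

section \<open>Triangulated categories linear over a field\<close>

text \<open>
  \<open>Hom X Y\<close> is a module record over the base field (its multiplicative part is ignored, as usual
  in HOL-Algebra); \<open>g \<cdot> f\<close> is \<open>g\<close> after \<open>f\<close>.  Objects live in the carrier \<open>Ob\<close>, so that a full
  subcategory is again a structure of the same type.  A triangle
  \<open>X \<rightarrow> Y \<rightarrow> Z \<rightarrow> X[1]\<close> with maps \<open>f, g, h\<close> is the tuple \<open>(X, Y, Z, f, g, h)\<close>.
\<close>

record ('k, 'o, 'm) tricat =
  Ob :: "'o set"
  Hom :: "'o \<Rightarrow> 'o \<Rightarrow> ('k, 'm) module"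
  ident :: "'o \<Rightarrow> 'm"
  cmp :: "'m \<Rightarrow> 'm \<Rightarrow> 'm"  (infixr "\<cdot>\<index>" 75)
  shift :: "'o \<Rightarrow> 'o"
  shiftm :: "'m \<Rightarrow> 'm"
  dist :: "('o \<times> 'o \<times> 'o \<times> 'm \<times> 'm \<times> 'm) set"

abbreviation Mor :: "('k, 'o, 'm) tricat \<Rightarrow> 'o \<Rightarrow> 'o \<Rightarrow> 'm set" where
  "Mor C X Y \<equiv> carrier (Hom C X Y)"

abbreviation zerom :: "('k, 'o, 'm) tricat \<Rightarrow> 'o \<Rightarrow> 'o \<Rightarrow> 'm" where
  "zerom C X Y \<equiv> \<zero>\<^bsub>Hom C X Y\<^esub>"

definition is_zero :: "('k, 'o, 'm) tricat \<Rightarrow> 'o \<Rightarrow> bool" where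
  "is_zero C X \<longleftrightarrow> X \<in> Ob C \<and>
     (\<forall>Y\<in>Ob C. Mor C X Y = {zerom C X Y} \<and> Mor C Y X = {zerom C Y X})"

definition is_biproduct :: "('k, 'o, 'm) tricat \<Rightarrow> 'o \<Rightarrow> 'o \<Rightarrow> 'o \<Rightarrow> bool" where
  "is_biproduct C X Y B \<longleftrightarrow> X \<in> Ob C \<and> Y \<in> Ob C \<and> B \<in> Ob C \<and>
     (\<exists>i1\<in>Mor C X B. \<exists>i2\<in>Mor C Y B. \<exists>p1\<in>Mor C B X. \<exists>p2\<in>Mor C B Y.
        p1 \<cdot>\<^bsub>C\<^esub> i1 = ident C X \<and> p2 \<cdot>\<^bsub>C\<^esub> i2 = ident C Y \<and>
        p1 \<cdot>\<^bsub>C\<^esub> i2 = zerom C Y X \<and> p2 \<cdot>\<^bsub>C\<^esub> i1 = zerom C X Y \<and>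
        (i1 \<cdot>\<^bsub>C\<^esub> p1) \<oplus>\<^bsub>Hom C B B\<^esub> (i2 \<cdot>\<^bsub>C\<^esub> p2) = ident C B)"

definition is_iso :: "('k, 'o, 'm) tricat \<Rightarrow> 'o \<Rightarrow> 'o \<Rightarrow> 'm \<Rightarrow> bool" where
  "is_iso C X Y f \<longleftrightarrow> f \<in> Mor C X Y \<and>
     (\<exists>g\<in>Mor C Y X. g \<cdot>\<^bsub>C\<^esub> f = ident C X \<and> f \<cdot>\<^bsub>C\<^esub> g = ident C Y)"

definition isomorphic :: "('k, 'o, 'm) tricat \<Rightarrow> 'o \<Rightarrow> 'o \<Rightarrow> bool" where
  "isomorphic C X Y \<longleftrightarrow> (\<exists>f. is_iso C X Y f)"

definition triangle :: "('k, 'o, 'm) tricat \<Rightarrow> 'o \<Rightarrow> 'o \<Rightarrow> 'o \<Rightarrow> 'm \<Rightarrow> 'm \<Rightarrow> 'm \<Rightarrow> bool" where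
  "triangle C X Y Z f g h \<longleftrightarrow> X \<in> Ob C \<and> Y \<in> Ob C \<and> Z \<in> Ob C \<and>
     f \<in> Mor C X Y \<and> g \<in> Mor C Y Z \<and> h \<in> Mor C Z (shift C X)"

locale linear_category =
  fixes k :: "'k ring" and C :: "('k, 'o, 'm) tricat" (structure)
  assumes field_k: "field k"
    and module_Hom: "\<lbrakk>X \<in> Ob C; Y \<in> Ob C\<rbrakk> \<Longrightarrow> module k (Hom C X Y)"
    and ident_in: "X \<in> Ob C \<Longrightarrow> ident C X \<in> Mor C X X"
    and cmp_in: "\<lbrakk>X \<in> Ob C; Y \<in> Ob C; Z \<in> Ob C; g \<in> Mor C Y Z; f \<in> Mor C X Y\<rbrakk>
      \<Longrightarrow> g \<cdot> f \<in> Mor C X Z"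
    and ident_left: "\<lbrakk>X \<in> Ob C; Y \<in> Ob C; f \<in> Mor C X Y\<rbrakk> \<Longrightarrow> ident C Y \<cdot> f = f"
    and ident_right: "\<lbrakk>X \<in> Ob C; Y \<in> Ob C; f \<in> Mor C X Y\<rbrakk> \<Longrightarrow> f \<cdot> ident C X = f"
    and cmp_assoc: "\<lbrakk>W \<in> Ob C; X \<in> Ob C; Y \<in> Ob C; Z \<in> Ob C;
        h \<in> Mor C Y Z; g \<in> Mor C X Y; f \<in> Mor C W X\<rbrakk> \<Longrightarrow> (h \<cdot> g) \<cdot> f = h \<cdot> (g \<cdot> f)"
    and cmp_add_right: "\<lbrakk>X \<in> Ob C; Y \<in> Ob C; Z \<in> Ob C;
        g \<in> Mor C Y Z; f \<in> Mor C X Y; f' \<in> Mor C X Y\<rbrakk>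
      \<Longrightarrow> g \<cdot> (f \<oplus>\<^bsub>Hom C X Y\<^esub> f') = (g \<cdot> f) \<oplus>\<^bsub>Hom C X Z\<^esub> (g \<cdot> f')"
    and cmp_add_left: "\<lbrakk>X \<in> Ob C; Y \<in> Ob C; Z \<in> Ob C;
        g \<in> Mor C Y Z; g' \<in> Mor C Y Z; f \<in> Mor C X Y\<rbrakk>
      \<Longrightarrow> (g \<oplus>\<^bsub>Hom C Y Z\<^esub> g') \<cdot> f = (g \<cdot> f) \<oplus>\<^bsub>Hom C X Z\<^esub> (g' \<cdot> f)"
    and cmp_smult_right: "\<lbrakk>X \<in> Ob C; Y \<in> Ob C; Z \<in> Ob C;
        g \<in> Mor C Y Z; f \<in> Mor C X Y; r \<in> carrier k\<rbrakk>
      \<Longrightarrow> g \<cdot> (r \<odot>\<^bsub>Hom C X Y\<^esub> f) = r \<odot>\<^bsub>Hom C X Z\<^esub> (g \<cdot> f)"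
    and cmp_smult_left: "\<lbrakk>X \<in> Ob C; Y \<in> Ob C; Z \<in> Ob C;
        g \<in> Mor C Y Z; f \<in> Mor C X Y; r \<in> carrier k\<rbrakk>
      \<Longrightarrow> (r \<odot>\<^bsub>Hom C Y Z\<^esub> g) \<cdot> f = r \<odot>\<^bsub>Hom C X Z\<^esub> (g \<cdot> f)"

text \<open>The translation functor is an automorphism of the category, as in Verdier's definition.\<close>

locale triangulated_category = linear_category +
  assumes ex_zero: "\<exists>X. is_zero C X"
    and ex_biproduct: "\<lbrakk>X \<in> Ob C; Y \<in> Ob C\<rbrakk> \<Longrightarrow> \<exists>B. is_biproduct C X Y B"
    and shift_bij: "bij_betw (shift C) (Ob C) (Ob C)"
    and shiftm_bij: "\<lbrakk>X \<in> Ob C; Y \<in> Ob C\<rbrakk>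
      \<Longrightarrow> bij_betw (shiftm C) (Mor C X Y) (Mor C (shift C X) (shift C Y))"
    and shiftm_ident: "X \<in> Ob C \<Longrightarrow> shiftm C (ident C X) = ident C (shift C X)"
    and shiftm_cmp: "\<lbrakk>X \<in> Ob C; Y \<in> Ob C; Z \<in> Ob C; g \<in> Mor C Y Z; f \<in> Mor C X Y\<rbrakk>
      \<Longrightarrow> shiftm C (g \<cdot> f) = shiftm C g \<cdot> shiftm C f"
    and shiftm_add: "\<lbrakk>X \<in> Ob C; Y \<in> Ob C; f \<in> Mor C X Y; f' \<in> Mor C X Y\<rbrakk>
      \<Longrightarrow> shiftm C (f \<oplus>\<^bsub>Hom C X Y\<^esub> f') =
        shiftm C f \<oplus>\<^bsub>Hom C (shift C X) (shift C Y)\<^esub> shiftm C f'"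
    and shiftm_smult: "\<lbrakk>X \<in> Ob C; Y \<in> Ob C; f \<in> Mor C X Y; r \<in> carrier k\<rbrakk>
      \<Longrightarrow> shiftm C (r \<odot>\<^bsub>Hom C X Y\<^esub> f) = r \<odot>\<^bsub>Hom C (shift C X) (shift C Y)\<^esub> shiftm C f"
    and dist_triangle: "(X, Y, Z, f, g, h) \<in> dist C \<Longrightarrow> triangle C X Y Z f g h"
    and TR1_iso: "\<lbrakk>(X, Y, Z, f, g, h) \<in> dist C; triangle C X' Y' Z' f' g' h';
        is_iso C X X' a; is_iso C Y Y' b; is_iso C Z Z' c;
        b \<cdot> f = f' \<cdot> a; c \<cdot> g = g' \<cdot> b; shiftm C a \<cdot> h = h' \<cdot> c\<rbrakk>
      \<Longrightarrow> (X', Y', Z', f', g', h') \<in> dist C"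
    and TR1_ident: "\<lbrakk>X \<in> Ob C; is_zero C Z\<rbrakk>
      \<Longrightarrow> (X, X, Z, ident C X, zerom C X Z, zerom C Z (shift C X)) \<in> dist C"
    and TR1_cone: "\<lbrakk>X \<in> Ob C; Y \<in> Ob C; f \<in> Mor C X Y\<rbrakk>
      \<Longrightarrow> \<exists>Z g h. (X, Y, Z, f, g, h) \<in> dist C"
    and TR2: "triangle C X Y Z f g h \<Longrightarrow>
      (X, Y, Z, f, g, h) \<in> dist C \<longleftrightarrow>
      (Y, Z, shift C X, g, h, \<ominus>\<^bsub>Hom C (shift C X) (shift C Y)\<^esub> shiftm C f) \<in> dist C"
    and TR3: "\<lbrakk>(X, Y, Z, f, g, h) \<in> dist C; (X', Y', Z', f', g', h') \<in> dist C;
        a \<in> Mor C X X'; b \<in> Mor C Y Y'; b \<cdot> f = f' \<cdot> a\<rbrakk>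
      \<Longrightarrow> \<exists>c\<in>Mor C Z Z'. c \<cdot> g = g' \<cdot> b \<and> shiftm C a \<cdot> h = h' \<cdot> c"
    and TR4: "\<lbrakk>(X, Y, Z', f, u, u') \<in> dist C; (Y, Z, X', g, v, v') \<in> dist C;
        (X, Z, Y', g \<cdot> f, w, w') \<in> dist C\<rbrakk>
      \<Longrightarrow> \<exists>a b. (Z', Y', X', a, b, shiftm C u \<cdot> v') \<in> dist C \<and>
          a \<cdot> u = w \<cdot> g \<and> w' \<cdot> a = u' \<and> b \<cdot> w = v \<and> v' \<cdot> b = shiftm C f \<cdot> w'"

definition shift_by :: "('k, 'o, 'm) tricat \<Rightarrow> int \<Rightarrow> 'o \<Rightarrow> 'o" where
  "shift_by C p X =
     (if 0 \<le> p then (shift C ^^ nat p) X else (inv_into (Ob C) (shift C) ^^ nat (- p)) X)"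


section \<open>Subcategories\<close>

text \<open>All subcategories are strictly full, hence given by isomorphism-closed sets of objects.\<close>

definition full_subcat :: "('k, 'o, 'm) tricat \<Rightarrow> 'o set \<Rightarrow> ('k, 'o, 'm) tricat" where
  "full_subcat C D =
     C\<lparr>Ob := D, dist := {(X, Y, Z, f, g, h) \<in> dist C. X \<in> D \<and> Y \<in> D \<and> Z \<in> D}\<rparr>"

definition additive_subcat :: "('k, 'o, 'm) tricat \<Rightarrow> 'o set \<Rightarrow> bool" where
  "additive_subcat C D \<longleftrightarrow> D \<subseteq> Ob C \<and> (\<exists>X\<in>D. is_zero C X) \<and>
     (\<forall>X\<in>D. \<forall>Y\<in>Ob C. isomorphic C X Y \<longrightarrow> Y \<in> D) \<and>
     (\<forall>X\<in>D. \<forall>Y\<in>D. \<forall>B. is_biproduct C X Y B \<longrightarrow> B \<in> D)"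

definition triangulated_subcat :: "('k, 'o, 'm) tricat \<Rightarrow> 'o set \<Rightarrow> bool" where
  "triangulated_subcat C D \<longleftrightarrow> additive_subcat C D \<and>
     (\<forall>X\<in>Ob C. X \<in> D \<longleftrightarrow> shift C X \<in> D) \<and>
     (\<forall>X Y Z f g h. (X, Y, Z, f, g, h) \<in> dist C \<longrightarrow> X \<in> D \<longrightarrow> Y \<in> D \<longrightarrow> Z \<in> D)"

definition generated_obs :: "('k, 'o, 'm) tricat \<Rightarrow> 'o set \<Rightarrow> 'o set" where
  "generated_obs C S = \<Inter>{D. triangulated_subcat C D \<and> S \<subseteq> D}"

definition generated :: "('k, 'o, 'm) tricat \<Rightarrow> 'o set \<Rightarrow> ('k, 'o, 'm) tricat" where
  "generated C S = full_subcat C (generated_obs C S)"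

text \<open>The zero objects and the extension rule make the extension closure isomorphism-closed.\<close>

inductive_set ext_closure :: "('k, 'o, 'm) tricat \<Rightarrow> 'o set \<Rightarrow> 'o set"
  for C :: "('k, 'o, 'm) tricat" and S :: "'o set" where
  zero: "is_zero C X \<Longrightarrow> X \<in> ext_closure C S"
| base: "X \<in> S \<Longrightarrow> X \<in> ext_closure C S"
| ext: "\<lbrakk>(X, Y, Z, f, g, h) \<in> dist C; X \<in> ext_closure C S; Z \<in> ext_closure C S\<rbrakk>
    \<Longrightarrow> Y \<in> ext_closure C S"


section \<open>Finite length\<close>

definition is_kernel :: "('k, 'o, 'm) tricat \<Rightarrow> 'o \<Rightarrow> 'o \<Rightarrow> 'o \<Rightarrow> 'm \<Rightarrow> 'm \<Rightarrow> bool" where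
  "is_kernel C K X Y u f \<longleftrightarrow> K \<in> Ob C \<and> u \<in> Mor C K X \<and> f \<cdot>\<^bsub>C\<^esub> u = zerom C K Y \<and>
     (\<forall>W\<in>Ob C. \<forall>w\<in>Mor C W X. f \<cdot>\<^bsub>C\<^esub> w = zerom C W Y \<longrightarrow>
        (\<exists>!v. v \<in> Mor C W K \<and> u \<cdot>\<^bsub>C\<^esub> v = w))"

definition is_cokernel :: "('k, 'o, 'm) tricat \<Rightarrow> 'o \<Rightarrow> 'o \<Rightarrow> 'o \<Rightarrow> 'm \<Rightarrow> 'm \<Rightarrow> bool" where
  "is_cokernel C X Y Q f q \<longleftrightarrow> Q \<in> Ob C \<and> q \<in> Mor C Y Q \<and> q \<cdot>\<^bsub>C\<^esub> f = zerom C X Q \<and>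
     (\<forall>W\<in>Ob C. \<forall>w\<in>Mor C Y W. w \<cdot>\<^bsub>C\<^esub> f = zerom C X W \<longrightarrow>
        (\<exists>!v. v \<in> Mor C Q W \<and> v \<cdot>\<^bsub>C\<^esub> q = w))"

text \<open>
  A morphism is strict if its coimage maps isomorphically to its image.  For a monomorphism
  \<open>u : A \<rightarrow> X\<close> the coimage is \<open>A\<close> and the image is the kernel of the cokernel of \<open>u\<close>, so a strict
  subobject is a morphism that is a kernel of its cokernel.
\<close>

definition strict_subobject :: "('k, 'o, 'm) tricat \<Rightarrow> 'o \<Rightarrow> 'o \<times> 'm \<Rightarrow> bool" where
  "strict_subobject C X = (\<lambda>(A, u). A \<in> Ob C \<and> u \<in> Mor C A X \<and>
     (\<exists>Q q. is_cokernel C A X Q u q \<and> is_kernel C A X Q u q))"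

definition subobject_le :: "('k, 'o, 'm) tricat \<Rightarrow> 'o \<times> 'm \<Rightarrow> 'o \<times> 'm \<Rightarrow> bool" where
  "subobject_le C = (\<lambda>(A, u) (B, v). \<exists>w\<in>Mor C A B. v \<cdot>\<^bsub>C\<^esub> w = u)"

definition artinian_cat :: "('k, 'o, 'm) tricat \<Rightarrow> bool" where
  "artinian_cat C \<longleftrightarrow> (\<forall>X\<in>Ob C. \<forall>s :: nat \<Rightarrow> 'o \<times> 'm.
     (\<forall>n. strict_subobject C X (s n)) \<longrightarrow> (\<forall>n. subobject_le C (s (Suc n)) (s n)) \<longrightarrow>
     (\<exists>N. \<forall>n\<ge>N. subobject_le C (s n) (s (Suc n))))"

definition noetherian_cat :: "('k, 'o, 'm) tricat \<Rightarrow> bool" where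
  "noetherian_cat C \<longleftrightarrow> (\<forall>X\<in>Ob C. \<forall>s :: nat \<Rightarrow> 'o \<times> 'm.
     (\<forall>n. strict_subobject C X (s n)) \<longrightarrow> (\<forall>n. subobject_le C (s n) (s (Suc n))) \<longrightarrow>
     (\<exists>N. \<forall>n\<ge>N. subobject_le C (s (Suc n)) (s n)))"

definition finite_length :: "('k, 'o, 'm) tricat \<Rightarrow> bool" where
  "finite_length C \<longleftrightarrow> artinian_cat C \<and> noetherian_cat C"


section \<open>The Grothendieck group\<close>

definition K_free :: "('k, 'o, 'm) tricat \<Rightarrow> ('o \<Rightarrow>\<^sub>0 int) monoid" where
  "K_free C = free_Abelian_group (Ob C)"

definition K_relations :: "('k, 'o, 'm) tricat \<Rightarrow> ('o \<Rightarrow>\<^sub>0 int) set" where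
  "K_relations C = generate (K_free C)
     {frag_of Y - frag_of X - frag_of Z |X Y Z. \<exists>f g h. (X, Y, Z, f, g, h) \<in> dist C}"

definition K_group :: "('k, 'o, 'm) tricat \<Rightarrow> ('o \<Rightarrow>\<^sub>0 int) set monoid" where
  "K_group C = K_free C Mod K_relations C"

definition K_class :: "('k, 'o, 'm) tricat \<Rightarrow> 'o \<Rightarrow> ('o \<Rightarrow>\<^sub>0 int) set" where
  "K_class C X = K_relations C #>\<^bsub>K_free C\<^esub> frag_of X"

definition complex_add_group :: "complex monoid" where
  "complex_add_group = \<lparr>carrier = UNIV, mult = (+), one = 0\<rparr>"


section \<open>Bridgeland stability conditions\<close>

text \<open>
  The Harder--Narasimhan condition: \<open>X\<close> has a filtration \<open>0 = F 0 \<rightarrow> F 1 \<rightarrow> \<dots> \<rightarrow> F n = X\<close> whose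
  successive cones \<open>A 0, \<dots>, A (n - 1)\<close> have decreasing phases.
\<close>

definition has_HN_filtration ::
    "('k, 'o, 'm) tricat \<Rightarrow> (real \<Rightarrow> 'o set) \<Rightarrow> 'o \<Rightarrow> bool" where
  "has_HN_filtration C P X \<longleftrightarrow>
     (\<exists>(n::nat) (\<phi> :: nat \<Rightarrow> real) (F :: nat \<Rightarrow> 'o) (A :: nat \<Rightarrow> 'o).
        is_zero C (F 0) \<and> F n = X \<and>
        (\<forall>l m. l < m \<longrightarrow> m < n \<longrightarrow> \<phi> m < \<phi> l) \<and>
        (\<forall>l<n. A l \<in> P (\<phi> l) \<and> (\<exists>f g h. (F l, F (Suc l), A l, f, g, h) \<in> dist C)))"

definition slicing :: "('k, 'o, 'm) tricat \<Rightarrow> (real \<Rightarrow> 'o set) \<Rightarrow> bool" where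
  "slicing C P \<longleftrightarrow>
     (\<forall>t. additive_subcat C (P t)) \<and>
     (\<forall>t. P (t + 1) = shift C ` P t) \<and>
     (\<forall>s t. t < s \<longrightarrow> (\<forall>X\<in>P s. \<forall>Y\<in>P t. Mor C X Y = {zerom C X Y})) \<and>
     (\<forall>X\<in>Ob C. \<not> is_zero C X \<longrightarrow> has_HN_filtration C P X)"

definition P_interval ::
    "('k, 'o, 'm) tricat \<Rightarrow> (real \<Rightarrow> 'o set) \<Rightarrow> real set \<Rightarrow> 'o set" where
  "P_interval C P I = ext_closure C (\<Union>t\<in>I. P t)"

text \<open>The bound \<open>\<eta> < 1/2\<close> makes the interval shorter than 1, so that its category is quasi-abelian.\<close>

definition locally_finite :: "('k, 'o, 'm) tricat \<Rightarrow> (real \<Rightarrow> 'o set) \<Rightarrow> bool" where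
  "locally_finite C P \<longleftrightarrow> (\<exists>\<eta>>0. \<eta> < 1/2 \<and>
     (\<forall>t. finite_length (full_subcat C (P_interval C P {t - \<eta><..<t + \<eta>}))))"

text \<open>
  Central charges are extensional on the Grothendieck group, so that equality of pairs
  \<open>(P, Z)\<close> is equality of stability conditions.
\<close>

type_synonym 'o stab_cond = "(real \<Rightarrow> 'o set) \<times> (('o \<Rightarrow>\<^sub>0 int) set \<Rightarrow> complex)"

definition Stab :: "('k, 'o, 'm) tricat \<Rightarrow> 'o stab_cond set" where
  "Stab C = {(P, Z). slicing C P \<and> locally_finite C P \<and>
     Z \<in> hom (K_group C) complex_add_group \<and> Z \<in> extensional (carrier (K_group C)) \<and>
     (\<forall>t. \<forall>X\<in>P t. \<not> is_zero C X \<longrightarrow>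
        (\<exists>m>0. Z (K_class C X) = complex_of_real m * exp (\<i> * complex_of_real (pi * t))))}"


section \<open>Exceptional collections\<close>

text \<open>\<open>Hom(X, X) = k\<close> means that the structure map \<open>k \<rightarrow> Hom(X, X)\<close> is an isomorphism.\<close>

definition exceptional_object :: "'k ring \<Rightarrow> ('k, 'o, 'm) tricat \<Rightarrow> 'o \<Rightarrow> bool" where
  "exceptional_object k C X \<longleftrightarrow> X \<in> Ob C \<and>
     bij_betw (\<lambda>c. c \<odot>\<^bsub>Hom C X X\<^esub> ident C X) (carrier k) (Mor C X X) \<and>
     (\<forall>p. p \<noteq> 0 \<longrightarrow> Mor C X (shift_by C p X) = {zerom C X (shift_by C p X)})"

definition exceptional_collection :: "'k ring \<Rightarrow> ('k, 'o, 'm) tricat \<Rightarrow> 'o list \<Rightarrow> bool" where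
  "exceptional_collection k C E \<longleftrightarrow>
     (\<forall>X\<in>set E. exceptional_object k C X) \<and>
     (\<forall>i j p. i < length E \<longrightarrow> j < i \<longrightarrow>
        Mor C (E ! i) (shift_by C p (E ! j)) = {zerom C (E ! i) (shift_by C p (E ! j))})"

definition ext_exceptional_collection ::
    "'k ring \<Rightarrow> ('k, 'o, 'm) tricat \<Rightarrow> 'o list \<Rightarrow> bool" where
  "ext_exceptional_collection k C E \<longleftrightarrow> exceptional_collection k C E \<and>
     (\<forall>i j p. i < length E \<longrightarrow> j < length E \<longrightarrow> i \<noteq> j \<longrightarrow> p \<le> 0 \<longrightarrow>
        Mor C (E ! i) (shift_by C p (E ! j)) = {zerom C (E ! i) (shift_by C p (E ! j))})"

definition full_collection :: "('k, 'o, 'm) tricat \<Rightarrow> 'o list \<Rightarrow> bool" where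
  "full_collection C E \<longleftrightarrow> generated_obs C (set E) = Ob C"

definition heart :: "('k, 'o, 'm) tricat \<Rightarrow> 'o list \<Rightarrow> 'o set" where
  "heart C E = ext_closure C (set E)"

definition HH :: "('k, 'o, 'm) tricat \<Rightarrow> 'o list \<Rightarrow> 'o stab_cond set" where
  "HH C E = {(P, Z) \<in> Stab C. P_interval C P {0<..1} = heart C E}"

definition subcollection :: "'o list \<Rightarrow> nat \<Rightarrow> nat \<Rightarrow> 'o list" where
  "subcollection E i j = map (\<lambda>l. E ! l) [i..<Suc j]"

definition T_sub :: "('k, 'o, 'm) tricat \<Rightarrow> 'o list \<Rightarrow> nat \<Rightarrow> nat \<Rightarrow> ('k, 'o, 'm) tricat" where
  "T_sub C E i j = generated C (set (subcollection E i j))"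

definition charges_agree ::
    "('k, 'o, 'm) tricat \<Rightarrow> 'o list \<Rightarrow> nat \<Rightarrow> nat \<Rightarrow> 'o stab_cond \<Rightarrow> 'o stab_cond \<Rightarrow> bool" where
  "charges_agree C E i j \<sigma> \<sigma>' \<longleftrightarrow>
     (\<forall>l\<in>{i..j}. snd \<sigma>' (K_class (T_sub C E i j) (E ! l)) = snd \<sigma> (K_class C (E ! l)))"

text \<open>
  Meaningful only where such a stability condition exists uniquely; for a full Ext-exceptional
  collection this has to be proved.
\<close>

definition proj_stab ::
    "('k, 'o, 'm) tricat \<Rightarrow> 'o list \<Rightarrow> nat \<Rightarrow> nat \<Rightarrow> 'o stab_cond \<Rightarrow> 'o stab_cond" where
  "proj_stab C E i j \<sigma> =
     (THE \<sigma>'. \<sigma>' \<in> HH (T_sub C E i j) (subcollection E i j) \<and> charges_agree C E i j \<sigma> \<sigma>')"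

end

theory Submission
  imports Defs
begin

text \<open>
  Everything reduces to one construction. Call a finite set \<open>\<S>\<close> of generators simple-minded if its
  members have no maps of negative degree between them, no maps of degree \<open>0\<close> between different ones,
  and only zero or invertible endomorphisms. The members of a full Ext-exceptional collection form
  such a set, and any part \<open>\<S>'\<close> of \<open>\<S>\<close> is one in the subcategory that it generates. For a
  simple-minded set with extension closure \<open>\<A>\<close>, and for every choice of charges \<open>z S\<close> in the upper
  half plane, there is exactly one stability condition with heart \<open>\<A>\<close> and these charges. Hence the
  restriction of charges defines the map of the theorem (\<open>stability_condition_exists\<close>,
  \<open>stability_condition_unique\<close>), and it is onto since charges outside \<open>\<S>'\<close> can be chosen freely.

  The existence rests on sorting. Since \<open>\<S>\<close> generates, every object is an iterated extension of
  shifts \<open>S[p]\<close>, that is, filtered by a word in such letters. Two neighbouring letters in ascending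
  degree can be exchanged, or they cancel (\<open>exchange\<close>). Sorting a word by degree yields the
  cohomology filtration of the bounded t-structure with heart \<open>\<A>\<close>. Exchange and cancellation
  preserve the signed sum of the charges of the letters, and a sorted word that filters a zero object
  is empty; therefore this sum depends on the object only (\<open>weight_unique\<close>), which makes \<open>z\<close> an
  additive function on the triangulated category. Sorting a cone of a morphism between two objects
  of \<open>\<A>\<close> produces its kernel and cokernel, and the octahedral axiom its image
  (\<open>image_factorization\<close>).

  With images available, maps between semistable objects of decreasing phase vanish
  (\<open>orth_sem\<close>), and subobjects of maximal phase and length give Harder--Narasimhan filtrations
  (\<open>maximal_destabilizing\<close>). Local finiteness holds because the finitely many simple objects leave a
  gap of phases above each integer: a short interval of phases lies in a single shift of \<open>\<A>\<close>, where
  the length of objects bounds chains of subobjects (\<open>locally_finite_slice\<close>).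

  Conversely, every stability condition with heart \<open>\<A>\<close> has as its slices in \<open>(0,1]\<close> the semistable
  objects of \<open>\<A>\<close> (\<open>stability_condition_slices\<close>). This gives uniqueness. It also reduces the formula
  for the restricted slices to the comparison of semistable objects in two hearts. The multiplicity of
  the simple objects outside \<open>\<S>'\<close> is additive and non-negative, and on the larger heart it vanishes
  exactly on the smaller one. So the smaller heart contains all subobjects of its members, and an
  object of it is semistable in one heart if and only if it is in the other (\<open>Sub_sem\<close>).
\<close>

section \<open>Morphisms in a linear category\<close>

definition orth :: "('k, 'o, 'm) tricat \<Rightarrow> 'o \<Rightarrow> 'o \<Rightarrow> bool" where
  "orth C X Y \<longleftrightarrow> Mor C X Y = {zerom C X Y}"

context linear_category
begin

lemma Hom_abelian_group: "X \<in> Ob C \<Longrightarrow> Y \<in> Ob C \<Longrightarrow> abelian_group (Hom C X Y)"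
  using module_Hom module.axioms(2) by blast

lemma zerom_in [simp]: "X \<in> Ob C \<Longrightarrow> Y \<in> Ob C \<Longrightarrow> zerom C X Y \<in> Mor C X Y"
  by (simp add: Hom_abelian_group abelian_group.axioms(1) abelian_monoid.zero_closed)

lemma uminus_in [simp]:
  "X \<in> Ob C \<Longrightarrow> Y \<in> Ob C \<Longrightarrow> f \<in> Mor C X Y \<Longrightarrow> \<ominus>\<^bsub>Hom C X Y\<^esub> f \<in> Mor C X Y"
  by (simp add: Hom_abelian_group abelian_group.a_inv_closed)

lemma minus_minus [simp]:
  "X \<in> Ob C \<Longrightarrow> Y \<in> Ob C \<Longrightarrow> f \<in> Mor C X Y \<Longrightarrow> \<ominus>\<^bsub>Hom C X Y\<^esub> (\<ominus>\<^bsub>Hom C X Y\<^esub> f) = f"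
  by (simp add: Hom_abelian_group abelian_group.minus_minus)

lemma add_in [simp]:
  "X \<in> Ob C \<Longrightarrow> Y \<in> Ob C \<Longrightarrow> f \<in> Mor C X Y \<Longrightarrow> g \<in> Mor C X Y \<Longrightarrow> f \<oplus>\<^bsub>Hom C X Y\<^esub> g \<in> Mor C X Y"
  by (simp add: Hom_abelian_group abelian_group.axioms(1) abelian_monoid.a_closed)

lemma add_zero [simp]:
  assumes "X \<in> Ob C" "Y \<in> Ob C" "f \<in> Mor C X Y"
  shows "f \<oplus>\<^bsub>Hom C X Y\<^esub> zerom C X Y = f" "zerom C X Y \<oplus>\<^bsub>Hom C X Y\<^esub> f = f"
    "f \<oplus>\<^bsub>Hom C X Y\<^esub> (\<ominus>\<^bsub>Hom C X Y\<^esub> f) = zerom C X Y"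
proof -
  interpret abelian_group "Hom C X Y" using assms Hom_abelian_group by blast
  show "f \<oplus>\<^bsub>Hom C X Y\<^esub> zerom C X Y = f" "zerom C X Y \<oplus>\<^bsub>Hom C X Y\<^esub> f = f"
    "f \<oplus>\<^bsub>Hom C X Y\<^esub> (\<ominus>\<^bsub>Hom C X Y\<^esub> f) = zerom C X Y"
    using assms by (auto simp: r_neg)
qed

lemma idempotent_zero:
  assumes "X \<in> Ob C" "Y \<in> Ob C" "f \<in> Mor C X Y" "f \<oplus>\<^bsub>Hom C X Y\<^esub> f = f"
  shows "f = zerom C X Y"
proof -
  interpret abelian_group "Hom C X Y" using assms Hom_abelian_group by blast
  show ?thesis using assms by (metis add.r_cancel_one')
qed

lemma uminus_unique:
  assumes "X \<in> Ob C" "Y \<in> Ob C" "f \<in> Mor C X Y" "g \<in> Mor C X Y" "f \<oplus>\<^bsub>Hom C X Y\<^esub> g = zerom C X Y"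
  shows "g = \<ominus>\<^bsub>Hom C X Y\<^esub> f"
proof -
  interpret abelian_group "Hom C X Y" using assms Hom_abelian_group by blast
  show ?thesis using assms by (metis minus_equality add.m_comm)
qed

lemma diff_zero_imp_eq:
  assumes "X \<in> Ob C" "Y \<in> Ob C" "f \<in> Mor C X Y" "g \<in> Mor C X Y"
    and "f \<oplus>\<^bsub>Hom C X Y\<^esub> (\<ominus>\<^bsub>Hom C X Y\<^esub> g) = zerom C X Y"
  shows "f = g"
proof -
  interpret abelian_group "Hom C X Y" using assms Hom_abelian_group by blast
  show ?thesis using assms by (metis a_inv_closed minus_equality minus_minus)
qed

lemma cmp_zero_right [simp]:
  assumes "g \<in> Mor C Y Z" "X \<in> Ob C" "Y \<in> Ob C" "Z \<in> Ob C"
  shows "g \<cdot> zerom C X Y = zerom C X Z"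
proof -
  have "g \<cdot> zerom C X Y \<oplus>\<^bsub>Hom C X Z\<^esub> g \<cdot> zerom C X Y = g \<cdot> zerom C X Y"
    using assms cmp_add_right[of X Y Z g "zerom C X Y" "zerom C X Y"] by simp
  then show ?thesis using assms cmp_in[of X Y Z] idempotent_zero by simp
qed

lemma cmp_zero_left [simp]:
  assumes "f \<in> Mor C X Y" "X \<in> Ob C" "Y \<in> Ob C" "Z \<in> Ob C"
  shows "zerom C Y Z \<cdot> f = zerom C X Z"
proof -
  have "zerom C Y Z \<cdot> f \<oplus>\<^bsub>Hom C X Z\<^esub> zerom C Y Z \<cdot> f = zerom C Y Z \<cdot> f"
    using assms cmp_add_left[of X Y Z "zerom C Y Z" "zerom C Y Z" f] by simp
  then show ?thesis using assms cmp_in[of X Y Z] idempotent_zero by simp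
qed

lemma ident_cmp [simp]: "f \<in> Mor C X Y \<Longrightarrow> X \<in> Ob C \<Longrightarrow> Y \<in> Ob C \<Longrightarrow> ident C Y \<cdot> f = f"
  using ident_left by blast

lemma cmp_ident [simp]: "f \<in> Mor C X Y \<Longrightarrow> X \<in> Ob C \<Longrightarrow> Y \<in> Ob C \<Longrightarrow> f \<cdot> ident C X = f"
  using ident_right by blast

lemma cmp_uminus_right:
  assumes "X \<in> Ob C" "Y \<in> Ob C" "Z \<in> Ob C" "g \<in> Mor C Y Z" "f \<in> Mor C X Y"
  shows "g \<cdot> (\<ominus>\<^bsub>Hom C X Y\<^esub> f) = \<ominus>\<^bsub>Hom C X Z\<^esub> (g \<cdot> f)"
proof (rule uminus_unique)
  show "g \<cdot> f \<oplus>\<^bsub>Hom C X Z\<^esub> g \<cdot> (\<ominus>\<^bsub>Hom C X Y\<^esub> f) = zerom C X Z"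
    using assms cmp_add_right[of X Y Z g f "\<ominus>\<^bsub>Hom C X Y\<^esub> f"] by simp
qed (use assms cmp_in in auto)

lemma cmp_uminus_left:
  assumes "X \<in> Ob C" "Y \<in> Ob C" "Z \<in> Ob C" "g \<in> Mor C Y Z" "f \<in> Mor C X Y"
  shows "(\<ominus>\<^bsub>Hom C Y Z\<^esub> g) \<cdot> f = \<ominus>\<^bsub>Hom C X Z\<^esub> (g \<cdot> f)"
proof (rule uminus_unique)
  show "g \<cdot> f \<oplus>\<^bsub>Hom C X Z\<^esub> (\<ominus>\<^bsub>Hom C Y Z\<^esub> g) \<cdot> f = zerom C X Z"
    using assms cmp_add_left[of X Y Z g "\<ominus>\<^bsub>Hom C Y Z\<^esub> g" f] by simp
qed (use assms cmp_in in auto)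

lemma uminus_zero [simp]: "X \<in> Ob C \<Longrightarrow> Y \<in> Ob C \<Longrightarrow> \<ominus>\<^bsub>Hom C X Y\<^esub> zerom C X Y = zerom C X Y"
  by (metis uminus_unique add_zero(1) zerom_in)

lemma is_zero_Ob: "is_zero C X \<Longrightarrow> X \<in> Ob C"
  by (simp add: is_zero_def)

lemma is_zero_iff_ident: "X \<in> Ob C \<Longrightarrow> is_zero C X \<longleftrightarrow> ident C X = zerom C X X"
proof
  assume X: "X \<in> Ob C" and eq: "ident C X = zerom C X X"
  have "Mor C X Y = {zerom C X Y} \<and> Mor C Y X = {zerom C Y X}" if Y: "Y \<in> Ob C" for Y
  proof (intro conjI equalityI subsetI)
    fix f assume f: "f \<in> Mor C X Y"
    have "f = f \<cdot> ident C X" using X Y f by (simp add: ident_right)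
    then show "f \<in> {zerom C X Y}" using X Y f eq by simp
  next
    fix f assume f: "f \<in> Mor C Y X"
    have "f = ident C X \<cdot> f" using X Y f by (simp add: ident_left)
    then show "f \<in> {zerom C Y X}" using X Y f eq by simp
  qed (use X Y in auto)
  then show "is_zero C X" using X by (simp add: is_zero_def)
qed (use ident_in in \<open>auto simp: is_zero_def\<close>)

lemma orthI: "X \<in> Ob C \<Longrightarrow> Y \<in> Ob C \<Longrightarrow> (\<And>f. f \<in> Mor C X Y \<Longrightarrow> f = zerom C X Y) \<Longrightarrow> orth C X Y"
  by (auto simp: orth_def)

lemma orthD: "orth C X Y \<Longrightarrow> f \<in> Mor C X Y \<Longrightarrow> f = zerom C X Y"
  by (auto simp: orth_def)

lemma orth_self_iff: "X \<in> Ob C \<Longrightarrow> orth C X X \<longleftrightarrow> is_zero C X"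
  by (metis orth_def ident_in is_zero_def is_zero_iff_ident singletonD)

lemma orth_zero:
  "is_zero C X \<Longrightarrow> Y \<in> Ob C \<Longrightarrow> orth C X Y" "is_zero C X \<Longrightarrow> Y \<in> Ob C \<Longrightarrow> orth C Y X"
  by (auto simp: orth_def is_zero_def)

lemma is_iso_ident: "X \<in> Ob C \<Longrightarrow> is_iso C X X (ident C X)"
  using ident_in ident_left unfolding is_iso_def by metis

lemma isomorphic_refl: "X \<in> Ob C \<Longrightarrow> isomorphic C X X"
  using is_iso_ident isomorphic_def by metis

lemma isomorphic_sym: "isomorphic C X Y \<Longrightarrow> isomorphic C Y X"
  unfolding isomorphic_def is_iso_def by blast

lemma isomorphic_zero:
  assumes "isomorphic C X Y" "is_zero C X" "Y \<in> Ob C"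
  shows "is_zero C Y"
proof -
  obtain f g where fg: "f \<in> Mor C X Y" "g \<in> Mor C Y X" "f \<cdot> g = ident C Y"
    using assms unfolding isomorphic_def is_iso_def by blast
  have X: "X \<in> Ob C" using assms is_zero_Ob by blast
  have "f = zerom C X Y" using assms fg unfolding is_zero_def by blast
  then have "f \<cdot> g = zerom C Y Y" using fg assms X by simp
  then show ?thesis using fg assms is_zero_iff_ident by simp
qed

lemma isomorphic_zeros:
  assumes "is_zero C X" "is_zero C Y"
  shows "isomorphic C X Y"
proof -
  have X: "X \<in> Ob C" and Y: "Y \<in> Ob C" using assms is_zero_Ob by auto
  then have "zerom C Y X \<cdot> zerom C X Y = ident C X" "zerom C X Y \<cdot> zerom C Y X = ident C Y"
    using assms is_zero_iff_ident cmp_zero_right[of "zerom C Y X" Y X X] cmp_zero_right[of "zerom C X Y" X Y Y]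
    by simp_all
  then have "is_iso C X Y (zerom C X Y)"
    unfolding is_iso_def using X Y zerom_in by blast
  then show ?thesis unfolding isomorphic_def by blast
qed

end


section \<open>Exactness in a triangulated category\<close>

text \<open>For most arguments only the objects of a distinguished triangle matter.\<close>

definition tri :: "('k, 'o, 'm) tricat \<Rightarrow> 'o \<Rightarrow> 'o \<Rightarrow> 'o \<Rightarrow> bool" where
  "tri C X Y Z \<longleftrightarrow> (\<exists>f g h. (X, Y, Z, f, g, h) \<in> dist C)"

context triangulated_category
begin

lemma shift_Ob [simp]: "X \<in> Ob C \<Longrightarrow> shift C X \<in> Ob C"
  using shift_bij bij_betwE by blast

lemma shift_surj: "X \<in> Ob C \<Longrightarrow> \<exists>X'\<in>Ob C. X = shift C X'"
  using shift_bij unfolding bij_betw_def by blast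

lemma shiftm_in [simp]:
  "X \<in> Ob C \<Longrightarrow> Y \<in> Ob C \<Longrightarrow> f \<in> Mor C X Y \<Longrightarrow> shiftm C f \<in> Mor C (shift C X) (shift C Y)"
  using shiftm_bij bij_betwE by blast

lemma shiftm_surj:
  "X \<in> Ob C \<Longrightarrow> Y \<in> Ob C \<Longrightarrow> f \<in> Mor C (shift C X) (shift C Y) \<Longrightarrow> \<exists>f'\<in>Mor C X Y. f = shiftm C f'"
  using shiftm_bij unfolding bij_betw_def by blast

lemma shiftm_inj:
  "X \<in> Ob C \<Longrightarrow> Y \<in> Ob C \<Longrightarrow> f \<in> Mor C X Y \<Longrightarrow> g \<in> Mor C X Y \<Longrightarrow> shiftm C f = shiftm C g \<Longrightarrow> f = g"
  using shiftm_bij unfolding bij_betw_def inj_on_def by blast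

lemma shiftm_zero [simp]:
  assumes "X \<in> Ob C" "Y \<in> Ob C"
  shows "shiftm C (zerom C X Y) = zerom C (shift C X) (shift C Y)"
  using assms shiftm_add[of X Y "zerom C X Y" "zerom C X Y"] by (intro idempotent_zero) auto

lemma shiftm_uminus:
  assumes "X \<in> Ob C" "Y \<in> Ob C" "f \<in> Mor C X Y"
  shows "shiftm C (\<ominus>\<^bsub>Hom C X Y\<^esub> f) = \<ominus>\<^bsub>Hom C (shift C X) (shift C Y)\<^esub> shiftm C f"
  using assms shiftm_add[of X Y f "\<ominus>\<^bsub>Hom C X Y\<^esub> f"] by (intro uminus_unique) auto

lemma shift_zero_iff: "X \<in> Ob C \<Longrightarrow> is_zero C (shift C X) \<longleftrightarrow> is_zero C X"
  by (metis is_zero_iff_ident shift_Ob shiftm_ident shiftm_inj shiftm_zero ident_in zerom_in)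

lemma orth_shift_iff:
  assumes "X \<in> Ob C" "Y \<in> Ob C"
  shows "orth C (shift C X) (shift C Y) \<longleftrightarrow> orth C X Y"
proof
  assume *: "orth C (shift C X) (shift C Y)"
  show "orth C X Y"
  proof (rule orthI[OF assms])
    fix f assume f: "f \<in> Mor C X Y"
    then have "shiftm C f = shiftm C (zerom C X Y)" using orthD[OF *] assms by simp
    then show "f = zerom C X Y" using shiftm_inj f assms zerom_in by blast
  qed
next
  assume *: "orth C X Y"
  show "orth C (shift C X) (shift C Y)"
  proof (rule orthI)
    fix f assume "f \<in> Mor C (shift C X) (shift C Y)"
    then obtain f' where "f' \<in> Mor C X Y" "f = shiftm C f'" using shiftm_surj assms by blast
    then show "f = zerom C (shift C X) (shift C Y)" using orthD[OF *, of f'] assms shiftm_zero by auto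
  qed (use assms in auto)
qed

lemma distD:
  assumes "(X, Y, Z, f, g, h) \<in> dist C"
  shows "X \<in> Ob C" "Y \<in> Ob C" "Z \<in> Ob C" "f \<in> Mor C X Y" "g \<in> Mor C Y Z" "h \<in> Mor C Z (shift C X)"
  using dist_triangle[OF assms] unfolding triangle_def by auto

lemma triD: "tri C X Y Z \<Longrightarrow> X \<in> Ob C" "tri C X Y Z \<Longrightarrow> Y \<in> Ob C" "tri C X Y Z \<Longrightarrow> Z \<in> Ob C"
  unfolding tri_def using distD by blast+

lemma triI: "(X, Y, Z, f, g, h) \<in> dist C \<Longrightarrow> tri C X Y Z"
  unfolding tri_def by blast

lemma dist_rotate:
  "(X, Y, Z, f, g, h) \<in> dist C \<Longrightarrow>
    (Y, Z, shift C X, g, h, \<ominus>\<^bsub>Hom C (shift C X) (shift C Y)\<^esub> shiftm C f) \<in> dist C"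
  using TR2 dist_triangle by blast

lemma dist_unrotate:
  assumes "(X, Y, shift C Z, f, g, h) \<in> dist C" "Z \<in> Ob C"
  shows "\<exists>f'. (Z, X, Y, f', f, g) \<in> dist C \<and> f' \<in> Mor C Z X \<and> h = \<ominus>\<^bsub>Hom C (shift C Z) (shift C X)\<^esub> shiftm C f'"
proof -
  note d = distD[OF assms(1)]
  obtain f0 where f0: "f0 \<in> Mor C Z X" "h = shiftm C f0"
    using shiftm_surj[of Z X h] d assms by blast
  define f' where "f' = \<ominus>\<^bsub>Hom C Z X\<^esub> f0"
  have f': "f' \<in> Mor C Z X" "h = \<ominus>\<^bsub>Hom C (shift C Z) (shift C X)\<^esub> shiftm C f'"
    using f0 d assms by (auto simp: f'_def shiftm_uminus)
  have "triangle C Z X Y f' f g" unfolding triangle_def using d assms f' by auto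
  then have "(Z, X, Y, f', f, g) \<in> dist C" using TR2 assms(1) f'(2) by blast
  then show ?thesis using f' by blast
qed

lemma tri_rotate: "tri C X Y Z \<Longrightarrow> tri C Y Z (shift C X)"
  unfolding tri_def using dist_rotate by blast

lemma tri_unrotate: "tri C X Y (shift C Z) \<Longrightarrow> Z \<in> Ob C \<Longrightarrow> tri C Z X Y"
  unfolding tri_def using dist_unrotate by blast

lemma tri_shift_iff:
  assumes "X \<in> Ob C" "Y \<in> Ob C" "Z \<in> Ob C"
  shows "tri C (shift C X) (shift C Y) (shift C Z) \<longleftrightarrow> tri C X Y Z"
  using assms tri_rotate tri_unrotate shift_Ob by meson

text \<open>Comparing with the triangle of an identity, which exists on every object, gives the
  exactness of \<open>Hom\<close>.\<close>

lemma dist_cmp_zero: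
  assumes t: "(X, Y, Z, f, g, h) \<in> dist C"
  shows "g \<cdot> f = zerom C X Z"
proof -
  note d = distD[OF t]
  obtain N where N: "is_zero C N" using ex_zero by blast
  have "(X, X, N, ident C X, zerom C X N, zerom C N (shift C X)) \<in> dist C"
    using TR1_ident N d by blast
  then obtain c where "c \<in> Mor C N Z" "c \<cdot> zerom C X N = g \<cdot> f"
    using TR3[OF _ t ident_in[OF d(1)] d(4)] by blast
  then show ?thesis using d N is_zero_Ob by simp
qed

lemma dist_lift:
  assumes t: "(X, Y, Z, f, g, h) \<in> dist C"
    and W: "W \<in> Ob C" and w: "w \<in> Mor C W Y" and eq: "g \<cdot> w = zerom C W Z"
  shows "\<exists>v\<in>Mor C W X. f \<cdot> v = w"
proof -
  note d = distD[OF t]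
  obtain N where N: "is_zero C N" using ex_zero by blast
  then have N': "N \<in> Ob C" using is_zero_Ob by blast
  have "(W, W, N, ident C W, zerom C W N, zerom C N (shift C W)) \<in> dist C"
    using TR1_ident N W by blast
  from dist_rotate[OF this] have
    t1: "(W, N, shift C W, zerom C W N, zerom C N (shift C W),
       \<ominus>\<^bsub>Hom C (shift C W) (shift C W)\<^esub> shiftm C (ident C W)) \<in> dist C" .
  have "zerom C N Z \<cdot> zerom C W N = g \<cdot> w" using eq d W N' cmp_zero_right[of "zerom C N Z" N Z W] by simp
  from TR3[OF t1 dist_rotate[OF t] w zerom_in[OF N' d(3)] this]
  obtain c where c: "c \<in> Mor C (shift C W) (shift C X)"
    "shiftm C w \<cdot> (\<ominus>\<^bsub>Hom C (shift C W) (shift C W)\<^esub> shiftm C (ident C W)) =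
      (\<ominus>\<^bsub>Hom C (shift C X) (shift C Y)\<^esub> shiftm C f) \<cdot> c" by blast
  obtain v where v: "v \<in> Mor C W X" "c = shiftm C v" using shiftm_surj c W d by blast
  have "\<ominus>\<^bsub>Hom C (shift C W) (shift C Y)\<^esub> shiftm C w =
      \<ominus>\<^bsub>Hom C (shift C W) (shift C Y)\<^esub> (shiftm C f \<cdot> shiftm C v)"
    using c(2) v d W w cmp_uminus_right[of "shift C W" "shift C W" "shift C Y" "shiftm C w" "ident C (shift C W)"]
      cmp_uminus_left[of "shift C W" "shift C X" "shift C Y" "shiftm C f" "shiftm C v"]
      cmp_ident[of "shiftm C w" "shift C W" "shift C Y"]
    by (simp add: shiftm_ident ident_in)
  then have "shiftm C w = shiftm C f \<cdot> shiftm C v"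
    using v d W w by (metis minus_minus cmp_in shift_Ob shiftm_in)
  then have "shiftm C w = shiftm C (f \<cdot> v)" using shiftm_cmp v d W by simp
  then have "f \<cdot> v = w" using shiftm_inj[of W Y "f \<cdot> v" w] v d W w cmp_in by simp
  then show ?thesis using v by blast
qed

lemma dist_extend:
  assumes t: "(X, Y, Z, f, g, h) \<in> dist C"
    and W: "W \<in> Ob C" and w: "w \<in> Mor C Y W" and eq: "w \<cdot> f = zerom C X W"
  shows "\<exists>v\<in>Mor C Z W. v \<cdot> g = w"
proof -
  note d = distD[OF t]
  obtain N where N: "is_zero C N" using ex_zero by blast
  then have N': "N \<in> Ob C" using is_zero_Ob by blast
  have NN: "is_zero C (shift C N)" using N N' shift_zero_iff by simp
  have "triangle C N W W (zerom C N W) (ident C W) (zerom C W (shift C N))"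
    unfolding triangle_def using N' W ident_in by simp
  moreover have "(W, W, shift C N, ident C W, zerom C W (shift C N), zerom C (shift C N) (shift C W)) \<in> dist C"
    using TR1_ident NN W by blast
  ultimately have t1: "(N, W, W, zerom C N W, ident C W, zerom C W (shift C N)) \<in> dist C"
    using TR2 N' W by simp
  have "w \<cdot> f = zerom C N W \<cdot> zerom C X N" using eq d N' W by (metis cmp_zero_left zerom_in)
  from TR3[OF t t1 zerom_in[OF d(1) N'] w this]
  obtain c where "c \<in> Mor C Z W" "c \<cdot> g = ident C W \<cdot> w" by blast
  then show ?thesis using ident_left w d W by auto
qed

lemma dist_lift':
  assumes t: "(X, Y, Z, f, g, h) \<in> dist C"
    and W: "W \<in> Ob C" and w: "w \<in> Mor C W Z" and eq: "h \<cdot> w = zerom C W (shift C X)"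
  shows "\<exists>v\<in>Mor C W Y. g \<cdot> v = w"
  using dist_lift[OF dist_rotate[OF t] W w eq] .

lemma dist_extend':
  assumes t: "(X, Y, Z, f, g, h) \<in> dist C"
    and W: "W \<in> Ob C" and w: "w \<in> Mor C Z W" and eq: "w \<cdot> g = zerom C Y W"
  shows "\<exists>v\<in>Mor C (shift C X) W. v \<cdot> h = w"
  using dist_extend[OF dist_rotate[OF t] W w eq] .

lemma orth_mid_right:
  assumes "tri C X Y Z" "W \<in> Ob C" "orth C W X" "orth C W Z"
  shows "orth C W Y"
proof -
  obtain f g h where t: "(X, Y, Z, f, g, h) \<in> dist C" using assms tri_def by metis
  note d = distD[OF t]
  show ?thesis
  proof (rule orthI)
    fix w assume w: "w \<in> Mor C W Y"
    have "g \<cdot> w = zerom C W Z" using orthD assms cmp_in w d by metis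
    from dist_lift[OF t _ w this] obtain v where "v \<in> Mor C W X" "f \<cdot> v = w" using assms by blast
    moreover have "v = zerom C W X" using calculation orthD assms by metis
    ultimately show "w = zerom C W Y" using d assms by simp
  qed (use d assms in auto)
qed

lemma orth_mid_left:
  assumes "tri C X Y Z" "W \<in> Ob C" "orth C X W" "orth C Z W"
  shows "orth C Y W"
proof -
  obtain f g h where t: "(X, Y, Z, f, g, h) \<in> dist C" using assms tri_def by metis
  note d = distD[OF t]
  show ?thesis
  proof (rule orthI)
    fix w assume w: "w \<in> Mor C Y W"
    have "w \<cdot> f = zerom C X W" using orthD assms cmp_in w d by metis
    from dist_extend[OF t _ w this] obtain v where "v \<in> Mor C Z W" "v \<cdot> g = w" using assms by blast
    moreover have "v = zerom C Z W" using calculation orthD assms by metis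
    ultimately show "w = zerom C Y W" using d assms by simp
  qed (use d assms in auto)
qed

text \<open>If \<open>U \<rightarrow> X\<close> is zero then the identity of \<open>U[1]\<close> factors through the third vertex; in the
  applications \<open>U\<close> is the first step of a filtration whose later factors admit no maps from
  \<open>U[1]\<close>.  The second lemma is the dual.\<close>

lemma tri_first_zero:
  assumes "tri C U X V" "orth C U X" "orth C (shift C U) V"
  shows "is_zero C U"
proof -
  obtain f g h where t: "(U, X, V, f, g, h) \<in> dist C" using assms tri_def by metis
  note d = distD[OF t]
  have f0: "f = zerom C U X" using assms d orthD by metis
  have "\<exists>s\<in>Mor C (shift C U) V. h \<cdot> s = ident C (shift C U)"
  proof (rule dist_lift'[OF dist_rotate[OF t]])
    show "(\<ominus>\<^bsub>Hom C (shift C U) (shift C X)\<^esub> shiftm C f) \<cdot> ident C (shift C U) = zerom C (shift C U) (shift C X)"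
      using d f0 ident_in by simp
  qed (use d ident_in in auto)
  then obtain s where s: "s \<in> Mor C (shift C U) V" "h \<cdot> s = ident C (shift C U)" by blast
  have "s = zerom C (shift C U) V" using s assms orthD by metis
  then have "is_zero C (shift C U)" using s d is_zero_iff_ident[of "shift C U"] by simp
  then show ?thesis using d shift_zero_iff by simp
qed

lemma tri_last_zero:
  assumes "tri C U X V" "orth C X V" "orth C (shift C U) V"
  shows "is_zero C V"
proof -
  obtain f g h where t: "(U, X, V, f, g, h) \<in> dist C" using assms tri_def by metis
  note d = distD[OF t]
  have "g = zerom C X V" using assms d orthD by metis
  then have "ident C V \<cdot> g = zerom C X V" using d ident_in by simp
  from dist_extend'[OF t _ _ this] obtain s where s: "s \<in> Mor C (shift C U) V" "s \<cdot> h = ident C V"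
    using d ident_in by blast
  have "s = zerom C (shift C U) V" using s assms orthD by metis
  then show ?thesis using s d is_zero_iff_ident[of V] by simp
qed


subsection \<open>Isomorphisms and degenerate triangles\<close>

lemma dist_third_zero_iso:
  assumes t: "(X, Y, Z, f, g, h) \<in> dist C" and Z: "is_zero C Z"
  shows "is_iso C X Y f"
proof -
  note d = distD[OF t]
  obtain Z' where Z': "Z' \<in> Ob C" "Z = shift C Z'" using shift_surj d by blast
  have zZ': "is_zero C Z'" using Z Z' shift_zero_iff by simp
  obtain f' where t': "(Z', X, Y, f', f, g) \<in> dist C" "f' \<in> Mor C Z' X"
    using dist_unrotate[of X Y Z' f g h] t Z' by blast
  have "g \<cdot> ident C Y = zerom C Y Z" using d Z orthD orth_zero ident_in cmp_in by metis
  then obtain v where v: "v \<in> Mor C Y X" "f \<cdot> v = ident C Y"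
    using dist_lift[OF t d(2) ident_in[OF d(2)]] by blast
  have "ident C X \<cdot> f' = zerom C Z' X"
    using t' d zZ' Z' orthD orth_zero ident_in cmp_in by metis
  then obtain v' where v': "v' \<in> Mor C Y X" "v' \<cdot> f = ident C X"
    using dist_extend[OF t'(1) d(1) ident_in[OF d(1)]] by blast
  have "v' = v' \<cdot> (f \<cdot> v)" using v v' d ident_right by simp
  also have "\<dots> = (v' \<cdot> f) \<cdot> v" using v v' d cmp_assoc by metis
  also have "\<dots> = v" using v v' d ident_left by simp
  finally show ?thesis using v v' d unfolding is_iso_def by auto
qed

lemma tri_third_zero: "tri C X Y Z \<Longrightarrow> is_zero C Z \<Longrightarrow> isomorphic C X Y"
  unfolding tri_def isomorphic_def using dist_third_zero_iso by blast

lemma tri_first_zero_iso: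
  assumes "tri C X Y Z" "is_zero C X"
  shows "isomorphic C Y Z"
  using assms tri_rotate tri_third_zero shift_zero_iff triD by metis

lemma tri_mid_iso:
  assumes "tri C X Y Z" "isomorphic C Y Y'" "Y' \<in> Ob C"
  shows "tri C X Y' Z"
proof -
  obtain f g h where t: "(X, Y, Z, f, g, h) \<in> dist C" using assms tri_def by metis
  note d = distD[OF t]
  obtain b b' where b: "is_iso C Y Y' b" "b \<in> Mor C Y Y'" "b' \<in> Mor C Y' Y" "b' \<cdot> b = ident C Y"
    using assms unfolding isomorphic_def is_iso_def by blast
  have "(X, Y', Z, b \<cdot> f, g \<cdot> b', h) \<in> dist C"
  proof (rule TR1_iso[OF t _ is_iso_ident b(1) is_iso_ident])
    show "triangle C X Y' Z (b \<cdot> f) (g \<cdot> b') h"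
      unfolding triangle_def using d b assms cmp_in[of X Y Y'] cmp_in[of Y' Y Z] by auto
    show "b \<cdot> f = (b \<cdot> f) \<cdot> ident C X" using d b assms cmp_in ident_right by metis
    show "ident C Z \<cdot> g = (g \<cdot> b') \<cdot> b"
      using d b assms cmp_assoc[of Y Y' Y Z g b' b] ident_left ident_right by auto
    show "shiftm C (ident C X) \<cdot> h = h \<cdot> ident C Z"
      using d shiftm_ident by simp
  qed (use d in auto)
  then show ?thesis by (rule triI)
qed

lemma isomorphic_shift_iff:
  assumes "X \<in> Ob C" "Y \<in> Ob C"
  shows "isomorphic C (shift C X) (shift C Y) \<longleftrightarrow> isomorphic C X Y"
proof
  assume "isomorphic C X Y"
  then obtain f g where "f \<in> Mor C X Y" "g \<in> Mor C Y X" "g \<cdot> f = ident C X" "f \<cdot> g = ident C Y"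
    unfolding isomorphic_def is_iso_def by blast
  then have "is_iso C (shift C X) (shift C Y) (shiftm C f)"
    unfolding is_iso_def using assms by (metis shiftm_cmp shiftm_ident shiftm_in)
  then show "isomorphic C (shift C X) (shift C Y)" unfolding isomorphic_def by blast
next
  assume "isomorphic C (shift C X) (shift C Y)"
  then obtain f g where fg: "f \<in> Mor C (shift C X) (shift C Y)" "g \<in> Mor C (shift C Y) (shift C X)"
    "g \<cdot> f = ident C (shift C X)" "f \<cdot> g = ident C (shift C Y)"
    unfolding isomorphic_def is_iso_def by blast
  obtain f' g' where f': "f' \<in> Mor C X Y" "f = shiftm C f'" "g' \<in> Mor C Y X" "g = shiftm C g'"
    using shiftm_surj fg assms by metis
  have "g' \<cdot> f' = ident C X"
  proof (rule shiftm_inj)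
    show "g' \<cdot> f' \<in> Mor C X X" using cmp_in f' assms by blast
    show "shiftm C (g' \<cdot> f') = shiftm C (ident C X)"
      using shiftm_cmp[of X Y X g' f'] shiftm_ident fg f' assms by simp
  qed (use assms ident_in in auto)
  moreover have "f' \<cdot> g' = ident C Y"
  proof (rule shiftm_inj)
    show "f' \<cdot> g' \<in> Mor C Y Y" using cmp_in f' assms by blast
    show "shiftm C (f' \<cdot> g') = shiftm C (ident C Y)"
      using shiftm_cmp[of Y X Y f' g'] shiftm_ident fg f' assms by simp
  qed (use assms ident_in in auto)
  ultimately show "isomorphic C X Y" using f' unfolding isomorphic_def is_iso_def by blast
qed

lemma tri_third_iso:
  assumes "tri C X Y Z" "isomorphic C Z Z'" "Z' \<in> Ob C"
  shows "tri C X Y Z'"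
  using assms tri_mid_iso[OF tri_rotate] tri_unrotate triD by blast

lemma tri_first_iso:
  assumes "tri C X Y Z" "isomorphic C X X'" "X' \<in> Ob C"
  shows "tri C X' Y Z"
  using assms tri_third_iso[OF tri_rotate] tri_unrotate triD isomorphic_shift_iff shift_Ob by metis

lemma tri_isoI:
  assumes "isomorphic C X Y" "X \<in> Ob C" "Y \<in> Ob C" "is_zero C N"
  shows "tri C X Y N" "tri C N X Y"
proof -
  have "tri C X X N" using TR1_ident assms triI by metis
  then show *: "tri C X Y N" using assms tri_mid_iso by blast
  obtain N' where N': "N' \<in> Ob C" "N = shift C N'" using shift_surj assms is_zero_Ob by blast
  have "tri C N' X Y" using * N' tri_unrotate by simp
  then show "tri C N X Y"
    using N' assms isomorphic_zeros[of N' N] shift_zero_iff[of N'] is_zero_Ob[of N]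
    by (intro tri_first_iso[of N' X Y N]) auto
qed

lemma octahedral_push:
  assumes "tri C S A A'" "tri C A X B"
  shows "\<exists>Y. tri C S X Y \<and> tri C A' Y B"
proof -
  obtain f u u' where 1: "(S, A, A', f, u, u') \<in> dist C" using assms tri_def by metis
  obtain g v v' where 2: "(A, X, B, g, v, v') \<in> dist C" using assms tri_def by metis
  note d = distD[OF 1] distD[OF 2]
  have "g \<cdot> f \<in> Mor C S X" using cmp_in d by blast
  then obtain Y w w' where 3: "(S, X, Y, g \<cdot> f, w, w') \<in> dist C" using TR1_cone d by blast
  show ?thesis using TR4[OF 1 2 3] triI[OF 3] unfolding tri_def by blast
qed

lemma octahedral_pull:
  assumes "tri C S X Y" "tri C A' Y B"
  shows "\<exists>A. tri C S A A' \<and> tri C A X B"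
proof -
  obtain A1 where A1: "tri C X B A1" "tri C (shift C S) A1 (shift C A')"
    using octahedral_push[OF tri_rotate tri_rotate, of S X Y A' B] 
      octahedral_push[of X Y "shift C S" B "shift C A'"] tri_rotate assms by blast
  obtain A where A: "A \<in> Ob C" "A1 = shift C A" using shift_surj A1 triD by blast
  have "tri C A X B" using A1 A tri_unrotate by blast
  moreover have "tri C S A A'" using A1 A tri_shift_iff triD assms by metis
  ultimately show ?thesis by blast
qed

text \<open>A vanishing connecting map provides a section of \<open>Y \<rightarrow> Z\<close>, and the octahedron over the identity
  \<open>Z \<rightarrow> Y \<rightarrow> Z\<close> identifies the cone of this section with \<open>X\<close>.\<close>

lemma dist_swap:
  assumes t: "(X, Y, Z, f, g, zerom C Z (shift C X)) \<in> dist C"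
  shows "tri C Z Y X"
proof -
  note d = distD[OF t]
  have "zerom C Z (shift C X) \<cdot> ident C Z = zerom C Z (shift C X)"
    using d cmp_ident[of "zerom C Z (shift C X)" Z "shift C X"] by simp
  then obtain s where s: "s \<in> Mor C Z Y" "g \<cdot> s = ident C Z"
    using dist_lift'[OF t d(3) ident_in[OF d(3)]] by blast
  obtain W u u' where W: "(Z, Y, W, s, u, u') \<in> dist C" using TR1_cone s d by blast
  obtain N where N: "is_zero C N" using ex_zero by blast
  have idt: "(Z, Z, N, g \<cdot> s, zerom C Z N, zerom C N (shift C Z)) \<in> dist C"
    using TR1_ident N s d by simp
  have "tri C W N (shift C X)" using TR4[OF W dist_rotate[OF t] idt] unfolding tri_def by blast
  then have "tri C X W N" using tri_unrotate d by blast
  then have "isomorphic C W X" using N tri_third_zero isomorphic_sym by blast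
  then show ?thesis by (rule tri_third_iso[OF triI[OF W] _ d(1)])
qed

lemma tri_swap:
  assumes "tri C X Y Z" "orth C Z (shift C X)"
  shows "tri C Z Y X"
proof -
  obtain f g h where t: "(X, Y, Z, f, g, h) \<in> dist C" using assms tri_def by metis
  have "h = zerom C Z (shift C X)" using orthD[OF assms(2)] distD[OF t] by blast
  then show ?thesis using dist_swap t by blast
qed

text \<open>At the other extreme, an invertible connecting map forces the other two maps of the triangle to
  vanish, so that the outer vertices cancel.\<close>

lemma dist_connecting_iso_zero:
  assumes t: "(X, Y, Z, f, g, h) \<in> dist C" and h: "is_iso C Z (shift C X) h"
  shows "is_zero C Y"
proof -
  note d = distD[OF t]
  obtain h' where h': "h' \<in> Mor C (shift C X) Z" "h' \<cdot> h = ident C Z"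
    using h unfolding is_iso_def by blast
  have "h \<cdot> g = zerom C Y (shift C X)" using dist_cmp_zero dist_rotate[OF t] by blast
  then have "h' \<cdot> (h \<cdot> g) = zerom C Y Z" using h' d by simp
  then have g: "g = zerom C Y Z"
    using cmp_assoc[of Y Z "shift C X" Z h' h g] h' d by simp
  obtain v where v: "v \<in> Mor C Y X" "f \<cdot> v = ident C Y"
    using dist_lift[OF t d(2) ident_in[OF d(2)]] g d cmp_ident[of "zerom C Y Z" Y Z] by auto
  have fh: "(\<ominus>\<^bsub>Hom C (shift C X) (shift C Y)\<^esub> shiftm C f) \<cdot> h = zerom C Z (shift C Y)"
    using dist_cmp_zero dist_rotate[OF dist_rotate[OF t]] by blast
  obtain h'' where h'': "h'' \<in> Mor C (shift C X) Z" "h \<cdot> h'' = ident C (shift C X)"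
    using h unfolding is_iso_def by blast
  have "\<ominus>\<^bsub>Hom C (shift C X) (shift C Y)\<^esub> shiftm C f = zerom C (shift C X) (shift C Y)"
    using cmp_assoc[of "shift C X" Z "shift C X" "shift C Y" "\<ominus>\<^bsub>Hom C (shift C X) (shift C Y)\<^esub> shiftm C f" h h'']
      fh h'' d cmp_ident[of "\<ominus>\<^bsub>Hom C (shift C X) (shift C Y)\<^esub> shiftm C f" "shift C X" "shift C Y"] by simp
  then have "shiftm C f = zerom C (shift C X) (shift C Y)"
    using d minus_minus[of "shift C X" "shift C Y" "shiftm C f"] by simp
  then have "f = zerom C X Y" using shiftm_inj[of X Y f "zerom C X Y"] d by simp
  then show ?thesis using v d is_zero_iff_ident[of Y] by simp
qed

text \<open>A biproduct is a split extension; the cone of the first inclusion is identified with the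
  second summand.\<close>

lemma biproduct_tri:
  assumes "is_biproduct C X Y B"
  shows "tri C X B Y"
proof -
  have X: "X \<in> Ob C" and Y: "Y \<in> Ob C" and B: "B \<in> Ob C"
    using assms unfolding is_biproduct_def by auto
  obtain i1 i2 p1 p2 where i1: "i1 \<in> Mor C X B" and i2: "i2 \<in> Mor C Y B"
    and p1: "p1 \<in> Mor C B X" and p2: "p2 \<in> Mor C B Y"
    and eqs: "p1 \<cdot> i1 = ident C X" "p2 \<cdot> i2 = ident C Y" "p1 \<cdot> i2 = zerom C Y X"
      "p2 \<cdot> i1 = zerom C X Y" "(i1 \<cdot> p1) \<oplus>\<^bsub>Hom C B B\<^esub> (i2 \<cdot> p2) = ident C B"
    using assms unfolding is_biproduct_def by blast
  obtain Q g h where t: "(X, B, Q, i1, g, h) \<in> dist C" using TR1_cone X B i1 by blast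
  note d = distD[OF t]
  \<comment> \<open>The inclusion has a left inverse, so the connecting map vanishes.\<close>
  have "(\<ominus>\<^bsub>Hom C (shift C X) (shift C B)\<^esub> shiftm C i1) \<cdot> h = zerom C Q (shift C B)"
    using dist_cmp_zero dist_rotate[OF dist_rotate[OF t]] by blast
  then have "\<ominus>\<^bsub>Hom C Q (shift C B)\<^esub> (shiftm C i1 \<cdot> h) = zerom C Q (shift C B)"
    using cmp_uminus_left[of Q "shift C X" "shift C B" "shiftm C i1" h] d i1 X B by simp
  then have "shiftm C i1 \<cdot> h = zerom C Q (shift C B)"
    using minus_minus[of Q "shift C B" "shiftm C i1 \<cdot> h"] cmp_in[of Q "shift C X" "shift C B"] d i1 X B by simp
  then have "shiftm C p1 \<cdot> (shiftm C i1 \<cdot> h) = zerom C Q (shift C X)"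
    using d p1 X B by simp
  moreover have "shiftm C p1 \<cdot> (shiftm C i1 \<cdot> h) = shiftm C (p1 \<cdot> i1) \<cdot> h"
    using cmp_assoc[of Q "shift C X" "shift C B" "shift C X" "shiftm C p1" "shiftm C i1" h]
      shiftm_cmp[of X B X p1 i1] d i1 p1 X B by simp
  ultimately have h0: "h = zerom C Q (shift C X)"
    using eqs d X by (simp add: shiftm_ident ident_left)
  obtain c where c: "c \<in> Mor C Q Y" "c \<cdot> g = p2"
    using dist_extend[OF t Y p2 eqs(4)] by blast
  define e where "e = g \<cdot> i2"
  have e: "e \<in> Mor C Y Q" using e_def d i2 Y cmp_in[of Y B Q] by simp
  have ce: "c \<cdot> e = ident C Y"
    using cmp_assoc[of Y B Q Y c g i2] c d i2 Y eqs e_def by simp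
  have ec: "e \<cdot> c = ident C Q"
  proof -
    have "(e \<cdot> c) \<cdot> g = e \<cdot> p2" using cmp_assoc[of B Q Y Q e c g] c e d Y by simp
    also have "\<dots> = g \<cdot> (i2 \<cdot> p2)" unfolding e_def using cmp_assoc[of B Y B Q g i2 p2] d i2 p2 Y by simp
    also have "\<dots> = (g \<cdot> (i1 \<cdot> p1)) \<oplus>\<^bsub>Hom C B Q\<^esub> (g \<cdot> (i2 \<cdot> p2))"
    proof -
      have "g \<cdot> (i1 \<cdot> p1) = (g \<cdot> i1) \<cdot> p1" using cmp_assoc[of B X B Q g i1 p1] d i1 p1 X by simp
      also have "\<dots> = zerom C B Q" using dist_cmp_zero[OF t] d p1 X by simp
      finally show ?thesis using cmp_in[of B B Q g "i2 \<cdot> p2"] cmp_in[of B Y B i2 p2] d i2 p2 Y B by simp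
    qed
    also have "\<dots> = g \<cdot> ident C B"
      using cmp_add_right[of B B Q g "i1 \<cdot> p1" "i2 \<cdot> p2"] eqs(5) cmp_in[of B X B i1 p1] cmp_in[of B Y B i2 p2]
        d i1 p1 i2 p2 X Y B by simp
    finally have eg: "(e \<cdot> c) \<cdot> g = g" using d ident_right by simp
    define w where "w = (e \<cdot> c) \<oplus>\<^bsub>Hom C Q Q\<^esub> (\<ominus>\<^bsub>Hom C Q Q\<^esub> ident C Q)"
    have ecQ: "e \<cdot> c \<in> Mor C Q Q" using cmp_in[of Q Y Q e c] e c d Y by simp
    have w: "w \<in> Mor C Q Q" using w_def ecQ d ident_in by simp
    have "w \<cdot> g = zerom C B Q"
      unfolding w_def using cmp_add_left[of B Q Q "e \<cdot> c" "\<ominus>\<^bsub>Hom C Q Q\<^esub> ident C Q" g]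
        cmp_uminus_left[of B Q Q "ident C Q" g] eg ecQ d ident_in ident_left by simp
    then obtain v where "v \<in> Mor C (shift C X) Q" "v \<cdot> h = w" using dist_extend'[OF t d(3) w] by blast
    then have w0: "w = zerom C Q Q" using h0 d X by simp
    show ?thesis using diff_zero_imp_eq[OF d(3,3) ecQ ident_in[OF d(3)]] w0 unfolding w_def .
  qed
  have "isomorphic C Q Y" unfolding isomorphic_def is_iso_def using c e ce ec by blast
  then show ?thesis by (rule tri_third_iso[OF triI[OF t] _ Y])
qed

end

section \<open>Filtrations and shifts\<close>

text \<open>The objects with a filtration whose successive factors are isomorphic to the members of a
  list; in the literature, the product \<open>S1 * \<dots> * Sm\<close>.\<close>

primrec Filt :: "('k, 'o, 'm) tricat \<Rightarrow> 'o list \<Rightarrow> 'o set" where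
  "Filt C [] = {X. is_zero C X}"
| "Filt C (S # w) = {X. \<exists>Y\<in>Filt C w. tri C S X Y}"

definition letter :: "('k, 'o, 'm) tricat \<Rightarrow> 'o \<times> int \<Rightarrow> 'o" where
  "letter C = (\<lambda>(S, p). shift_by C p S)"

context triangulated_category
begin

lemma Filt_Ob: "X \<in> Filt C w \<Longrightarrow> X \<in> Ob C"
  by (cases w) (auto simp: is_zero_Ob dest: triD)

lemma Filt_iso:
  assumes "X \<in> Filt C w" "isomorphic C X Y" "Y \<in> Ob C"
  shows "Y \<in> Filt C w"
  using assms by (cases w) (auto intro: isomorphic_zero tri_mid_iso)

lemma tri_ident_left: "X \<in> Ob C \<Longrightarrow> is_zero C N \<Longrightarrow> tri C N X X"
  using tri_isoI(2)[OF isomorphic_refl] by blast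

lemma tri_ident_right: "X \<in> Ob C \<Longrightarrow> is_zero C N \<Longrightarrow> tri C X X N"
  using tri_isoI(1)[OF isomorphic_refl] by blast

lemma tri_shift_self: "X \<in> Ob C \<Longrightarrow> is_zero C N \<Longrightarrow> tri C X N (shift C X)"
  using tri_rotate[OF tri_ident_right] by blast

text \<open>Associativity of the product, which is the octahedral axiom.\<close>

lemma Filt_append: "X \<in> Filt C (u @ v) \<longleftrightarrow> (\<exists>A\<in>Filt C u. \<exists>B\<in>Filt C v. tri C A X B)"
proof (induction u arbitrary: X)
  case Nil
  obtain N where N: "is_zero C N" using ex_zero by blast
  show ?case
  proof
    assume "X \<in> Filt C ([] @ v)"
    then show "\<exists>A\<in>Filt C []. \<exists>B\<in>Filt C v. tri C A X B"
      using N tri_ident_left Filt_Ob by fastforce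
  next
    assume "\<exists>A\<in>Filt C []. \<exists>B\<in>Filt C v. tri C A X B"
    then obtain A B where "is_zero C A" "B \<in> Filt C v" "tri C A X B" by auto
    then show "X \<in> Filt C ([] @ v)"
      using tri_first_zero_iso isomorphic_sym Filt_iso triD(2) by (metis append_Nil)
  qed
next
  case (Cons S u)
  show ?case
  proof
    assume "X \<in> Filt C ((S # u) @ v)"
    then obtain Y A B where "tri C S X Y" "A \<in> Filt C u" "B \<in> Filt C v" "tri C A Y B"
      using Cons by auto
    then show "\<exists>A\<in>Filt C (S # u). \<exists>B\<in>Filt C v. tri C A X B"
      using octahedral_pull[of S X Y A B] by auto
  next
    assume "\<exists>A\<in>Filt C (S # u). \<exists>B\<in>Filt C v. tri C A X B"
    then obtain A B A' where "tri C A X B" "B \<in> Filt C v" "A' \<in> Filt C u" "tri C S A A'" by auto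
    then show "X \<in> Filt C ((S # u) @ v)"
      using octahedral_push[of S A A' X B] Cons by auto
  qed
qed

lemma Filt_single:
  assumes "S \<in> Ob C"
  shows "Filt C [S] = {X \<in> Ob C. isomorphic C S X}"
proof (intro equalityI subsetI)
  fix X assume "X \<in> Filt C [S]"
  then obtain N where "is_zero C N" "tri C S X N" by auto
  then show "X \<in> {X \<in> Ob C. isomorphic C S X}" using tri_third_zero triD(2) by blast
next
  fix X assume X: "X \<in> {X \<in> Ob C. isomorphic C S X}"
  obtain N where N: "is_zero C N" using ex_zero by blast
  have "tri C S X N" using X N assms tri_isoI(1) by blast
  then show "X \<in> Filt C [S]" using N by auto
qed

lemma Filt_single_self: "S \<in> Ob C \<Longrightarrow> S \<in> Filt C [S]"
  using Filt_single isomorphic_refl by blast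

lemma Filt_pair: "Filt C [S, S'] = {X. tri C S X S'}"
proof (intro equalityI subsetI)
  fix X assume "X \<in> Filt C [S, S']"
  then obtain Y N where "tri C S X Y" "tri C S' Y N" "is_zero C N" by auto
  then show "X \<in> {X. tri C S X S'}"
    using tri_third_iso[of S X Y S'] tri_third_zero[of S' Y N] isomorphic_sym triD by blast
next
  fix X assume "X \<in> {X. tri C S X S'}"
  then show "X \<in> Filt C [S, S']" using Filt_single_self[of S'] triD(3) by auto
qed

lemma orth_Filt_right:
  assumes "Y \<in> Filt C w" "X \<in> Ob C" "\<And>S. S \<in> set w \<Longrightarrow> orth C X S"
  shows "orth C X Y"
  using assms
proof (induction w arbitrary: Y)
  case Nil
  then show ?case using orth_zero(2) by simp
next
  case (Cons S w)
  then obtain Z where Z: "Z \<in> Filt C w" "tri C S Y Z" by auto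
  have "orth C X Z" by (rule Cons.IH[OF Z(1)]) (use Cons.prems in auto)
  then show ?case using orth_mid_right[OF Z(2)] Cons.prems by simp
qed

lemma orth_Filt_left:
  assumes "X \<in> Filt C w" "Y \<in> Ob C" "\<And>S. S \<in> set w \<Longrightarrow> orth C S Y"
  shows "orth C X Y"
  using assms
proof (induction w arbitrary: X)
  case Nil
  then show ?case using orth_zero(1) by simp
next
  case (Cons S w)
  then obtain Z where Z: "Z \<in> Filt C w" "tri C S X Z" by auto
  have "orth C Z Y" by (rule Cons.IH[OF Z(1)]) (use Cons.prems in auto)
  then show ?case using orth_mid_left[OF Z(2)] Cons.prems by simp
qed

lemma ext_closure_iff_Filt:
  assumes "S \<subseteq> Ob C"
  shows "X \<in> ext_closure C S \<longleftrightarrow> (\<exists>w. set w \<subseteq> S \<and> X \<in> Filt C w)"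
proof
  assume "X \<in> ext_closure C S"
  then show "\<exists>w. set w \<subseteq> S \<and> X \<in> Filt C w"
  proof induction
    case (zero X)
    then show ?case by (intro exI[of _ "[]"]) auto
  next
    case (base X)
    then show ?case using assms Filt_single_self by (intro exI[of _ "[X]"]) auto
  next
    case (ext X Y Z f g h)
    then obtain u v where uv: "set u \<subseteq> S" "X \<in> Filt C u" "set v \<subseteq> S" "Z \<in> Filt C v" by blast
    moreover have "tri C X Y Z" using ext triI by blast
    ultimately show ?case using Filt_append by (intro exI[of _ "u @ v"]) auto
  qed
next
  assume "\<exists>w. set w \<subseteq> S \<and> X \<in> Filt C w"
  then obtain w where "set w \<subseteq> S" "X \<in> Filt C w" by blast
  then show "X \<in> ext_closure C S"
    by (induction w arbitrary: X) (auto simp: tri_def intro: ext_closure.intros)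
qed


subsection \<open>Iterated shifts\<close>

lemma shift_by_0 [simp]: "shift_by C 0 X = X"
  by (simp add: shift_by_def)

lemma funpow_inv_shift_Ob: "X \<in> Ob C \<Longrightarrow> (inv_into (Ob C) (shift C) ^^ m) X \<in> Ob C"
  by (induction m) (use shift_bij in \<open>auto simp: bij_betw_def inv_into_into\<close>)

lemma funpow_shift_Ob: "X \<in> Ob C \<Longrightarrow> (shift C ^^ m) X \<in> Ob C"
  by (induction m) auto

lemma shift_by_Ob [simp]: "X \<in> Ob C \<Longrightarrow> shift_by C p X \<in> Ob C"
  by (simp add: shift_by_def funpow_inv_shift_Ob funpow_shift_Ob)

lemma shift_shift_by:
  assumes "X \<in> Ob C"
  shows "shift C (shift_by C p X) = shift_by C (p + 1) X"
proof (cases "0 \<le> p")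
  case True
  then show ?thesis by (simp add: shift_by_def nat_add_distrib)
next
  case False
  define m where "m = nat (- p - 1)"
  have p: "p = - int (Suc m)" using False m_def by simp
  have "shift C (shift_by C p X) = (inv_into (Ob C) (shift C) ^^ m) X"
    using funpow_inv_shift_Ob[OF assms, of m] shift_bij
    by (simp add: p shift_by_def f_inv_into_f bij_betw_def nat_add_distrib)
  also have "\<dots> = shift_by C (p + 1) X"
    by (cases m) (auto simp: p shift_by_def nat_add_distrib)
  finally show ?thesis .
qed

lemma shift_inj: "X \<in> Ob C \<Longrightarrow> Y \<in> Ob C \<Longrightarrow> shift C X = shift C Y \<longleftrightarrow> X = Y"
  using shift_bij unfolding bij_betw_def inj_on_def by blast

lemma shift_by_induct:
  assumes "Q 0" and "\<And>p. Q (p + 1) \<longleftrightarrow> Q p"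
  shows "Q (p :: int)"
proof (induction p rule: int_induct[of _ 0])
  case base
  show ?case by (rule assms(1))
next
  case (step1 i)
  then show ?case using assms(2) by blast
next
  case (step2 i)
  then show ?case using assms(2)[of "i - 1"] by simp
qed

lemma shift_by_shift_by:
  assumes "X \<in> Ob C"
  shows "shift_by C p (shift_by C q X) = shift_by C (p + q) X"
proof (induction p rule: shift_by_induct)
  case (2 p)
  have "shift_by C (p + 1) (shift_by C q X) = shift C (shift_by C p (shift_by C q X))"
    "shift_by C (p + 1 + q) X = shift C (shift_by C (p + q) X)"
    using assms by (simp_all add: shift_shift_by algebra_simps)
  then show ?case using assms shift_inj by simp
qed simp

lemma shift_by_inverse: "X \<in> Ob C \<Longrightarrow> shift_by C (- p) (shift_by C p X) = X"
  "X \<in> Ob C \<Longrightarrow> shift_by C p (shift_by C (- p) X) = X"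
  by (simp_all add: shift_by_shift_by)

lemma shift_by_1: "X \<in> Ob C \<Longrightarrow> shift_by C 1 X = shift C X"
  using shift_shift_by[of X 0] by simp

lemma tri_unshift_third:
  assumes "tri C X Y Z"
  shows "tri C (shift_by C (- 1) Z) X Y"
  using tri_unrotate[of X Y "shift_by C (- 1) Z"] assms triD[OF assms] shift_by_inverse(2)[of Z 1]
    shift_by_1[of "shift_by C (- 1) Z"] by simp

lemma shift_by_zero_iff: "X \<in> Ob C \<Longrightarrow> is_zero C (shift_by C p X) \<longleftrightarrow> is_zero C X"
  by (induction p rule: shift_by_induct) (auto simp: shift_shift_by[symmetric] shift_zero_iff)

lemma orth_shift_by_iff:
  "X \<in> Ob C \<Longrightarrow> Y \<in> Ob C \<Longrightarrow> orth C (shift_by C p X) (shift_by C p Y) \<longleftrightarrow> orth C X Y"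
  by (induction p rule: shift_by_induct) (auto simp: shift_shift_by[symmetric] orth_shift_iff)

lemma isomorphic_shift_by_iff:
  "X \<in> Ob C \<Longrightarrow> Y \<in> Ob C \<Longrightarrow> isomorphic C (shift_by C p X) (shift_by C p Y) \<longleftrightarrow> isomorphic C X Y"
  by (induction p rule: shift_by_induct) (auto simp: shift_shift_by[symmetric] isomorphic_shift_iff)

lemma tri_shift_by_iff:
  "X \<in> Ob C \<Longrightarrow> Y \<in> Ob C \<Longrightarrow> Z \<in> Ob C \<Longrightarrow>
    tri C (shift_by C p X) (shift_by C p Y) (shift_by C p Z) \<longleftrightarrow> tri C X Y Z"
  by (induction p rule: shift_by_induct) (auto simp: shift_shift_by[symmetric] tri_shift_iff)

lemma Filt_shift_by: "X \<in> Filt C w \<Longrightarrow> shift_by C p X \<in> Filt C (map (shift_by C p) w)"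
proof (induction w arbitrary: X)
  case Nil
  then show ?case using is_zero_Ob shift_by_zero_iff by auto
next
  case (Cons S w)
  then obtain Y where Y: "Y \<in> Filt C w" "tri C S X Y" by auto
  then have "tri C (shift_by C p S) (shift_by C p X) (shift_by C p Y)"
    using tri_shift_by_iff triD by blast
  then show ?case using Cons Y by auto
qed


subsection \<open>Generated triangulated subcategories\<close>

lemma triangulated_subcat_Ob: "triangulated_subcat C (Ob C)"
  unfolding triangulated_subcat_def additive_subcat_def using ex_zero distD
  by (auto simp: is_zero_Ob is_biproduct_def)

context
  fixes D assumes D: "triangulated_subcat C D"
begin

lemma subcat_Ob: "X \<in> D \<Longrightarrow> X \<in> Ob C"
  using D unfolding triangulated_subcat_def additive_subcat_def by blast

lemma subcat_shift: "X \<in> Ob C \<Longrightarrow> shift C X \<in> D \<longleftrightarrow> X \<in> D"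
  using D unfolding triangulated_subcat_def by blast

lemma subcat_third: "tri C X Y Z \<Longrightarrow> X \<in> D \<Longrightarrow> Y \<in> D \<Longrightarrow> Z \<in> D"
  using D unfolding triangulated_subcat_def tri_def by blast

lemma subcat_zero: "is_zero C X \<Longrightarrow> X \<in> D"
  using D isomorphic_zeros is_zero_Ob unfolding triangulated_subcat_def additive_subcat_def by blast

lemma subcat_first: "tri C X Y Z \<Longrightarrow> Y \<in> D \<Longrightarrow> Z \<in> D \<Longrightarrow> X \<in> D"
  using subcat_third[OF tri_rotate] subcat_shift triD(1) by blast

lemma subcat_mid: "tri C X Y Z \<Longrightarrow> X \<in> D \<Longrightarrow> Z \<in> D \<Longrightarrow> Y \<in> D"
  using subcat_first[OF tri_rotate] subcat_shift triD(1) by blast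

lemma subcat_shift_by: "X \<in> Ob C \<Longrightarrow> shift_by C p X \<in> D \<longleftrightarrow> X \<in> D"
  by (induction p rule: shift_by_induct) (auto simp: shift_shift_by[symmetric] subcat_shift)

lemma subcat_Filt: "X \<in> Filt C w \<Longrightarrow> set w \<subseteq> D \<Longrightarrow> X \<in> D"
  by (induction w arbitrary: X) (auto intro: subcat_zero subcat_mid)

lemma subcat_ext_closure: "S \<subseteq> D \<Longrightarrow> ext_closure C S \<subseteq> D"
  using ext_closure_iff_Filt[of S] subcat_Filt subcat_Ob by blast

end

lemma generated_obs_base: "S \<subseteq> generated_obs C S"
  unfolding generated_obs_def by blast

lemma generated_obs_least: "triangulated_subcat C D \<Longrightarrow> S \<subseteq> D \<Longrightarrow> generated_obs C S \<subseteq> D"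
  unfolding generated_obs_def by blast

lemma triangulated_subcat_generated:
  assumes "S \<subseteq> Ob C"
  shows "triangulated_subcat C (generated_obs C S)"
proof -
  let ?F = "{D. triangulated_subcat C D \<and> S \<subseteq> D}"
  have sub: "generated_obs C S \<subseteq> Ob C" using generated_obs_least[OF triangulated_subcat_Ob assms] .
  have zero: "is_zero C X \<Longrightarrow> X \<in> generated_obs C S" for X
    unfolding generated_obs_def using subcat_zero by blast
  show ?thesis
    unfolding triangulated_subcat_def additive_subcat_def
  proof (intro conjI ballI allI impI)
    show "generated_obs C S \<subseteq> Ob C" by (rule sub)
    show "\<exists>X\<in>generated_obs C S. is_zero C X" using zero ex_zero by blast
  next
    fix X Y assume *: "X \<in> generated_obs C S" "Y \<in> Ob C" "isomorphic C X Y"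
    show "Y \<in> generated_obs C S"
      using * unfolding generated_obs_def triangulated_subcat_def additive_subcat_def by blast
  next
    fix X Y B assume *: "X \<in> generated_obs C S" "Y \<in> generated_obs C S" "is_biproduct C X Y B"
    show "B \<in> generated_obs C S"
      using * unfolding generated_obs_def triangulated_subcat_def additive_subcat_def by blast
  next
    fix X assume X: "X \<in> Ob C"
    then have "\<forall>D\<in>?F. shift C X \<in> D \<longleftrightarrow> X \<in> D" using subcat_shift by blast
    then show "(X \<in> generated_obs C S) = (shift C X \<in> generated_obs C S)"
      unfolding generated_obs_def by blast
  next
    fix X Y Z f g h
    assume *: "(X, Y, Z, f, g, h) \<in> dist C" "X \<in> generated_obs C S" "Y \<in> generated_obs C S"
    show "Z \<in> generated_obs C S"
      using * unfolding generated_obs_def triangulated_subcat_def by blast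
  qed
qed

lemma shift_letter: "fst x \<in> Ob C \<Longrightarrow> shift_by C q (letter C x) = letter C (fst x, q + snd x)"
  by (cases x) (simp add: letter_def shift_by_shift_by)

lemma Filt_letters_shift:
  assumes "X \<in> Filt C (map (letter C) w)" "fst ` set w \<subseteq> Ob C"
  shows "shift_by C q X \<in> Filt C (map (letter C) (map (\<lambda>(S, p). (S, q + p)) w))"
proof -
  have "map (shift_by C q) (map (letter C) w) = map (letter C) (map (\<lambda>(S, p). (S, q + p)) w)"
    using assms(2) by (auto simp: shift_letter split: prod.split)
  then show ?thesis using Filt_shift_by[OF assms(1), of q] by metis
qed

text \<open>A cone \<open>Z\<close> of \<open>X \<rightarrow> Y\<close> is an extension of \<open>X[1]\<close> by \<open>Y\<close>.  Hence the extension closure of all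
  shifts of \<open>S\<close> is already triangulated.\<close>

lemma generated_obs_iff_Filt:
  assumes S: "S \<subseteq> Ob C"
  shows "X \<in> generated_obs C S \<longleftrightarrow> (\<exists>w. fst ` set w \<subseteq> S \<and> X \<in> Filt C (map (letter C) w))"
    (is "_ \<longleftrightarrow> ?W X")
proof
  assume "?W X"
  then obtain w where w: "fst ` set w \<subseteq> S" "X \<in> Filt C (map (letter C) w)" by blast
  have "letter C x \<in> generated_obs C S" if "x \<in> set w" for x
  proof -
    obtain Y p where x: "x = (Y, p)" by fastforce
    then have "Y \<in> S" using that w(1) by force
    then show ?thesis
      using x S generated_obs_base[of S] subcat_shift_by[OF triangulated_subcat_generated[OF S]]
      by (auto simp: letter_def)
  qed
  then show "X \<in> generated_obs C S"
    by (intro subcat_Filt[OF triangulated_subcat_generated[OF S] w(2)]) (simp add: image_subset_iff)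
next
  define D where "D = Collect ?W"
  have DI: "X \<in> D" if "fst ` set w \<subseteq> S" "X \<in> Filt C (map (letter C) w)" for X w
    using that unfolding D_def by blast
  have DE: "\<exists>w. fst ` set w \<subseteq> S \<and> X \<in> Filt C (map (letter C) w)" if "X \<in> D" for X
    using that unfolding D_def by blast
  have shift: "shift_by C q X \<in> D" if X: "X \<in> D" for q X
  proof -
    obtain w where w: "fst ` set w \<subseteq> S" "X \<in> Filt C (map (letter C) w)" using DE[OF X] by blast
    have "fst ` set (map (\<lambda>(S, p). (S, q + p)) w) \<subseteq> S" using w(1) by fastforce
    then show ?thesis using DI Filt_letters_shift[OF w(2)] w(1) S by blast
  qed
  have ext: "Y \<in> D" if XYZ: "tri C X Y Z" "X \<in> D" "Z \<in> D" for X Y Z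
  proof -
    obtain u v where "fst ` set u \<subseteq> S" "X \<in> Filt C (map (letter C) u)"
      "fst ` set v \<subseteq> S" "Z \<in> Filt C (map (letter C) v)" using XYZ DE by meson
    then have "fst ` set (u @ v) \<subseteq> S \<and> Y \<in> Filt C (map (letter C) (u @ v))"
      using XYZ(1) Filt_append by auto
    then show ?thesis using DI by blast
  qed
  have Ob: "D \<subseteq> Ob C" using DE Filt_Ob by blast
  have iso: "Y \<in> D" if "X \<in> D" "isomorphic C X Y" "Y \<in> Ob C" for X Y
    using DE[OF that(1)] DI Filt_iso that(2,3) by blast
  have zero: "N \<in> D" if "is_zero C N" for N
    using that by (intro DI[of "[]"]) auto
  have "triangulated_subcat C D"
    unfolding triangulated_subcat_def additive_subcat_def
  proof (intro conjI ballI allI impI)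
    show "D \<subseteq> Ob C" by (rule Ob)
    show "\<exists>X\<in>D. is_zero C X" using zero ex_zero by blast
  next
    fix X Y assume "X \<in> D" "Y \<in> Ob C" "isomorphic C X Y"
    then show "Y \<in> D" using iso by blast
  next
    fix X Y B assume "X \<in> D" "Y \<in> D" "is_biproduct C X Y B"
    then show "B \<in> D" using ext biproduct_tri by blast
  next
    fix X assume X: "X \<in> Ob C"
    show "(X \<in> D) = (shift C X \<in> D)"
      using shift[of X 1] shift[of "shift C X" "- 1"] shift_by_inverse(1)[OF X, of 1] shift_by_1[OF X]
      by auto
  next
    fix X Y Z f g h
    assume *: "(X, Y, Z, f, g, h) \<in> dist C" "X \<in> D" "Y \<in> D"
    have "shift C X \<in> D" using shift[OF *(2), of 1] shift_by_1 Ob *(2) by auto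
    then show "Z \<in> D" using ext[OF tri_rotate[OF triI[OF *(1)]] *(3)] by blast
  qed
  moreover have "S \<subseteq> D"
  proof
    fix Y assume "Y \<in> S"
    then have "fst ` set [(Y, 0 :: int)] \<subseteq> S \<and> Y \<in> Filt C (map (letter C) [(Y, 0)])"
      using S Filt_single_self[of Y] by (auto simp: letter_def)
    then show "Y \<in> D" using DI by blast
  qed
  ultimately have "generated_obs C S \<subseteq> D" by (rule generated_obs_least)
  then show "X \<in> generated_obs C S \<Longrightarrow> ?W X" using DE by blast
qed

end

context triangulated_category
begin

lemma uminus_inj:
  assumes "X \<in> Ob C" "Y \<in> Ob C" "f \<in> Mor C X Y" "g \<in> Mor C X Y"
    "\<ominus>\<^bsub>Hom C X Y\<^esub> f = \<ominus>\<^bsub>Hom C X Y\<^esub> g"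
  shows "f = g"
  using minus_minus[OF assms(1,2,3)] minus_minus[OF assms(1,2,4)] assms(5) by metis

lemma dist_uminus:
  assumes t: "(X, Y, Z, f, g, h) \<in> dist C"
  shows "(X, Y, Z, f, \<ominus>\<^bsub>Hom C Y Z\<^esub> g, \<ominus>\<^bsub>Hom C Z (shift C X)\<^esub> h) \<in> dist C"
proof -
  note d = distD[OF t]
  have "(\<ominus>\<^bsub>Hom C Z Z\<^esub> ident C Z) \<cdot> (\<ominus>\<^bsub>Hom C Z Z\<^esub> ident C Z) = ident C Z"
    using cmp_uminus_left[of Z Z Z "ident C Z" "\<ominus>\<^bsub>Hom C Z Z\<^esub> ident C Z"]
      cmp_uminus_right[of Z Z Z "ident C Z" "ident C Z"] cmp_ident[of "ident C Z" Z Z] d ident_in by simp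
  then have iso: "is_iso C Z Z (\<ominus>\<^bsub>Hom C Z Z\<^esub> ident C Z)"
    unfolding is_iso_def using d ident_in uminus_in by blast
  show ?thesis
  proof (rule TR1_iso[OF t _ is_iso_ident[OF d(1)] is_iso_ident[OF d(2)] iso])
    show "triangle C X Y Z f (\<ominus>\<^bsub>Hom C Y Z\<^esub> g) (\<ominus>\<^bsub>Hom C Z (shift C X)\<^esub> h)"
      unfolding triangle_def using d by simp
    show "ident C Y \<cdot> f = f \<cdot> ident C X" using d by simp
    show "(\<ominus>\<^bsub>Hom C Z Z\<^esub> ident C Z) \<cdot> g = (\<ominus>\<^bsub>Hom C Y Z\<^esub> g) \<cdot> ident C Y"
      using cmp_uminus_left[of Y Z Z "ident C Z" g] d ident_in cmp_ident[of "\<ominus>\<^bsub>Hom C Y Z\<^esub> g" Y Z] by simp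
    show "shiftm C (ident C X) \<cdot> h = (\<ominus>\<^bsub>Hom C Z (shift C X)\<^esub> h) \<cdot> (\<ominus>\<^bsub>Hom C Z Z\<^esub> ident C Z)"
      using cmp_uminus_left[of Z Z "shift C X" h "\<ominus>\<^bsub>Hom C Z Z\<^esub> ident C Z"]
        cmp_uminus_right[of Z Z "shift C X" h "ident C Z"] d ident_in shiftm_ident
        uminus_in[of Z "shift C X" h] cmp_in[of Z Z "shift C X" h] by simp
  qed
qed

end

section \<open>Simple-minded collections\<close>

text \<open>In non-positive degrees, the members of an Ext-exceptional collection behave like the pairwise
  non-isomorphic simple objects of a heart.  The locale isolates this behaviour.\<close>

locale simple_minded = triangulated_category k C
  for k :: "'k ring" and C :: "('k, 'o, 'm) tricat" (structure) +
  fixes \<S> :: "'o set"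
  assumes finite_S: "finite \<S>"
    and S_Ob: "\<S> \<subseteq> Ob C"
    and S_nonzero: "S \<in> \<S> \<Longrightarrow> \<not> is_zero C S"
    and S_brick: "S \<in> \<S> \<Longrightarrow> f \<in> Mor C S S \<Longrightarrow> f = zerom C S S \<or> is_iso C S S f"
    and S_negative: "S \<in> \<S> \<Longrightarrow> S' \<in> \<S> \<Longrightarrow> p < 0 \<Longrightarrow> orth C S (shift_by C p S')"
    and S_distinct: "S \<in> \<S> \<Longrightarrow> S' \<in> \<S> \<Longrightarrow> S \<noteq> S' \<Longrightarrow> orth C S S'"
    and S_generate: "generated_obs C \<S> = Ob C"

text \<open>A pair \<open>(S, p)\<close> stands for \<open>S[p]\<close>, whose class in the Grothendieck group is the class of \<open>S\<close> up to the
  sign given by the parity of \<open>p\<close>.\<close>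

definition signed :: "int \<Rightarrow> complex \<Rightarrow> complex" where
  "signed p c = (if even p then c else - c)"

definition weight :: "('o \<Rightarrow> complex) \<Rightarrow> ('o \<times> int) list \<Rightarrow> complex" where
  "weight z w = (\<Sum>(S, p)\<leftarrow>w. signed p (z S))"

definition descending :: "('o \<times> int) list \<Rightarrow> bool" where
  "descending w \<longleftrightarrow> sorted_wrt (\<lambda>x y. snd y \<le> snd x) w"

lemma signed_simps [simp]: "signed 0 c = c" "signed p 0 = 0" "signed (p + 1) c = - signed p c"
  "signed (1 + p) c = - signed p c" "signed (- p) c = signed p c" "signed p (c + d) = signed p c + signed p d"
  by (auto simp: signed_def)

lemma weight_simps [simp]:
  "weight z [] = 0" "weight z ((S, p) # w) = signed p (z S) + weight z w"
  "weight z (u @ v) = weight z u + weight z v"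
  by (simp_all add: weight_def)

lemma weight_shift: "weight z (map (\<lambda>(S, p). (S, q + p)) w) = signed q (weight z w)"
  by (induction w) (auto simp: signed_def)

context simple_minded
begin

abbreviation "wfilt w \<equiv> Filt C (map (letter C) w)"

definition is_word :: "('o \<times> int) list \<Rightarrow> bool" where
  "is_word w \<longleftrightarrow> fst ` set w \<subseteq> \<S>"

lemma is_word_simps [simp]: "is_word []" "is_word ((S, p) # w) \<longleftrightarrow> S \<in> \<S> \<and> is_word w"
  "is_word (u @ v) \<longleftrightarrow> is_word u \<and> is_word v"
  by (auto simp: is_word_def)

lemma is_word_Ob: "is_word w \<Longrightarrow> fst ` set w \<subseteq> Ob C"
  using S_Ob by (auto simp: is_word_def)

lemma is_word_subset: "is_word w \<Longrightarrow> set v \<subseteq> set w \<Longrightarrow> is_word v"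
  by (auto simp: is_word_def)

lemma ex_word: "X \<in> Ob C \<Longrightarrow> \<exists>w. is_word w \<and> X \<in> wfilt w"
  using generated_obs_iff_Filt[OF S_Ob] S_generate unfolding is_word_def by simp

lemma S_Ob': "S \<in> \<S> \<Longrightarrow> S \<in> Ob C"
  using S_Ob by blast

lemma orth_S:
  assumes "S \<in> \<S>" "S' \<in> \<S>" "p > q"
  shows "orth C (shift_by C p S) (shift_by C q S')"
proof -
  have "orth C (shift_by C p S) (shift_by C p (shift_by C (q - p) S'))"
    using S_negative assms S_Ob' orth_shift_by_iff by simp
  then show ?thesis using assms S_Ob' shift_by_shift_by by simp
qed

lemma orth_words:
  assumes "is_word u" "is_word v" "X \<in> wfilt u" "Y \<in> wfilt v"
    and less: "\<And>x y. x \<in> set u \<Longrightarrow> y \<in> set v \<Longrightarrow> snd y < snd x"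
  shows "orth C X Y"
proof (rule orth_Filt_left[OF assms(3)])
  fix A assume "A \<in> set (map (letter C) u)"
  then obtain S p where A: "(S, p) \<in> set u" "A = shift_by C p S" by (auto simp: letter_def)
  then have S: "S \<in> \<S>" using assms(1) by (force simp: is_word_def)
  show "orth C A Y"
  proof (rule orth_Filt_right[OF assms(4)])
    fix B assume "B \<in> set (map (letter C) v)"
    then obtain S' q where B: "(S', q) \<in> set v" "B = shift_by C q S'" by (auto simp: letter_def)
    then have S': "S' \<in> \<S>" using assms(2) by (force simp: is_word_def)
    show "orth C A B" using orth_S[OF S S'] less[OF A(1) B(1)] A B by simp
  qed (use A S S_Ob' in auto)
qed (use assms(4) Filt_Ob in auto)

text \<open>Letters in ascending degree are joined by a connecting map \<open>S'[q] \<rightarrow> S[p + 1]\<close>.  It vanishes for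
  degree reasons or because \<open>S \<noteq> S'\<close>, except when \<open>S = S'\<close> and \<open>q = p + 1\<close>.  Then it is zero or
  invertible, so the letters can be exchanged or they cancel.\<close>

lemma exchange_self:
  assumes S: "S \<in> \<S>" and t: "tri C S X (shift C S)"
  shows "tri C (shift C S) X S \<or> is_zero C X"
proof -
  obtain f g h where d: "(S, X, shift C S, f, g, h) \<in> dist C" using t tri_def by metis
  obtain h0 where h0: "h0 \<in> Mor C S S" "h = shiftm C h0"
    using shiftm_surj distD(6)[OF d] S S_Ob' by blast
  show ?thesis
  proof (cases "h0 = zerom C S S")
    case True
    then have "h = zerom C (shift C S) (shift C S)" using h0 S S_Ob' shiftm_zero by simp
    then show ?thesis using dist_swap d by blast
  next
    case False
    then have "is_iso C S S h0" using S_brick S h0 by blast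
    then obtain g0 where g0: "g0 \<in> Mor C S S" "g0 \<cdot> h0 = ident C S" "h0 \<cdot> g0 = ident C S"
      unfolding is_iso_def by blast
    have Sob: "S \<in> Ob C" using S S_Ob' by blast
    have "shiftm C g0 \<cdot> h = ident C (shift C S)" "h \<cdot> shiftm C g0 = ident C (shift C S)"
      using h0 g0 shiftm_cmp[OF Sob Sob Sob, of g0 h0] shiftm_cmp[OF Sob Sob Sob, of h0 g0]
        shiftm_ident[OF Sob] by simp_all
    then have "is_iso C (shift C S) (shift C S) h"
      unfolding is_iso_def using h0 g0 Sob shiftm_in by blast
    then show ?thesis using dist_connecting_iso_zero[OF d] by blast
  qed
qed

lemma exchange:
  assumes S: "S \<in> \<S>" "S' \<in> \<S>" and pq: "p < q"
    and X: "tri C (shift_by C p S) X (shift_by C q S')"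
  shows "tri C (shift_by C q S') X (shift_by C p S) \<or> (is_zero C X \<and> S = S' \<and> q = p + 1)"
proof (cases "S = S' \<and> q = p + 1")
  case True
  define X0 where "X0 = shift_by C (- p) X"
  have Ob: "S \<in> Ob C" "X0 \<in> Ob C" and X0: "X = shift_by C p X0"
    using S S_Ob' triD(2)[OF X] shift_by_inverse X0_def by auto
  have eq: "shift_by C q S' = shift_by C p (shift C S)"
    using True Ob shift_by_shift_by[OF Ob(1), of p 1] shift_by_1 by simp
  have "tri C S X0 (shift C S)"
    using X Ob tri_shift_by_iff eq X0 shift_Ob by metis
  then have "tri C (shift C S) X0 S \<or> is_zero C X0" using exchange_self S by blast
  then show ?thesis using True eq X0 Ob tri_shift_by_iff shift_by_zero_iff shift_Ob by metis
next
  case False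
  have "orth C (shift_by C q S') (shift C (shift_by C p S))"
  proof (cases "q = p + 1")
    case True
    then have "orth C S' S" using False S S_distinct by blast
    then show ?thesis using True S S_Ob' shift_shift_by orth_shift_by_iff by simp
  next
    case False
    then show ?thesis using orth_S S pq S_Ob' shift_shift_by by simp
  qed
  then show ?thesis using tri_swap[OF X] by blast
qed

text \<open>One step of insertion sort.\<close>

lemma insert_letter:
  assumes "is_word (x # w)" "descending w" "X \<in> wfilt (x # w)"
  shows "\<exists>w'. descending w' \<and> set w' \<subseteq> set (x # w) \<and> X \<in> wfilt w' \<and> (\<forall>z. weight z w' = weight z (x # w))"
  using assms
proof (induction w arbitrary: X)
  case Nil
  then show ?case by (intro exI[of _ "[x]"]) (auto simp: descending_def)
next
  case (Cons y w)
  obtain S p S' q where xy: "x = (S, p)" "y = (S', q)" by fastforce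
  have S: "S \<in> \<S>" "S' \<in> \<S>" using Cons xy by auto
  show ?case
  proof (cases "q \<le> p")
    case True
    then have "descending (x # y # w)" using Cons(3) xy by (auto simp: descending_def)
    then show ?thesis using Cons by blast
  next
    case False
    have "X \<in> Filt C (map (letter C) [x, y] @ map (letter C) w)" using Cons(4) by simp
    then obtain A B where AB: "A \<in> Filt C (map (letter C) [x, y])" "B \<in> wfilt w" "tri C A X B"
      using Filt_append by blast
    have "tri C (shift_by C p S) A (shift_by C q S')"
      using AB(1) Filt_pair[of "letter C x" "letter C y"] xy by (simp add: letter_def del: Filt.simps)
    then consider "tri C (shift_by C q S') A (shift_by C p S)" | "is_zero C A" "S = S'" "q = p + 1"
      using exchange[OF S, of p q A] False by force
    then show ?thesis
    proof cases
      case 1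
      then have "A \<in> Filt C (map (letter C) [y, x])"
        using Filt_pair[of "letter C y" "letter C x"] xy by (simp add: letter_def del: Filt.simps)
      then have "X \<in> Filt C (map (letter C) [y, x] @ map (letter C) w)"
        using AB Filt_append by blast
      then obtain Y where Y: "Y \<in> wfilt (x # w)" "tri C (letter C y) X Y" by auto
      have "is_word (x # w)" "descending w" using Cons.prems xy by (auto simp: descending_def)
      then obtain w' where w': "descending w'" "set w' \<subseteq> set (x # w)" "Y \<in> wfilt w'"
        "\<forall>z. weight z w' = weight z (x # w)"
        using Cons.IH Y(1) by blast
      have "descending (y # w')"
        using w' Cons.prems(2) False xy by (auto simp: descending_def)
      moreover have "X \<in> wfilt (y # w')" using w' Y by auto
      moreover have "weight z (y # w') = weight z (x # y # w)" for z
        using w' xy by simp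
      ultimately show ?thesis using w'(2) by (intro exI[of _ "y # w'"]) auto
    next
      case 2
      then have "X \<in> Filt C ([] @ map (letter C) w)" using AB Filt_append[of X "[]"] by auto
      moreover have "weight z w = weight z (x # y # w)" for z using 2 xy by simp
      ultimately show ?thesis
        using Cons.prems(2) by (intro exI[of _ w]) (auto simp: descending_def)
    qed
  qed
qed

text \<open>Sorting the letters by degree produces the filtration of an object by its cohomology with
  respect to the bounded t-structure.\<close>

lemma sort_word:
  assumes "is_word w" "X \<in> wfilt w"
  shows "\<exists>w'. descending w' \<and> set w' \<subseteq> set w \<and> X \<in> wfilt w' \<and> (\<forall>z. weight z w' = weight z w)"
  using assms
proof (induction w arbitrary: X)
  case Nil
  then show ?case by (intro exI[of _ "[]"]) (auto simp: descending_def)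
next
  case (Cons x w)
  then obtain Y where Y: "Y \<in> wfilt w" "tri C (letter C x) X Y" by auto
  have word: "is_word w" using Cons.prems by (cases x) simp
  then obtain w1 where w1: "descending w1" "set w1 \<subseteq> set w" "Y \<in> wfilt w1" "\<forall>z. weight z w1 = weight z w"
    using Cons.IH Y by blast
  have "is_word (x # w1)" using Cons.prems w1(2) by (auto simp: is_word_def)
  moreover have "X \<in> wfilt (x # w1)" using Y w1 by auto
  ultimately obtain w2 where "descending w2" "set w2 \<subseteq> set (x # w1)" "X \<in> wfilt w2"
    "\<forall>z. weight z w2 = weight z (x # w1)"
    using insert_letter w1(1) by blast
  then show ?case using w1 by (intro exI[of _ w2]) (cases x, auto)
qed

text \<open>The first letter of a sorted word contributes to the highest cohomology and cannot cancel: its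
  shift has no maps to what the other letters filter.\<close>

lemma zero_descending_word:
  assumes "is_word w" "descending w" "X \<in> wfilt w" "is_zero C X"
  shows "w = []"
proof (cases w)
  case (Cons x v)
  obtain S p where x: "x = (S, p)" by fastforce
  have S: "S \<in> \<S>" "S \<in> Ob C" using assms Cons x S_Ob' by auto
  obtain Y where Y: "Y \<in> wfilt v" "tri C (shift_by C p S) X Y"
    using assms Cons x by (auto simp: letter_def)
  have "shift C (shift_by C p S) \<in> wfilt [(S, p + 1)]"
    using S shift_shift_by Filt_single_self by (simp add: letter_def del: Filt.simps)
  then have "orth C (shift C (shift_by C p S)) Y"
  proof (rule orth_words[rotated 2])
    show "is_word [(S, p + 1)]" "is_word v" using S assms Cons x by auto
    show "snd b < snd a" if "a \<in> set [(S, p + 1)]" "b \<in> set v" for a b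
      using that assms(2) Cons x by (auto simp: descending_def)
  qed (rule Y)
  moreover have "orth C (shift_by C p S) X" using assms S orth_zero by simp
  ultimately have "is_zero C (shift_by C p S)" using tri_first_zero Y by blast
  then show ?thesis using S S_nonzero shift_by_zero_iff by blast
qed simp

text \<open>If \<open>X\<close> has filtrations by \<open>u\<close> and by \<open>v\<close>, the triangle \<open>X \<rightarrow> 0 \<rightarrow> X[1]\<close> filters a zero
  object by \<open>u\<close> followed by \<open>v[1]\<close>.  Sorting leaves nothing, and it preserves the weight.\<close>

lemma weight_unique:
  assumes "is_word u" "X \<in> wfilt u" "is_word v" "X \<in> wfilt v"
  shows "weight z u = weight z v"
proof -
  obtain N where N: "is_zero C N" using ex_zero by blast
  have X: "X \<in> Ob C" using assms Filt_Ob by blast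
  let ?v = "map (\<lambda>(S, p). (S, 1 + p)) v"
  have "shift C X \<in> wfilt ?v"
    using Filt_letters_shift[OF assms(4) is_word_Ob[OF assms(3)], of 1] X shift_by_1 by simp
  then have "N \<in> wfilt (u @ ?v)"
    using tri_shift_self[OF X N] assms(2) Filt_append by auto
  moreover have "is_word ?v" using assms(3) by (auto simp: is_word_def)
  ultimately obtain w where w: "descending w" "set w \<subseteq> set (u @ ?v)" "N \<in> wfilt w"
    "\<forall>z. weight z w = weight z (u @ ?v)"
    using sort_word[of "u @ ?v" N] assms(1) by auto
  have "is_word w" using is_word_subset[OF _ w(2)] assms(1) \<open>is_word ?v\<close> by simp
  then have "w = []" using zero_descending_word w N by blast
  then have "0 = weight z u + weight z ?v" using w(4) by simp
  then show ?thesis using weight_shift[of z 1 v] signed_simps(3)[of 0] by simp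
qed

definition charge :: "('o \<Rightarrow> complex) \<Rightarrow> 'o \<Rightarrow> complex" where
  "charge z X = weight z (SOME w. is_word w \<and> X \<in> wfilt w)"

lemma charge_eq: "is_word w \<Longrightarrow> X \<in> wfilt w \<Longrightarrow> charge z X = weight z w"
  unfolding charge_def using weight_unique by (metis (mono_tags, lifting) someI_ex)

lemma charge_S: "S \<in> \<S> \<Longrightarrow> charge z S = z S"
  using charge_eq[of "[(S, 0)]" S z] Filt_single_self[of S] S_Ob' by (simp add: letter_def del: Filt.simps)

lemma charge_tri:
  assumes "tri C X Y Z"
  shows "charge z Y = charge z X + charge z Z"
proof -
  obtain u v where uv: "is_word u" "X \<in> wfilt u" "is_word v" "Z \<in> wfilt v"
    using ex_word triD assms by meson
  then have "Y \<in> wfilt (u @ v)" using assms Filt_append by auto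
  then show ?thesis using uv charge_eq[of "u @ v" Y z] charge_eq[of u X z] charge_eq[of v Z z] by simp
qed

end

text \<open>These functions are the homomorphisms from the Grothendieck group.\<close>

definition tri_additive :: "('k, 'o, 'm) tricat \<Rightarrow> ('o \<Rightarrow> complex) \<Rightarrow> bool" where
  "tri_additive C f \<longleftrightarrow> (\<forall>X Y Z. tri C X Y Z \<longrightarrow> f Y = f X + f Z)"

context triangulated_category
begin

lemma additive_zero:
  assumes "tri_additive C f" "is_zero C N"
  shows "f N = 0"
proof -
  have "tri C N N N" using tri_ident_left assms is_zero_Ob by blast
  then have "f N = f N + f N" using assms(1) unfolding tri_additive_def by blast
  then show ?thesis by simp
qed

lemma additive_iso:
  assumes "tri_additive C f" "isomorphic C X Y" "X \<in> Ob C" "Y \<in> Ob C"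
  shows "f X = f Y"
proof -
  obtain N where N: "is_zero C N" using ex_zero by blast
  have "f Y = f X + f N" using tri_isoI(1)[OF assms(2-4) N] assms(1) unfolding tri_additive_def by blast
  then show ?thesis using additive_zero assms(1) N by simp
qed

lemma additive_shift:
  assumes "tri_additive C f" "X \<in> Ob C"
  shows "f (shift C X) = - f X"
proof -
  obtain N where N: "is_zero C N" using ex_zero by blast
  have "f N = f X + f (shift C X)" using tri_shift_self[OF assms(2) N] assms(1) unfolding tri_additive_def by blast
  then show ?thesis using additive_zero[OF assms(1) N] by (simp add: eq_neg_iff_add_eq_0 add.commute)
qed

lemma additive_shift_by:
  assumes "tri_additive C f" "X \<in> Ob C"
  shows "f (shift_by C p X) = signed p (f X)"
proof (induction p rule: shift_by_induct)
  case (2 p)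
  have "f (shift_by C (p + 1) X) = - f (shift_by C p X)"
    using additive_shift[OF assms(1), of "shift_by C p X"] assms(2) shift_shift_by by simp
  then show ?case by simp
qed simp

lemma additive_Filt: "tri_additive C f \<Longrightarrow> X \<in> Filt C w \<Longrightarrow> f X = (\<Sum>A\<leftarrow>w. f A)"
proof (induction w arbitrary: X)
  case Nil
  then show ?case using additive_zero by simp
next
  case (Cons S w)
  then obtain Y where Y: "Y \<in> Filt C w" "tri C S X Y" by auto
  then have "f X = f S + f Y" using Cons unfolding tri_additive_def by blast
  then show ?case using Cons Y by simp
qed

end

context simple_minded
begin

lemma additive_charge: "tri_additive C (charge z)"
  unfolding tri_additive_def using charge_tri by blast

lemma additive_word:
  assumes "tri_additive C f" "is_word w" "X \<in> wfilt w"
  shows "f X = weight f w"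
proof -
  have "f (letter C x) = signed (snd x) (f (fst x))" if "x \<in> set w" for x
    using that additive_shift_by[OF assms(1), of "fst x" "snd x"] is_word_Ob[OF assms(2)]
    by (auto simp: letter_def split: prod.split)
  then have "(\<Sum>A\<leftarrow>map (letter C) w. f A) = weight f w"
    unfolding weight_def map_map by (intro arg_cong[where f = sum_list] map_cong) auto
  then show ?thesis using additive_Filt[OF assms(1,3)] by simp
qed

lemma weight_cong: "is_word w \<Longrightarrow> (\<And>S. S \<in> \<S> \<Longrightarrow> z S = z' S) \<Longrightarrow> weight z w = weight z' w"
  by (induction w) auto

text \<open>Both sides are computed by the letters of any word that filters \<open>X\<close>.\<close>

lemma additive_eq_charge:
  assumes "tri_additive C f" "X \<in> Ob C" "\<And>S. S \<in> \<S> \<Longrightarrow> f S = z S"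
  shows "f X = charge z X"
proof -
  obtain w where w: "is_word w" "X \<in> wfilt w" using ex_word assms by blast
  then show ?thesis using additive_word[OF assms(1) w] weight_cong[OF w(1) assms(3)] charge_eq[OF w] by simp
qed


subsection \<open>The heart and its shifts\<close>

definition hrt :: "int \<Rightarrow> 'o set" where
  "hrt p = {X. \<exists>w. is_word w \<and> (\<forall>x\<in>set w. snd x = p) \<and> X \<in> wfilt w}"

lemma hrtE:
  assumes "X \<in> hrt p"
  obtains w where "is_word w" "\<And>x. x \<in> set w \<Longrightarrow> snd x = p" "X \<in> wfilt w"
  using assms unfolding hrt_def by blast

lemma hrt_Ob: "X \<in> hrt p \<Longrightarrow> X \<in> Ob C"
  using Filt_Ob by (auto simp: hrt_def)

lemma hrt_0: "hrt 0 = ext_closure C \<S>"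
proof (intro equalityI subsetI)
  fix X assume "X \<in> hrt 0"
  then obtain w where w: "is_word w" "\<And>x. x \<in> set w \<Longrightarrow> snd x = 0" "X \<in> wfilt w" by (rule hrtE) blast
  have "map (letter C) w = map fst w" using w(2) by (intro map_cong) (force simp: letter_def)+
  then show "X \<in> ext_closure C \<S>"
    using w ext_closure_iff_Filt[OF S_Ob] unfolding is_word_def by (metis set_map)
next
  fix X assume "X \<in> ext_closure C \<S>"
  then obtain w where w: "set w \<subseteq> \<S>" "X \<in> Filt C w" using ext_closure_iff_Filt[OF S_Ob] by blast
  have "map (letter C) (map (\<lambda>S. (S, 0)) w) = w" by (simp add: letter_def comp_def)
  then show "X \<in> hrt 0" unfolding hrt_def is_word_def
    using w by (intro CollectI exI[of _ "map (\<lambda>S. (S, 0)) w"]) (auto simp del: map_map)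
qed

lemma hrt_zero: "is_zero C X \<Longrightarrow> X \<in> hrt p"
  unfolding hrt_def by (intro CollectI exI[of _ "[]"]) auto

lemma hrt_iso: "X \<in> hrt p \<Longrightarrow> isomorphic C X Y \<Longrightarrow> Y \<in> Ob C \<Longrightarrow> Y \<in> hrt p"
  unfolding hrt_def using Filt_iso by blast

lemma hrt_ext:
  assumes "tri C X Y Z" "X \<in> hrt p" "Z \<in> hrt p"
  shows "Y \<in> hrt p"
proof -
  obtain u where u: "is_word u" "\<And>x. x \<in> set u \<Longrightarrow> snd x = p" "X \<in> wfilt u" using assms(2) by (rule hrtE) blast
  obtain v where v: "is_word v" "\<And>x. x \<in> set v \<Longrightarrow> snd x = p" "Z \<in> wfilt v" using assms(3) by (rule hrtE) blast
  have "Y \<in> wfilt (u @ v)" using assms(1) u v Filt_append by auto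
  then show ?thesis unfolding hrt_def using u v by (intro CollectI exI[of _ "u @ v"]) auto
qed

lemma hrt_shift_by:
  assumes "X \<in> hrt p"
  shows "shift_by C q X \<in> hrt (q + p)"
proof -
  obtain w where w: "is_word w" "\<And>x. x \<in> set w \<Longrightarrow> snd x = p" "X \<in> wfilt w" using assms by (rule hrtE) blast
  show ?thesis unfolding hrt_def
    using Filt_letters_shift[OF w(3) is_word_Ob[OF w(1)], of q] w
    by (intro CollectI exI[of _ "map (\<lambda>(S, p). (S, q + p)) w"]) (fastforce simp: is_word_def)
qed

lemma hrt_shift_by_iff: "X \<in> Ob C \<Longrightarrow> shift_by C q X \<in> hrt p \<longleftrightarrow> X \<in> hrt (p - q)"
  using hrt_shift_by[of X "p - q" q] hrt_shift_by[of "shift_by C q X" p "- q"] shift_by_inverse(1)[of X q]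
  by auto

lemma hrt_shift_iff: "X \<in> Ob C \<Longrightarrow> shift C X \<in> hrt p \<longleftrightarrow> X \<in> hrt (p - 1)"
  using hrt_shift_by_iff[of X 1 p] shift_by_1 by simp

lemma orth_hrt:
  assumes "X \<in> hrt p" "Y \<in> hrt q" "p > q"
  shows "orth C X Y"
proof -
  obtain u where u: "is_word u" "\<And>x. x \<in> set u \<Longrightarrow> snd x = p" "X \<in> wfilt u" using assms(1) by (rule hrtE) blast
  obtain v where v: "is_word v" "\<And>x. x \<in> set v \<Longrightarrow> snd x = q" "Y \<in> wfilt v" using assms(2) by (rule hrtE) blast
  show ?thesis using orth_words[OF u(1) v(1) u(3) v(3)] u v assms(3) by simp
qed

text \<open>Splitting a sorted word at a degree gives the truncation triangle of the t-structure.\<close>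

lemma descending_split:
  assumes "descending w" "X \<in> wfilt w" "is_word w"
  shows "\<exists>A\<in>wfilt (filter (\<lambda>x. p < snd x) w). \<exists>B\<in>wfilt (filter (\<lambda>x. snd x \<le> p) w). tri C A X B"
proof -
  have "w = filter (\<lambda>x. p < snd x) w @ filter (\<lambda>x. snd x \<le> p) w"
    using assms(1)
  proof (induction w)
    case (Cons x w)
    show ?case
    proof (cases "p < snd x")
      case True
      then show ?thesis using Cons by (auto simp: descending_def)
    next
      case False
      then have "filter (\<lambda>x. p < snd x) w = []" using Cons(2) by (fastforce simp: descending_def filter_empty_conv)
      then show ?thesis using Cons False by (auto simp: descending_def)
    qed
  qed simp
  then have "map (letter C) w = map (letter C) (filter (\<lambda>x. p < snd x) w) @
      map (letter C) (filter (\<lambda>x. snd x \<le> p) w)"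
    by (subst map_append[symmetric]) (rule arg_cong)
  then have "X \<in> Filt C (map (letter C) (filter (\<lambda>x. p < snd x) w) @
      map (letter C) (filter (\<lambda>x. snd x \<le> p) w))"
    using assms(2) by (rule subst)
  then show ?thesis by (simp only: Filt_append)
qed

text \<open>Sorting the wrong order of two neighbouring degrees.  Applied to the rotated triangle of a
  morphism of the heart, this provides its kernel and cokernel.\<close>

lemma two_step:
  assumes "tri C A X B" "A \<in> hrt p" "B \<in> hrt (p + 1)"
  shows "\<exists>U\<in>hrt (p + 1). \<exists>V\<in>hrt p. tri C U X V"
proof -
  obtain u where u: "is_word u" "\<And>x. x \<in> set u \<Longrightarrow> snd x = p" "A \<in> wfilt u" using assms(2) by (rule hrtE) blast
  obtain v where v: "is_word v" "\<And>x. x \<in> set v \<Longrightarrow> snd x = p + 1" "B \<in> wfilt v" using assms(3) by (rule hrtE) blast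
  have "X \<in> wfilt (u @ v)" using assms(1) u v Filt_append by auto
  then obtain w where w: "descending w" "set w \<subseteq> set (u @ v)" "X \<in> wfilt w"
    using sort_word[of "u @ v" X] u(1) v(1) by auto
  have word: "is_word w" using is_word_subset[OF _ w(2)] u v by simp
  obtain U V where UV: "U \<in> wfilt (filter (\<lambda>x. p < snd x) w)" "V \<in> wfilt (filter (\<lambda>x. snd x \<le> p) w)" "tri C U X V"
    using descending_split[OF w(1,3) word, of p] by blast
  have "U \<in> hrt (p + 1)" unfolding hrt_def
    using UV u v w(2) is_word_subset[OF word, of "filter (\<lambda>x. p < snd x) w"]
    by (intro CollectI exI[of _ "filter (\<lambda>x. p < snd x) w"]) fastforce
  moreover have "V \<in> hrt p" unfolding hrt_def
    using UV u v w(2) is_word_subset[OF word, of "filter (\<lambda>x. snd x \<le> p) w"]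
    by (intro CollectI exI[of _ "filter (\<lambda>x. snd x \<le> p) w"]) fastforce
  ultimately show ?thesis using UV(3) by blast
qed

text \<open>By the first triangle \<open>I\<close> can have cohomology only in degrees \<open>p\<close> and \<open>p + 1\<close>.  The part in degree
  \<open>p + 1\<close> has no maps to \<open>V\<close> and \<open>Y\<close>, hence none to \<open>I\<close>, and so it vanishes.\<close>

lemma hrt_squeeze:
  assumes "tri C X I U" "X \<in> hrt p" "U \<in> hrt (p + 1)"
    and "tri C V I Y" "V \<in> hrt (p - 1)" "Y \<in> hrt p"
  shows "I \<in> hrt p"
proof -
  obtain P R where PR: "P \<in> hrt (p + 1)" "R \<in> hrt p" "tri C P I R" using two_step assms by blast
  have "orth C P I" using orth_mid_right[OF assms(4)] orth_hrt[of P "p + 1"] PR assms hrt_Ob by simp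
  moreover have "orth C (shift C P) R"
    using orth_hrt[of "shift C P" "p + 2" R p] PR hrt_shift_iff[of P "p + 2"] hrt_Ob
    by (simp add: algebra_simps)
  ultimately have "is_zero C P" using tri_first_zero PR by blast
  then have "isomorphic C I R" using tri_first_zero_iso PR by blast
  then show ?thesis using hrt_iso[OF PR(2) isomorphic_sym] triD(2)[OF PR(3)] by blast
qed

text \<open>Every morphism of a heart has an image: a cone has cohomology \<open>U[1]\<close> and \<open>V\<close>, the kernel
  and the cokernel, and the image is the fibre of the map to the cokernel.\<close>

lemma image_factorization:
  assumes f: "f \<in> Mor C X Y" and X: "X \<in> hrt p" and Y: "Y \<in> hrt p"
  shows "\<exists>I\<in>hrt p. \<exists>U\<in>hrt p. \<exists>V\<in>hrt p. \<exists>e m a b c d. (U, X, I, a, e, b) \<in> dist C \<and>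
    (I, Y, V, m, c, d) \<in> dist C \<and> f = m \<cdot> e"
proof -
  have Ob: "X \<in> Ob C" "Y \<in> Ob C" using X Y hrt_Ob by auto
  obtain Q g h where t: "(X, Y, Q, f, g, h) \<in> dist C" using TR1_cone f Ob by blast
  note dt = distD[OF t]
  have "shift C X \<in> hrt (p + 1)" using X Ob hrt_shift_iff by simp
  then obtain U1 V where UV: "U1 \<in> hrt (p + 1)" "V \<in> hrt p" "tri C U1 Q V"
    using two_step[OF tri_rotate[OF triI[OF t]] Y] by blast
  obtain U where U: "U \<in> Ob C" "U1 = shift C U" using shift_surj UV(1) hrt_Ob by blast
  have U_hrt: "U \<in> hrt p" using U UV hrt_shift_iff by simp
  have VOb: "V \<in> Ob C" using UV hrt_Ob by blast
  obtain i v j where t2: "(shift C U, Q, V, i, v, j) \<in> dist C" using UV(3) U tri_def by metis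
  note d2 = distD[OF t2]
  have t2': "(Q, V, shift C (shift C U), v, j, \<ominus>\<^bsub>Hom C (shift C (shift C U)) (shift C Q)\<^esub> shiftm C i) \<in> dist C"
    using dist_rotate[OF t2] .
  have vg: "v \<cdot> g \<in> Mor C Y V" using cmp_in[of Y Q V v g] dt d2 by simp
  obtain I1 w w' where t3: "(Y, V, I1, v \<cdot> g, w, w') \<in> dist C" using TR1_cone[OF Ob(2) VOb vg] by blast
  obtain I where I: "I \<in> Ob C" "I1 = shift C I" using shift_surj distD(3)[OF t3] by blast
  obtain m where m: "(I, Y, V, m, v \<cdot> g, w) \<in> dist C" "m \<in> Mor C I Y"
    "w' = \<ominus>\<^bsub>Hom C (shift C I) (shift C Y)\<^esub> shiftm C m"
    using dist_unrotate[of Y V I "v \<cdot> g" w w'] t3 I by blast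
  obtain a b where ab: "(shift C X, shift C I, shift C (shift C U), a, b,
      shiftm C h \<cdot> (\<ominus>\<^bsub>Hom C (shift C (shift C U)) (shift C Q)\<^esub> shiftm C i)) \<in> dist C"
    "w' \<cdot> a = \<ominus>\<^bsub>Hom C (shift C X) (shift C Y)\<^esub> shiftm C f"
    using TR4[OF dist_rotate[OF t] t2' t3] I by blast
  obtain e where e: "e \<in> Mor C X I" "a = shiftm C e"
    using shiftm_surj[OF Ob(1) I(1)] distD(4)[OF ab(1)] by blast
  have "\<ominus>\<^bsub>Hom C (shift C X) (shift C Y)\<^esub> shiftm C (m \<cdot> e) = \<ominus>\<^bsub>Hom C (shift C X) (shift C Y)\<^esub> shiftm C f"
    using ab(2) m e Ob I cmp_uminus_left[of "shift C X" "shift C I" "shift C Y" "shiftm C m" "shiftm C e"]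
      shiftm_cmp[of X I Y m e] by simp
  then have "shiftm C (m \<cdot> e) = shiftm C f"
    using uminus_inj[of "shift C X" "shift C Y" "shiftm C (m \<cdot> e)" "shiftm C f"] shiftm_in[of X Y]
      cmp_in[of X I Y m e] m(2) e(1) f Ob I(1) shift_Ob by blast
  then have fme: "f = m \<cdot> e" using shiftm_inj[of X Y "m \<cdot> e" f] cmp_in[of X I Y m e] m e f Ob I by simp
  have tXI: "tri C X I (shift C U)"
    using triI[OF ab(1)] tri_shift_iff[of X I "shift C U"] Ob I U by simp
  have hI: "I \<in> hrt p"
  proof (rule hrt_squeeze[OF tXI X])
    show "shift C U \<in> hrt (p + 1)" using UV U by simp
    show "tri C (shift_by C (- 1) V) I Y" using tri_unshift_third[OF triI[OF m(1)]] .
    show "shift_by C (- 1) V \<in> hrt (p - 1)" using hrt_shift_by[OF UV(2), of "- 1"] by simp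
  qed (rule Y)
  \<comment> \<open>Three rotations undo the shift of the octahedral triangle at the price of a sign, which is then
    moved from \<open>e\<close> to the connecting map.\<close>
  obtain f1 where f1: "(shift C U, shift C X, shift C I, f1, a, b) \<in> dist C"
    using dist_unrotate[OF ab(1)] U by auto
  obtain f2 where f2: "(I, shift C U, shift C X, f2, f1, a) \<in> dist C"
    using dist_unrotate[OF f1 I(1)] by blast
  obtain x where x: "(X, I, shift C U, x, f2, f1) \<in> dist C" "x \<in> Mor C X I"
    "a = \<ominus>\<^bsub>Hom C (shift C X) (shift C I)\<^esub> shiftm C x"
    using dist_unrotate[OF f2 Ob(1)] by blast
  obtain y where y: "(U, X, I, y, x, f2) \<in> dist C" using dist_unrotate[OF x(1) U(1)] by blast
  have "shiftm C e = shiftm C (\<ominus>\<^bsub>Hom C X I\<^esub> x)" using x(2,3) e(2) Ob I shiftm_uminus by simp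
  then have "e = \<ominus>\<^bsub>Hom C X I\<^esub> x" using shiftm_inj[OF Ob(1) I(1) e(1) uminus_in] x(2) Ob I by blast
  then show ?thesis using dist_uminus[OF y] fme m(1) hI U_hrt UV(2) by blast
qed

end

section \<open>Phases\<close>

text \<open>The values \<open>r exp (\<i> \<pi> t)\<close> with \<open>r > 0\<close> and \<open>0 < t \<le> 1\<close>, described so that closure under addition
  is evident.\<close>

definition upper :: "complex set" where
  "upper = {c. 0 < Im c \<or> (Im c = 0 \<and> Re c < 0)}"

definition phase :: "complex \<Rightarrow> real" where
  "phase c = Arg c / pi"

text \<open>The sign of \<open>tilt t c\<close> compares the phase of \<open>c\<close> with \<open>t\<close>; unlike the phase it is linear
  in \<open>c\<close>.\<close>

definition tilt :: "real \<Rightarrow> complex \<Rightarrow> real" where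
  "tilt t c = Im (c * cis (- (pi * t)))"

lemma tilt_simps [simp]: "tilt t 0 = 0" "tilt t (c + d) = tilt t c + tilt t d" "tilt t (- c) = - tilt t c"
  by (simp_all add: tilt_def algebra_simps)

lemma tilt_sum_list: "tilt t (\<Sum>x\<leftarrow>xs. f x) = (\<Sum>x\<leftarrow>xs. tilt t (f x))"
  by (induction xs) auto

lemma upper_add: "c \<in> upper \<Longrightarrow> d \<in> upper \<Longrightarrow> c + d \<in> upper"
  by (auto simp: upper_def)

lemma polar_cis: "complex_of_real r * exp (\<i> * complex_of_real (pi * s)) = of_real r * cis (pi * s)"
  by (simp add: cis_conv_exp)

lemma tilt_polar: "tilt t (of_real r * cis (pi * s)) = r * sin (pi * (s - t))"
  by (simp add: tilt_def cis_mult mult.assoc right_diff_distrib)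

lemma upper_polar:
  assumes "r > 0" "0 < s" "s \<le> 1"
  shows "of_real r * cis (pi * s) \<in> upper"
proof (cases "s = 1")
  case False
  then have "sin (pi * s) > 0" using assms by (intro sin_gt_zero) auto
  then show ?thesis using assms by (simp add: upper_def)
qed (use assms in \<open>simp add: upper_def\<close>)

lemma phase_polar:
  assumes "r > 0" "0 < s" "s \<le> 1"
  shows "phase (of_real r * cis (pi * s)) = s"
proof -
  have "Arg (of_real r * cis (pi * s)) = pi * s"
  proof (rule cis_Arg_unique)
    show "sgn (of_real r * cis (pi * s)) = cis (pi * s)"
      using assms by (simp add: sgn_mult sgn_of_real)
    have "- pi < 0" "0 < pi * s" using assms by auto
    then show "- pi < pi * s" by linarith
    show "pi * s \<le> pi" using assms by simp
  qed
  then show ?thesis by (simp add: phase_def)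
qed

lemma upperE:
  assumes "c \<in> upper"
  shows "0 < cmod c" "c = of_real (cmod c) * cis (pi * phase c)" "0 < phase c" "phase c \<le> 1"
proof -
  have c0: "c \<noteq> 0" using assms by (auto simp: upper_def)
  then show r: "0 < cmod c" by simp
  have b: "- pi < Arg c" "Arg c \<le> pi" using Arg_bounded by auto
  have polar: "c = of_real (cmod c) * cis (Arg c)"
    using rcis_cmod_Arg[of c] by (simp add: rcis_def)
  then show "c = of_real (cmod c) * cis (pi * phase c)" by (simp add: phase_def)
  have im: "Im c = cmod c * sin (Arg c)" "Re c = cmod c * cos (Arg c)"
    by (subst polar, simp)+
  have "0 < Arg c"
  proof (rule ccontr)
    assume "\<not> 0 < Arg c"
    then consider "Arg c = 0" | "- pi < Arg c" "Arg c < 0" using b by linarith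
    then show False
    proof cases
      case 1
      then show False using assms im r by (auto simp: upper_def)
    next
      case 2
      then have "sin (- Arg c) > 0" by (intro sin_gt_zero) auto
      then have "Im c < 0" using im r by (simp add: mult_less_0_iff zero_less_mult_iff)
      then show False using assms by (auto simp: upper_def)
    qed
  qed
  then show "0 < phase c" by (simp add: phase_def)
  show "phase c \<le> 1" using b by (simp add: phase_def)
qed

lemma tilt_iff:
  assumes c: "c \<in> upper" and t: "0 < t" "t \<le> 1"
  shows "tilt t c < 0 \<longleftrightarrow> phase c < t" "tilt t c \<le> 0 \<longleftrightarrow> phase c \<le> t" "tilt t c = 0 \<longleftrightarrow> phase c = t"
proof -
  note c' = upperE[OF c]
  have eq: "tilt t c = cmod c * sin (pi * (phase c - t))" by (subst c'(2)) (rule tilt_polar)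
  have 1: "tilt t c < 0" if "phase c < t"
  proof -
    have "pi * (t - phase c) < pi * 1" using c' t by (intro mult_strict_left_mono) auto
    then have "sin (pi * (t - phase c)) > 0" using that by (intro sin_gt_zero) auto
    moreover have "sin (pi * (phase c - t)) = - sin (pi * (t - phase c))"
      by (simp add: right_diff_distrib sin_diff)
    ultimately show ?thesis using eq c'(1) by (simp add: mult_less_0_iff)
  qed
  have 2: "tilt t c > 0" if "phase c > t"
  proof -
    have "pi * (phase c - t) < pi * 1" using c' t by (intro mult_strict_left_mono) auto
    then have "sin (pi * (phase c - t)) > 0" using that by (intro sin_gt_zero) auto
    then show ?thesis using eq c'(1) by simp
  qed
  have 3: "tilt t c = 0" if "phase c = t" using eq that by simp
  show "tilt t c < 0 \<longleftrightarrow> phase c < t" "tilt t c \<le> 0 \<longleftrightarrow> phase c \<le> t" "tilt t c = 0 \<longleftrightarrow> phase c = t"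
    using 1 2 3 by (cases "phase c" t rule: linorder_cases; force)+
qed


section \<open>Semistable objects\<close>

text \<open>A Harder--Narasimhan filtration without zero factors, so that its phases are determined by
  \<open>X\<close>.\<close>

definition hn :: "('k, 'o, 'm) tricat \<Rightarrow> (real \<Rightarrow> 'o set) \<Rightarrow> (real \<times> 'o) list \<Rightarrow> 'o \<Rightarrow> bool" where
  "hn C P L X \<longleftrightarrow> sorted_wrt (>) (map fst L) \<and>
     (\<forall>(t, A)\<in>set L. A \<in> P t \<and> \<not> is_zero C A) \<and> X \<in> Filt C (map snd L)"

context simple_minded
begin

lemma hrt_Filt: "X \<in> Filt C w \<Longrightarrow> set w \<subseteq> hrt p \<Longrightarrow> X \<in> hrt p"
proof (induction w arbitrary: X)
  case Nil
  then show ?case using hrt_zero by simp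
next
  case (Cons S w)
  then obtain Y where "Y \<in> Filt C w" "tri C S X Y" by auto
  then show ?case using Cons hrt_ext[of S X Y p] by simp
qed

text \<open>If all simple objects have charge \<open>1\<close>, an object of a shifted heart has as its charge, up to
  sign, the common length of its Jordan--Hoelder filtrations.\<close>

definition len :: "'o \<Rightarrow> nat" where
  "len X = nat \<lfloor>cmod (charge (\<lambda>_. 1) X)\<rfloor>"

lemma len_word:
  assumes "is_word w" "\<And>x. x \<in> set w \<Longrightarrow> snd x = p" "X \<in> wfilt w"
  shows "len X = length w"
proof -
  have "weight (\<lambda>_. 1) w = signed p (of_nat (length w))"
    using assms(2)
  proof (induction w)
    case (Cons x w)
    then have "snd x = p" "weight (\<lambda>_. 1) w = signed p (of_nat (length w))" by auto
    then show ?case by (cases x) (simp add: signed_def)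
  qed simp
  then have "cmod (charge (\<lambda>_. 1) X) = real (length w)"
    using charge_eq[OF assms(1,3)] by (simp add: signed_def)
  then show ?thesis by (simp add: len_def)
qed

lemma len_tri:
  assumes "tri C X Y Z" "X \<in> hrt p" "Z \<in> hrt p"
  shows "len Y = len X + len Z"
proof -
  obtain u where u: "is_word u" "\<And>x. x \<in> set u \<Longrightarrow> snd x = p" "X \<in> wfilt u" using assms(2) by (rule hrtE) blast
  obtain v where v: "is_word v" "\<And>x. x \<in> set v \<Longrightarrow> snd x = p" "Z \<in> wfilt v" using assms(3) by (rule hrtE) blast
  have "Y \<in> wfilt (u @ v)" using assms(1) u v Filt_append by auto
  then have "len Y = length (u @ v)" using u v by (intro len_word[of _ p]) auto
  then show ?thesis using len_word[OF u] len_word[OF v] by simp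
qed

lemma len_zero:
  assumes "X \<in> hrt p" "len X = 0"
  shows "is_zero C X"
proof -
  obtain u where u: "is_word u" "\<And>x. x \<in> set u \<Longrightarrow> snd x = p" "X \<in> wfilt u" using assms(1) by (rule hrtE) blast
  then show ?thesis using len_word[OF u] assms(2) by simp
qed

end

locale stability_function = simple_minded k C \<S>
  for k :: "'k ring" and C :: "('k, 'o, 'm) tricat" (structure) and \<S> :: "'o set" +
  fixes z :: "'o \<Rightarrow> complex"
  assumes z_upper: "S \<in> \<S> \<Longrightarrow> z S \<in> upper"
begin

abbreviation "Z \<equiv> charge z"

lemma Z_hrt_word:
  assumes "is_word w" "\<And>x. x \<in> set w \<Longrightarrow> snd x = 0" "w \<noteq> []"
  shows "weight z w \<in> upper"
  using assms
proof (induction w)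
  case (Cons x w)
  have "snd x = 0" using Cons.prems(2) by simp
  then obtain S where x: "x = (S, 0)" "S \<in> \<S>" using Cons.prems(1) by (cases x) auto
  show ?case
  proof (cases "w = []")
    case True
    then show ?thesis using x z_upper by simp
  next
    case False
    then show ?thesis using x z_upper Cons upper_add by simp
  qed
qed simp

lemma Z_upper:
  assumes "X \<in> hrt 0" "\<not> is_zero C X"
  shows "Z X \<in> upper"
proof -
  obtain u where u: "is_word u" "\<And>x. x \<in> set u \<Longrightarrow> snd x = 0" "X \<in> wfilt u" using assms(1) by (rule hrtE) blast
  then have "u \<noteq> []" using assms(2) by auto
  then show ?thesis using Z_hrt_word u charge_eq[OF u(1,3)] by simp
qed

lemma Z_zero: "is_zero C X \<Longrightarrow> Z X = 0"
  using additive_zero additive_charge by blast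

lemma Z_tri: "tri C X Y W \<Longrightarrow> Z Y = Z X + Z W"
  by (rule charge_tri)

text \<open>For \<open>0 < t \<le> 1\<close> these are the semistable objects of phase \<open>t\<close> in the heart, together with
  the zero objects.\<close>

definition sem :: "real \<Rightarrow> 'o set" where
  "sem t = {X \<in> hrt 0. tilt t (Z X) = 0 \<and>
     (\<forall>A\<in>hrt 0. \<forall>B\<in>hrt 0. tri C A X B \<longrightarrow> tilt t (Z A) \<le> 0)}"

lemma sem_phase: "X \<in> sem t \<Longrightarrow> \<not> is_zero C X \<Longrightarrow> 0 < t \<Longrightarrow> t \<le> 1 \<Longrightarrow> phase (Z X) = t"
  unfolding sem_def using Z_upper tilt_iff(3) by blast

lemma sem_iso:
  assumes "X \<in> sem t" "isomorphic C X Y" "Y \<in> Ob C"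
  shows "Y \<in> sem t"
proof -
  have X: "X \<in> hrt 0" "X \<in> Ob C" using assms(1) hrt_Ob by (auto simp: sem_def)
  have "Z Y = Z X" using additive_iso[OF additive_charge assms(2) X(2) assms(3)] by simp
  moreover have "tri C A X B" if "tri C A Y B" for A B
    using tri_mid_iso[OF that isomorphic_sym[OF assms(2)] X(2)] .
  ultimately show ?thesis using assms hrt_iso[OF X(1) assms(2,3)] unfolding sem_def by auto
qed

text \<open>A nonzero map factors through its image, whose phase is at least \<open>s\<close> as a quotient of \<open>X\<close>
  and at most \<open>t\<close> as a subobject of \<open>Y\<close>.\<close>

lemma orth_sem:
  assumes X: "X \<in> sem s" and Y: "Y \<in> sem t" and st: "0 < t" "t < s" "s \<le> 1"
  shows "orth C X Y"
proof (rule orthI)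
  show Ob: "X \<in> Ob C" "Y \<in> Ob C" using X Y hrt_Ob by (auto simp: sem_def)
  fix f assume f: "f \<in> Mor C X Y"
  have XY: "X \<in> hrt 0" "Y \<in> hrt 0" using X Y by (auto simp: sem_def)
  obtain I U V e m a b c d where I: "I \<in> hrt 0" "U \<in> hrt 0" "V \<in> hrt 0"
    and d: "(U, X, I, a, e, b) \<in> dist C" "(I, Y, V, m, c, d) \<in> dist C" and fme: "f = m \<cdot> e"
    using image_factorization[OF f XY] by blast
  have "tilt s (Z U) \<le> 0" "tilt s (Z X) = 0" using X I triI[OF d(1)] unfolding sem_def by auto
  then have Is: "tilt s (Z I) \<ge> 0" using Z_tri[OF triI[OF d(1)]] by simp
  have It: "tilt t (Z I) \<le> 0" using Y I triI[OF d(2)] unfolding sem_def by auto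
  have "is_zero C I"
  proof (rule ccontr)
    assume "\<not> is_zero C I"
    then have "Z I \<in> upper" using Z_upper I by blast
    then show False using tilt_iff(1)[of "Z I" s] tilt_iff(2)[of "Z I" t] Is It st by force
  qed
  then have "e = zerom C X I" using distD(5)[OF d(1)] Ob unfolding is_zero_def by blast
  then show "f = zerom C X Y" using fme distD(4)[OF d(2)] Ob I hrt_Ob cmp_zero_right by blast
qed

text \<open>A subobject of maximal phase, and of maximal length among these.  It is semistable, and a
  nonzero subobject of the quotient has smaller phase, since otherwise its preimage would
  contradict the choice.\<close>

lemma maximal_destabilizing:
  assumes X: "X \<in> hrt 0" "\<not> is_zero C X"
  shows "\<exists>A\<in>hrt 0. \<exists>B\<in>hrt 0. tri C A X B \<and> \<not> is_zero C A \<and> A \<in> sem (phase (Z A)) \<and>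
    (\<forall>A'\<in>hrt 0. \<forall>B'\<in>hrt 0. tri C A' B B' \<longrightarrow> \<not> is_zero C A' \<longrightarrow> phase (Z A') < phase (Z A))"
proof -
  define Sub where "Sub = {A \<in> hrt 0. \<not> is_zero C A \<and> (\<exists>B\<in>hrt 0. tri C A X B)}"
  have SubI: "A \<in> Sub" if "A \<in> hrt 0" "\<not> is_zero C A" "B \<in> hrt 0" "tri C A X B" for A B
    using that unfolding Sub_def by blast
  obtain N where N: "is_zero C N" using ex_zero by blast
  have XSub: "X \<in> Sub" using SubI[OF X hrt_zero[OF N]] tri_ident_right N hrt_Ob X by blast
  have len_le: "len A \<le> len X" if "A \<in> Sub" for A
    using that len_tri[of A X _ 0] unfolding Sub_def by force
  let ?W = "{w. set w \<subseteq> \<S> \<times> {0 :: int} \<and> length w \<le> len X}"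
  have "Z ` Sub \<subseteq> weight z ` ?W"
  proof
    fix c assume "c \<in> Z ` Sub"
    then obtain A where A: "A \<in> Sub" "c = Z A" by blast
    then have "A \<in> hrt 0" unfolding Sub_def by blast
    then obtain w where w: "is_word w" "\<And>x. x \<in> set w \<Longrightarrow> snd x = 0" "A \<in> wfilt w" by (rule hrtE) blast
    have "set w \<subseteq> \<S> \<times> {0}" using w unfolding is_word_def by force
    then have "w \<in> ?W" using len_word[OF w] len_le[OF A(1)] by simp
    then show "c \<in> weight z ` ?W" using A charge_eq[OF w(1,3)] by blast
  qed
  moreover have "finite ?W" using finite_S by (intro finite_lists_length_le) auto
  ultimately have "finite (Z ` Sub)" by (rule finite_subset[OF _ finite_imageI])
  then have fin: "finite (phase ` Z ` Sub)" by (rule finite_imageI)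
  define M where "M = Max (phase ` Z ` Sub)"
  have M_ge: "phase (Z A) \<le> M" if "A \<in> Sub" for A
    unfolding M_def using fin that by (intro Max_ge) auto
  have "M \<in> phase ` Z ` Sub" unfolding M_def using fin XSub by (intro Max_in) auto
  then obtain A1 where A1: "A1 \<in> Sub \<and> phase (Z A1) = M" by blast
  have "\<exists>A. (A \<in> Sub \<and> phase (Z A) = M) \<and> (\<forall>A'. A' \<in> Sub \<and> phase (Z A') = M \<longrightarrow> len A' \<le> len A)"
    by (rule ex_has_greatest_nat[of _ A1 _ "Suc (len X)"]) (simp_all add: A1 len_le less_Suc_eq_le)
  then obtain A where A: "A \<in> Sub" "phase (Z A) = M"
    and max: "\<And>A'. A' \<in> Sub \<Longrightarrow> phase (Z A') = M \<Longrightarrow> len A' \<le> len A"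
    by blast
  obtain B where B: "B \<in> hrt 0" "tri C A X B" and A0: "A \<in> hrt 0" "\<not> is_zero C A"
    using A(1) unfolding Sub_def by blast
  have ZA: "Z A \<in> upper" using Z_upper A0 by blast
  have M01: "0 < M" "M \<le> 1" using upperE[OF ZA] A by auto
  have tilt_le: "tilt M (Z A') \<le> 0" if "A' \<in> Sub" for A'
    using that M_ge tilt_iff(2)[OF Z_upper M01] unfolding Sub_def by blast
  have "A \<in> sem M"
    unfolding sem_def
  proof (intro CollectI conjI ballI impI)
    show "tilt M (Z A) = 0" using tilt_iff(3)[OF ZA M01] A by simp
    fix A' B' assume A': "A' \<in> hrt 0" "B' \<in> hrt 0" "tri C A' A B'"
    show "tilt M (Z A') \<le> 0"
    proof (cases "is_zero C A'")
      case True
      then show ?thesis using Z_zero by simp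
    next
      case False
      obtain Y where "tri C A' X Y" "tri C B' Y B" using octahedral_push[OF A'(3) B(2)] by blast
      then have "A' \<in> Sub" using SubI A' False hrt_ext B by blast
      then show ?thesis using tilt_le by blast
    qed
  qed (rule A0)
  moreover have "phase (Z A') < M" if A': "A' \<in> hrt 0" "B' \<in> hrt 0" "tri C A' B B'" "\<not> is_zero C A'" for A' B'
  proof (rule ccontr)
    assume "\<not> phase (Z A') < M"
    then have "tilt M (Z A') \<ge> 0" using tilt_iff(1)[OF Z_upper[OF A'(1,4)] M01] by simp
    obtain E where E: "tri C A E A'" "tri C E X B'" using octahedral_pull[OF B(2) A'(3)] by blast
    have Eh: "E \<in> hrt 0" using hrt_ext E A0 A' by blast
    have lenE: "len E = len A + len A'" using len_tri[OF E(1)] A0 A' by blast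
    have "len A' > 0" using len_zero[OF A'(1)] A'(4) by blast
    have "\<not> is_zero C E"
    proof
      assume "is_zero C E"
      then have "len E = 0" using len_word[of "[]" 0 E] by simp
      then show False using lenE \<open>len A' > 0\<close> by simp
    qed
    then have ESub: "E \<in> Sub" using SubI Eh A'(2) E(2) by blast
    have "tilt M (Z E) \<ge> 0"
      using Z_tri[OF E(1)] \<open>tilt M (Z A') \<ge> 0\<close> \<open>A \<in> sem M\<close> unfolding sem_def by simp
    then have "phase (Z E) = M"
      using tilt_le[OF ESub] tilt_iff(3)[OF Z_upper[OF Eh \<open>\<not> is_zero C E\<close>] M01] by simp
    then show False using max[OF ESub] lenE \<open>len A' > 0\<close> by simp
  qed
  ultimately show ?thesis using A B A0 by blast
qed


subsection \<open>The slicing\<close>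

text \<open>Here \<open>\<lceil>t\<rceil> - 1\<close> is the integer \<open>p\<close> with \<open>p < t \<le> p + 1\<close>.\<close>

definition slice :: "real \<Rightarrow> 'o set" where
  "slice t = shift_by C (\<lceil>t\<rceil> - 1) ` sem (t - of_int (\<lceil>t\<rceil> - 1))"

lemma slice_unit: "0 < t \<Longrightarrow> t \<le> 1 \<Longrightarrow> slice t = sem t"
proof -
  assume t: "0 < t" "t \<le> 1"
  then have "\<lceil>t\<rceil> = 1" by (simp add: ceiling_eq_iff)
  then show ?thesis unfolding slice_def by simp
qed

lemma ceiling_unit: "0 < t - of_int (\<lceil>t\<rceil> - 1)" "t - of_int (\<lceil>t\<rceil> - 1) \<le> (1 :: real)"
  using ceiling_correct[of t] by auto

lemma sem_Ob: "X \<in> sem t \<Longrightarrow> X \<in> Ob C"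
  using hrt_Ob by (auto simp: sem_def)

lemma slice_shift_by: "slice (t + of_int p) = shift_by C p ` slice t"
proof -
  have "\<lceil>t + of_int p\<rceil> = \<lceil>t\<rceil> + p" by simp
  then have "slice (t + of_int p) = shift_by C (p + (\<lceil>t\<rceil> - 1)) ` sem (t - of_int (\<lceil>t\<rceil> - 1))"
    unfolding slice_def by (simp add: algebra_simps)
  also have "\<dots> = shift_by C p ` shift_by C (\<lceil>t\<rceil> - 1) ` sem (t - of_int (\<lceil>t\<rceil> - 1))"
    unfolding image_image using sem_Ob shift_by_shift_by by (intro image_cong) auto
  finally show ?thesis unfolding slice_def .
qed

lemma slice_hrt: "X \<in> slice t \<Longrightarrow> X \<in> hrt (\<lceil>t\<rceil> - 1)"
  unfolding slice_def sem_def using hrt_shift_by[of _ 0] by fastforce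

lemma slice_Ob: "X \<in> slice t \<Longrightarrow> X \<in> Ob C"
  using slice_hrt hrt_Ob by blast

lemma orth_slice:
  assumes "X \<in> slice s" "Y \<in> slice t" "t < s"
  shows "orth C X Y"
proof (cases "\<lceil>s\<rceil> = \<lceil>t\<rceil>")
  case True
  obtain X0 Y0 where X0: "X = shift_by C (\<lceil>s\<rceil> - 1) X0" "X0 \<in> sem (s - of_int (\<lceil>s\<rceil> - 1))"
    and Y0: "Y = shift_by C (\<lceil>t\<rceil> - 1) Y0" "Y0 \<in> sem (t - of_int (\<lceil>t\<rceil> - 1))"
    using assms unfolding slice_def by blast
  have "orth C X0 Y0"
    by (rule orth_sem[OF X0(2) Y0(2)]) (use assms True ceiling_unit[of s] ceiling_unit[of t] in auto)
  then show ?thesis using orth_shift_by_iff X0 Y0 True sem_Ob by simp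
next
  case False
  have "\<lceil>t\<rceil> < \<lceil>s\<rceil>" using False assms(3) by (metis ceiling_mono less_le)
  then show ?thesis using orth_hrt[OF slice_hrt[OF assms(1)] slice_hrt[OF assms(2)]] by simp
qed

lemma slice_iso:
  assumes "X \<in> slice t" "isomorphic C X Y" "Y \<in> Ob C"
  shows "Y \<in> slice t"
proof -
  define p where "p = \<lceil>t\<rceil> - 1"
  obtain X0 where X0: "X = shift_by C p X0" "X0 \<in> sem (t - of_int p)"
    using assms unfolding slice_def p_def by blast
  have Y: "Y = shift_by C p (shift_by C (- p) Y)" using shift_by_inverse assms by simp
  then have "isomorphic C X0 (shift_by C (- p) Y)"
    using isomorphic_shift_by_iff[of X0 "shift_by C (- p) Y" p] assms X0 sem_Ob by simp
  then have "shift_by C (- p) Y \<in> sem (t - of_int p)" using sem_iso[OF X0(2)] assms by simp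
  then show ?thesis using Y unfolding slice_def p_def by blast
qed

lemma Z_slice:
  assumes "X \<in> slice t" "\<not> is_zero C X"
  shows "\<exists>m>0. Z X = complex_of_real m * exp (\<i> * complex_of_real (pi * t))"
proof -
  define p where "p = \<lceil>t\<rceil> - 1"
  obtain X0 where X0: "X = shift_by C p X0" "X0 \<in> sem (t - of_int p)"
    using assms unfolding slice_def p_def by blast
  have nz: "\<not> is_zero C X0" using assms X0 shift_by_zero_iff sem_Ob by blast
  have X0h: "X0 \<in> hrt 0" using X0 by (simp add: sem_def)
  note u = upperE[OF Z_upper[OF X0h nz]]
  have "phase (Z X0) = t - of_int p"
    using sem_phase[OF X0(2) nz] ceiling_unit[of t] unfolding p_def by blast
  then have "Z X0 = of_real (cmod (Z X0)) * cis (pi * (t - of_int p))" using u by simp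
  moreover have "Z X = signed p (Z X0)" using additive_shift_by[OF additive_charge] X0 sem_Ob by blast
  moreover have "signed p (cis (pi * (t - of_int p))) = cis (pi * t)"
  proof -
    have "cis (pi * t) = cis (pi * of_int p) * cis (pi * (t - of_int p))"
      by (simp add: cis_mult algebra_simps)
    moreover have "cis (pi * of_int p) = (if even p then 1 else -1)"
      using sin_npi_int[of p] cos_npi_int[of p] by (simp add: complex_eq_iff)
    ultimately show ?thesis by (simp add: signed_def)
  qed
  moreover have "signed p (of_real r * c) = of_real r * signed p c" for r c by (simp add: signed_def)
  ultimately have "Z X = of_real (cmod (Z X0)) * cis (pi * t)" by metis
  then show ?thesis using u(1) polar_cis by metis
qed


subsection \<open>Harder--Narasimhan filtrations\<close>

lemma hn_Nil: "is_zero C X \<Longrightarrow> hn C P [] X"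
  by (simp add: hn_def)

lemma hn_append:
  assumes "tri C A X B" "hn C P L A" "hn C P L' B"
    and "\<And>s t. s \<in> fst ` set L \<Longrightarrow> t \<in> fst ` set L' \<Longrightarrow> t < s"
  shows "hn C P (L @ L') X"
  using assms unfolding hn_def by (auto simp: sorted_wrt_append Filt_append)

text \<open>Induction on the length: splitting off a maximal destabilizing subobject leaves a quotient of
  smaller length, whose phases are smaller because its first factor is a subobject of it.\<close>

lemma hn_heart:
  assumes "X \<in> hrt 0"
  shows "\<exists>L. hn C slice L X \<and> fst ` set L \<subseteq> {0<..1}"
  using assms
proof (induction "len X" arbitrary: X rule: less_induct)
  case less
  show ?case
  proof (cases "is_zero C X")
    case True
    then show ?thesis using hn_Nil by (intro exI[of _ "[]"]) auto
  next
    case False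
    obtain A B where A: "A \<in> hrt 0" "B \<in> hrt 0" "tri C A X B" "\<not> is_zero C A" "A \<in> sem (phase (Z A))"
      and quot: "\<And>A' B'. A' \<in> hrt 0 \<Longrightarrow> B' \<in> hrt 0 \<Longrightarrow> tri C A' B B' \<Longrightarrow> \<not> is_zero C A' \<Longrightarrow> phase (Z A') < phase (Z A)"
      using maximal_destabilizing[OF less(2) False] by blast
    have "len B < len X" using len_tri[OF A(3,1,2)] len_zero[OF A(1)] A(4) by fastforce
    then obtain L where L: "hn C slice L B" "fst ` set L \<subseteq> {0<..1}" using less(1) A(2) by blast
    have ph: "0 < phase (Z A)" "phase (Z A) \<le> 1" using upperE[OF Z_upper[OF A(1,4)]] by auto
    have "t < phase (Z A)" if t: "t \<in> fst ` set L" for t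
    proof -
      obtain t0 A0 L' where L0: "L = (t0, A0) # L'" using t by (cases L) auto
      have t0: "t \<le> t0" "0 < t0" "t0 \<le> 1" using t L L0 by (auto simp: hn_def)
      have A0: "A0 \<in> sem t0" "\<not> is_zero C A0" using L L0 slice_unit[OF t0(2,3)] by (auto simp: hn_def)
      obtain R where R: "tri C A0 B R" "R \<in> Filt C (map snd L')" using L L0 by (auto simp: hn_def)
      have "set (map snd L') \<subseteq> hrt 0"
      proof
        fix Y assume "Y \<in> set (map snd L')"
        then obtain s where "(s, Y) \<in> set L'" by auto
        then have s: "(s, Y) \<in> set L" using L0 by simp
        then have "0 < s" "s \<le> 1" "Y \<in> slice s" using L by (force simp: hn_def)+
        then show "Y \<in> hrt 0" using slice_unit by (auto simp: sem_def)
      qed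
      then have "R \<in> hrt 0" using hrt_Filt R by blast
      then have "phase (Z A0) < phase (Z A)" using quot[OF _ _ R(1)] A0 by (auto simp: sem_def)
      then show ?thesis using sem_phase[OF A0 t0(2,3)] t0 by simp
    qed
    moreover have "hn C slice [(phase (Z A), A)] A"
      using A slice_unit[OF ph] Filt_single_self[of A] hrt_Ob by (simp add: hn_def del: Filt.simps)
    ultimately have "hn C slice ([(phase (Z A), A)] @ L) X"
      by (intro hn_append[OF A(3) _ L(1)]) auto
    then show ?thesis using L(2) ph by (intro exI[of _ "[(phase (Z A), A)] @ L"]) auto
  qed
qed

lemma hn_hrt:
  assumes "X \<in> hrt p"
  shows "\<exists>L. hn C slice L X \<and> fst ` set L \<subseteq> {of_int p<..of_int p + 1}"
proof -
  have X: "X \<in> Ob C" using assms hrt_Ob by blast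
  have "shift_by C (- p) X \<in> hrt 0" using hrt_shift_by[OF assms, of "- p"] by simp
  then obtain L where L: "hn C slice L (shift_by C (- p) X)" "fst ` set L \<subseteq> {0<..1}" using hn_heart by blast
  define L' where "L' = map (\<lambda>(t, A). (t + of_int p, shift_by C p A)) L"
  have "X \<in> Filt C (map (shift_by C p) (map snd L))"
    using L(1) Filt_shift_by[of "shift_by C (- p) X" "map snd L" p] shift_by_inverse(2)[OF X] by (simp add: hn_def)
  moreover have "map (shift_by C p) (map snd L) = map snd L'" unfolding L'_def by auto
  moreover have "A \<in> slice t \<and> \<not> is_zero C A" if tA: "(t, A) \<in> set L'" for t A
  proof -
    obtain t0 A0 where "(t0, A0) \<in> set L" "t = t0 + of_int p" "A = shift_by C p A0"
      using tA unfolding L'_def by auto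
    then show ?thesis using L(1) slice_shift_by shift_by_zero_iff slice_Ob by (auto simp: hn_def)
  qed
  moreover have "sorted_wrt (>) (map fst L')"
    using L(1) unfolding L'_def hn_def by (auto simp: sorted_wrt_map case_prod_beta)
  ultimately have "hn C slice L' X" by (auto simp: hn_def)
  moreover have "fst ` set L' \<subseteq> {of_int p<..of_int p + 1}" using L(2) unfolding L'_def by fastforce
  ultimately show ?thesis by blast
qed

text \<open>For a general object the filtrations of its cohomology objects are concatenated.  The bound on
  the phases is what makes the result decreasing.\<close>

lemma hn_descending:
  assumes "is_word w" "descending w" "X \<in> wfilt w"
  shows "\<exists>L. hn C slice L X \<and> (\<forall>t\<in>fst ` set L. \<exists>x\<in>set w. t \<le> of_int (snd x) + 1)"
  using assms
proof (induction "length w" arbitrary: X w rule: less_induct)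
  case less
  show ?case
  proof (cases w)
    case Nil
    then show ?thesis using less hn_Nil by (intro exI[of _ "[]"]) auto
  next
    case (Cons x v)
    define p where "p = snd x"
    have le: "snd y \<le> p" if "y \<in> set w" for y using that less(3) Cons by (auto simp: descending_def p_def)
    let ?u = "filter (\<lambda>x. p - 1 < snd x) w" and ?v = "filter (\<lambda>x. snd x \<le> p - 1) w"
    obtain A B where AB: "A \<in> wfilt ?u" "B \<in> wfilt ?v" "tri C A X B"
      using descending_split[OF less(3,4,2), of "p - 1"] by blast
    have words: "is_word ?u" "is_word ?v" using less(2) is_word_subset[OF less(2)] by auto
    have "snd y = p" if "y \<in> set ?u" for y using that le[of y] by auto
    then have "A \<in> hrt p" unfolding hrt_def using AB(1) words(1) by blast
    then obtain L where L: "hn C slice L A" "fst ` set L \<subseteq> {of_int p<..of_int p + 1}" using hn_hrt by blast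
    have "length ?v < length w" using Cons p_def by (simp add: le_imp_less_Suc)
    moreover have "descending ?v" using less(3) unfolding descending_def by (rule sorted_wrt_filter)
    ultimately obtain L' where L': "hn C slice L' B" "\<forall>t\<in>fst ` set L'. \<exists>x\<in>set ?v. t \<le> of_int (snd x) + 1"
      using less(1) words(2) AB(2) by blast
    have "t \<le> of_int p" if "t \<in> fst ` set L'" for t
      using L'(2) that by force
    then have "hn C slice (L @ L') X" using hn_append[OF AB(3) L(1) L'(1)] L(2) by fastforce
    moreover have "\<exists>y\<in>set w. t \<le> of_int (snd y) + 1" if t: "t \<in> fst ` set (L @ L')" for t
    proof -
      consider "t \<in> fst ` set L" | "t \<in> fst ` set L'" using t by (auto simp: image_Un)
      then show ?thesis
      proof cases
        case 1
        then have "t \<le> of_int (snd x) + 1" using L(2) p_def by auto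
        then show ?thesis using Cons by auto
      next
        case 2
        then obtain y where "y \<in> set ?v" "t \<le> of_int (snd y) + 1" using L'(2) by blast
        then show ?thesis by auto
      qed
    qed
    ultimately show ?thesis by blast
  qed
qed

lemma hn_exists:
  assumes "X \<in> Ob C"
  shows "\<exists>L. hn C slice L X"
proof -
  obtain w where "is_word w" "X \<in> wfilt w" using ex_word assms by blast
  then obtain w' where w': "descending w'" "set w' \<subseteq> set w" "X \<in> wfilt w'" "is_word w'"
    using sort_word is_word_subset by meson
  then show ?thesis using hn_descending by blast
qed

end

section \<open>Additive functions and the Grothendieck group\<close>

context triangulated_category
begin

lemma K_free_comm_group: "comm_group (K_free C)"
  unfolding K_free_def by (rule abelian_free_Abelian_group)

lemma K_free_diff: "x \<in> carrier (K_free C) \<Longrightarrow> y \<in> carrier (K_free C) \<Longrightarrow> x - y \<in> carrier (K_free C)"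
  using keys_diff[of x y] by (auto simp: K_free_def)

lemma K_free_add: "x \<in> carrier (K_free C) \<Longrightarrow> y \<in> carrier (K_free C) \<Longrightarrow> x + y \<in> carrier (K_free C)"
  using keys_add[of x y] by (auto simp: K_free_def)

lemma K_relations_normal: "K_relations C \<lhd> K_free C"
proof -
  interpret comm_group "K_free C" by (rule K_free_comm_group)
  have "{frag_of Y - frag_of X - frag_of Z |X Y Z. \<exists>f g h. (X, Y, Z, f, g, h) \<in> dist C} \<subseteq> carrier (K_free C)"
  proof
    fix r assume "r \<in> {frag_of Y - frag_of X - frag_of Z |X Y Z. \<exists>f g h. (X, Y, Z, f, g, h) \<in> dist C}"
    then obtain X Y Z f g h where r: "r = frag_of Y - frag_of X - frag_of Z" "(X, Y, Z, f, g, h) \<in> dist C"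
      by blast
    note d = distD[OF r(2)]
    have "frag_of X \<in> carrier (K_free C)" "frag_of Y \<in> carrier (K_free C)" "frag_of Z \<in> carrier (K_free C)"
      using d by (simp_all add: K_free_def)
    then show "r \<in> carrier (K_free C)" unfolding r(1) by (intro K_free_diff)
  qed
  then show ?thesis
    unfolding K_relations_def by (intro subgroup_imp_normal generate_is_subgroup)
qed

lemma complex_add_comm_group: "comm_group complex_add_group"
  unfolding complex_add_group_def
proof (rule comm_groupI)
  fix x :: complex assume "x \<in> carrier \<lparr>carrier = UNIV, mult = (+), one = 0\<rparr>"
  show "\<exists>y\<in>carrier \<lparr>carrier = UNIV, mult = (+), one = 0\<rparr>.
      y \<otimes>\<^bsub>\<lparr>carrier = UNIV, mult = (+), one = 0\<rparr>\<^esub> x = \<one>\<^bsub>\<lparr>carrier = UNIV, mult = (+), one = 0\<rparr>\<^esub>"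
    by (rule bexI[of _ "- x"]) auto
qed (auto simp: algebra_simps)

text \<open>On formal sums of objects, a central charge can be computed without cosets.\<close>

lemma K_hom_free:
  assumes "W \<in> hom (K_group C) complex_add_group"
  defines "g \<equiv> \<lambda>x. W (K_relations C #>\<^bsub>K_free C\<^esub> x)"
  shows "\<And>x y. x \<in> carrier (K_free C) \<Longrightarrow> y \<in> carrier (K_free C) \<Longrightarrow> g (x + y) = g x + g y"
    and "g 0 = 0"
    and "\<And>x y. x \<in> carrier (K_free C) \<Longrightarrow> y \<in> carrier (K_free C) \<Longrightarrow> g (x - y) = g x - g y"
    and "\<And>r. r \<in> K_relations C \<Longrightarrow> g r = 0"
proof -
  interpret comm_group "K_free C" by (rule K_free_comm_group)
  interpret normal "K_relations C" "K_free C" by (rule K_relations_normal)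
  have mult: "x \<otimes>\<^bsub>K_free C\<^esub> y = x + y" "\<one>\<^bsub>K_free C\<^esub> = 0" for x y
    by (simp_all add: K_free_def)
  show add: "g (x + y) = g x + g y" if "x \<in> carrier (K_free C)" "y \<in> carrier (K_free C)" for x y
  proof -
    let ?q = "\<lambda>x. K_relations C #>\<^bsub>K_free C\<^esub> x"
    have "?q x \<in> carrier (K_group C)" "?q y \<in> carrier (K_group C)"
      using that by (auto simp: K_group_def carrier_FactGroup)
    moreover have "?q (x + y) = ?q x \<otimes>\<^bsub>K_group C\<^esub> ?q y"
      using rcos_sum that by (simp add: K_group_def FactGroup_def mult)
    ultimately show ?thesis
      using hom_mult[OF assms(1)] unfolding g_def by (simp add: complex_add_group_def)
  qed
  have z: "0 \<in> carrier (K_free C)" using one_closed mult by simp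
  show g0: "g 0 = 0" using add[OF z z] by simp
  show "g (x - y) = g x - g y" if xy: "x \<in> carrier (K_free C)" "y \<in> carrier (K_free C)" for x y
  proof -
    have "g (x - y + y) = g (x - y) + g y" using add xy K_free_diff by blast
    then show ?thesis by simp
  qed
  show "g r = 0" if r: "r \<in> K_relations C" for r
  proof -
    have "K_relations C #>\<^bsub>K_free C\<^esub> r = K_relations C #>\<^bsub>K_free C\<^esub> 0"
      using coset_join2[OF _ is_subgroup] r z subgroup.one_closed[OF is_subgroup] mult subset by auto
    then show ?thesis using g0 unfolding g_def by simp
  qed
qed

lemma frag_of_K_free: "X \<in> Ob C \<Longrightarrow> frag_of X \<in> carrier (K_free C)"
  by (simp add: K_free_def)

lemma K_hom_additive:
  assumes "W \<in> hom (K_group C) complex_add_group"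
  shows "tri_additive C (\<lambda>X. W (K_class C X))"
  unfolding tri_additive_def
proof (intro allI impI)
  fix X Y Z assume t: "tri C X Y Z"
  define g where "g = (\<lambda>x. W (K_relations C #>\<^bsub>K_free C\<^esub> x))"
  have gd: "g (x - y) = g x - g y" if "x \<in> carrier (K_free C)" "y \<in> carrier (K_free C)" for x y
    using K_hom_free(3)[OF assms that] unfolding g_def .
  have gr: "g r = 0" if "r \<in> K_relations C" for r
    using K_hom_free(4)[OF assms that] unfolding g_def .
  note c = frag_of_K_free[OF triD(1)[OF t]] frag_of_K_free[OF triD(2)[OF t]] frag_of_K_free[OF triD(3)[OF t]]
  have "frag_of Y - frag_of X - frag_of Z \<in> K_relations C"
    unfolding K_relations_def using t by (intro generate.incl) (unfold tri_def, blast)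
  then have "g (frag_of Y - frag_of X - frag_of Z) = 0" by (rule gr)
  then have "g (frag_of Y) - g (frag_of X) - g (frag_of Z) = 0"
    using gd c K_free_diff[OF c(2,1)] by simp
  then show "W (K_class C Y) = W (K_class C X) + W (K_class C Z)"
    unfolding g_def K_class_def by (simp add: algebra_simps)
qed

lemma K_hom_unique:
  assumes W: "W \<in> hom (K_group C) complex_add_group" "W \<in> extensional (carrier (K_group C))"
    and W': "W' \<in> hom (K_group C) complex_add_group" "W' \<in> extensional (carrier (K_group C))"
    and eq: "\<And>X. X \<in> Ob C \<Longrightarrow> W (K_class C X) = W' (K_class C X)"
  shows "W = W'"
proof (rule extensionalityI[OF W(2) W'(2)])
  fix c assume "c \<in> carrier (K_group C)"
  then obtain x where x: "x \<in> carrier (K_free C)" "c = K_relations C #>\<^bsub>K_free C\<^esub> x"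
    by (auto simp: K_group_def carrier_FactGroup)
  have "Poly_Mapping.keys x \<subseteq> Ob C" using x by (simp add: K_free_def)
  then have "W (K_relations C #>\<^bsub>K_free C\<^esub> x) = W' (K_relations C #>\<^bsub>K_free C\<^esub> x)"
  proof (rule free_Abelian_group_induct[where P = "\<lambda>x. W (K_relations C #>\<^bsub>K_free C\<^esub> x) = W' (K_relations C #>\<^bsub>K_free C\<^esub> x)"])
    show "W (K_relations C #>\<^bsub>K_free C\<^esub> 0) = W' (K_relations C #>\<^bsub>K_free C\<^esub> 0)"
      using K_hom_free(2)[OF W(1)] K_hom_free(2)[OF W'(1)] by simp
  next
    fix x y :: "'b \<Rightarrow>\<^sub>0 int"
    assume "Poly_Mapping.keys x \<subseteq> Ob C" "Poly_Mapping.keys y \<subseteq> Ob C"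
      "W (K_relations C #>\<^bsub>K_free C\<^esub> x) = W' (K_relations C #>\<^bsub>K_free C\<^esub> x)"
      "W (K_relations C #>\<^bsub>K_free C\<^esub> y) = W' (K_relations C #>\<^bsub>K_free C\<^esub> y)"
    then show "W (K_relations C #>\<^bsub>K_free C\<^esub> (x - y)) = W' (K_relations C #>\<^bsub>K_free C\<^esub> (x - y))"
      using K_hom_free(3)[OF W(1), of x y] K_hom_free(3)[OF W'(1), of x y] by (simp add: K_free_def)
  next
    fix a assume "a \<in> Ob C"
    then show "W (K_relations C #>\<^bsub>K_free C\<^esub> frag_of a) = W' (K_relations C #>\<^bsub>K_free C\<^esub> frag_of a)"
      using eq by (simp add: K_class_def)
  qed
  then show "W c = W' c" using x by simp
qed

lemma K_hom_exists:
  assumes f: "tri_additive C f"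
  shows "\<exists>W\<in>hom (K_group C) complex_add_group. W \<in> extensional (carrier (K_group C)) \<and>
    (\<forall>X\<in>Ob C. W (K_class C X) = f X)"
proof -
  obtain h where h: "h \<in> hom (K_free C) complex_add_group" "\<And>X. X \<in> Ob C \<Longrightarrow> h (frag_of X) = f X"
    using comm_group.free_Abelian_group_universal[OF complex_add_comm_group, of f "Ob C"]
    unfolding K_free_def by (auto simp: complex_add_group_def)
  interpret h: group_hom "K_free C" complex_add_group h
    using h(1) K_free_comm_group complex_add_comm_group
    by (simp add: group_hom_def group_hom_axioms_def comm_group.axioms(2))
  have add: "h (x + y) = h x + h y" if "x \<in> carrier (K_free C)" "y \<in> carrier (K_free C)" for x y
    using h.hom_mult[OF that] by (simp add: K_free_def complex_add_group_def)
  have "K_relations C \<subseteq> kernel (K_free C) complex_add_group h"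
    unfolding K_relations_def
  proof (rule h.G.generate_subgroup_incl)
    show "subgroup (kernel (K_free C) complex_add_group h) (K_free C)" by (rule h.subgroup_kernel)
    show "{frag_of Y - frag_of X - frag_of Z |X Y Z. \<exists>f g h. (X, Y, Z, f, g, h) \<in> dist C}
      \<subseteq> kernel (K_free C) complex_add_group h"
    proof
      fix r assume "r \<in> {frag_of Y - frag_of X - frag_of Z |X Y Z. \<exists>f g h. (X, Y, Z, f, g, h) \<in> dist C}"
      then obtain X Y Z where r: "r = frag_of Y - frag_of X - frag_of Z" and t: "tri C X Y Z"
        unfolding tri_def by blast
      note c = frag_of_K_free[OF triD(1)[OF t]] frag_of_K_free[OF triD(2)[OF t]] frag_of_K_free[OF triD(3)[OF t]]
      have s: "frag_of X + frag_of Z \<in> carrier (K_free C)"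
        using c K_free_add by blast
      have rc: "r \<in> carrier (K_free C)"
        using K_free_diff[OF c(2) s] unfolding r by (simp add: diff_diff_eq)
      have "h (frag_of Y) = h r + h (frag_of X + frag_of Z)"
        using add[OF rc s] r by simp
      then have "h r = 0"
        using add[OF c(1,3)] h(2) triD t f unfolding tri_additive_def by force
      then show "r \<in> kernel (K_free C) complex_add_group h"
        using rc by (simp add: kernel_def complex_add_group_def)
    qed
  qed
  from h.FactGroup_universal_kernel[OF K_relations_normal this] obtain W where
    W: "W \<in> hom (K_group C) complex_add_group"
      "\<And>x. x \<in> carrier (K_free C) \<Longrightarrow> W (K_relations C #>\<^bsub>K_free C\<^esub> x) = h x"
    unfolding K_group_def by blast
  have cls: "K_class C X \<in> carrier (K_group C)" if "X \<in> Ob C" for X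
    using frag_of_K_free[OF that] by (auto simp: K_class_def K_group_def carrier_FactGroup)
  have grp: "group (K_group C)"
    unfolding K_group_def by (rule normal.factorgroup_is_group[OF K_relations_normal])
  have "restrict W (carrier (K_group C)) \<in> hom (K_group C) complex_add_group"
    using W(1) group.is_monoid[OF grp] by (auto simp: hom_def monoid.m_closed)
  moreover have "\<forall>X\<in>Ob C. restrict W (carrier (K_group C)) (K_class C X) = f X"
    using cls W(2) frag_of_K_free h(2) by (auto simp: K_class_def)
  ultimately show ?thesis by (intro bexI[of _ "restrict W (carrier (K_group C))"]) auto
qed


section \<open>Slicings and Harder--Narasimhan lists\<close>

text \<open>The axioms of a slicing without the existence of filtrations.\<close>

definition orthogonal_slices :: "(real \<Rightarrow> 'b set) \<Rightarrow> bool" where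
  "orthogonal_slices P \<longleftrightarrow> (\<forall>t. P t \<subseteq> Ob C) \<and> (\<forall>t. P (t + 1) = shift C ` P t) \<and>
     (\<forall>s t. t < s \<longrightarrow> (\<forall>X\<in>P s. \<forall>Y\<in>P t. orth C X Y))"

lemma slicing_orthogonal: "slicing C P \<Longrightarrow> orthogonal_slices P"
  unfolding slicing_def orthogonal_slices_def additive_subcat_def orth_def by blast

lemma orthogonal_slicesD:
  assumes "orthogonal_slices P"
  shows "X \<in> P t \<Longrightarrow> X \<in> Ob C" "X \<in> P t \<Longrightarrow> shift C X \<in> P (t + 1)"
    "X \<in> P s \<Longrightarrow> Y \<in> P t \<Longrightarrow> t < s \<Longrightarrow> orth C X Y"
  using assms unfolding orthogonal_slices_def by blast+

text \<open>The remaining factors of the filtration have phases below \<open>t + 1\<close>, the phase of \<open>A[1]\<close>.  So \<open>A\<close>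
  would vanish if it had no maps to \<open>X\<close>.  The lemma about the last factor is dual.\<close>

lemma hn_first:
  assumes P: "orthogonal_slices P" and L: "hn C P ((t, A) # L) X"
  shows "\<not> orth C A X"
proof
  assume o: "orth C A X"
  obtain R where R: "R \<in> Filt C (map snd L)" "tri C A X R" using L by (auto simp: hn_def)
  have A: "A \<in> P t" "\<not> is_zero C A" using L by (auto simp: hn_def)
  have "orth C (shift C A) R"
  proof (rule orth_Filt_right[OF R(1)])
    fix B assume "B \<in> set (map snd L)"
    then obtain s where s: "(s, B) \<in> set L" by auto
    then have "s < t" "B \<in> P s" using L by (force simp: hn_def)+
    moreover have "shift C A \<in> P (t + 1)" using A orthogonal_slicesD(2)[OF P] by blast
    ultimately show "orth C (shift C A) B" using orthogonal_slicesD(3)[OF P, of _ "t + 1" B s] by simp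
  qed (use triD R in simp)
  then show False using tri_first_zero[OF R(2) o] A by blast
qed

lemma hn_last:
  assumes P: "orthogonal_slices P" and L: "hn C P (L @ [(t, A)]) X"
  shows "\<not> orth C X A"
proof
  assume o: "orth C X A"
  have A: "A \<in> P t" "\<not> is_zero C A" "A \<in> Ob C" using L P by (auto simp: hn_def orthogonal_slices_def)
  obtain B A' where B: "B \<in> Filt C (map snd L)" "A' \<in> Filt C [A]" "tri C B X A'"
    using L Filt_append[of X "map snd L" "[A]"] by (auto simp: hn_def simp del: Filt.simps)
  then have t: "tri C B X A" using Filt_single[OF A(3)] tri_third_iso[OF B(3)] isomorphic_sym A(3) by blast
  have "shift_by C 1 B \<in> Filt C (map (shift_by C 1) (map snd L))" by (rule Filt_shift_by[OF B(1)])
  then have "orth C (shift_by C 1 B) A"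
  proof (rule orth_Filt_left)
    fix D assume "D \<in> set (map (shift_by C 1) (map snd L))"
    then obtain s D' where s: "(s, D') \<in> set L" "D = shift_by C 1 D'" by auto
    then have D': "t < s" "D' \<in> P s" using L by (force simp: hn_def sorted_wrt_append)+
    then have "D \<in> P (s + 1)" using orthogonal_slicesD(1,2)[OF P D'(2)] s shift_by_1 by simp
    then show "orth C D A" using orthogonal_slicesD(3)[OF P, of D "s + 1" A t] D' A by simp
  qed (rule A)
  then show False using tri_last_zero[OF t o] A shift_by_1 triD(1)[OF t] by simp
qed

lemma P_interval_iff_Filt:
  assumes "orthogonal_slices P"
  shows "X \<in> P_interval C P I \<longleftrightarrow> (\<exists>w. set w \<subseteq> (\<Union>t\<in>I. P t) \<and> X \<in> Filt C w)"
  unfolding P_interval_def using assms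
  by (intro ext_closure_iff_Filt) (auto simp: orthogonal_slices_def)

lemma P_interval_base: "X \<in> P t \<Longrightarrow> t \<in> I \<Longrightarrow> X \<in> P_interval C P I"
  unfolding P_interval_def by (intro ext_closure.base) blast

lemma P_interval_orth:
  assumes P: "orthogonal_slices P" and X: "X \<in> P_interval C P I" and A: "A \<in> P s"
  shows "\<forall>t\<in>I. t < s \<Longrightarrow> orth C A X" "\<forall>t\<in>I. s < t \<Longrightarrow> orth C X A"
proof -
  obtain w where w: "set w \<subseteq> (\<Union>t\<in>I. P t)" "X \<in> Filt C w" using X P_interval_iff_Filt[OF P] by blast
  have AO: "A \<in> Ob C" using orthogonal_slicesD(1)[OF P A] .
  show "orth C A X" if "\<forall>t\<in>I. t < s"
    using w(1) that orthogonal_slicesD(3)[OF P A] by (intro orth_Filt_right[OF w(2) AO]) blast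
  show "orth C X A" if "\<forall>t\<in>I. s < t"
    using w(1) that orthogonal_slicesD(3)[OF P _ A] by (intro orth_Filt_left[OF w(2) AO]) blast
qed

text \<open>The first factor maps nontrivially to \<open>X\<close> and the last one receives a nontrivial map, so
  vanishing of maps into and out of \<open>X\<close> bounds all phases of the filtration.\<close>

lemma hn_top:
  assumes P: "orthogonal_slices P" and L: "hn C P L X" and s: "s \<in> fst ` set L"
  shows "\<exists>t A. (t, A) \<in> set L \<and> A \<in> P t \<and> s \<le> t \<and> \<not> orth C A X"
proof -
  obtain t A L' where L': "L = (t, A) # L'" using s by (cases L) auto
  have "s \<le> t" "A \<in> P t" using s L L' by (auto simp: hn_def)
  moreover have "\<not> orth C A X" using hn_first[OF P] L L' by blast
  ultimately show ?thesis using L' by auto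
qed

lemma hn_bottom:
  assumes P: "orthogonal_slices P" and L: "hn C P L X" and s: "s \<in> fst ` set L"
  shows "\<exists>t A. (t, A) \<in> set L \<and> A \<in> P t \<and> t \<le> s \<and> \<not> orth C X A"
proof -
  have "L \<noteq> []" using s by auto
  then obtain t A L' where L': "L = L' @ [(t, A)]" by (cases L rule: rev_cases) auto
  have "t \<le> s" "A \<in> P t" using s L L' by (auto simp: hn_def sorted_wrt_append)
  moreover have "\<not> orth C X A" using hn_last[OF P] L L' by blast
  ultimately show ?thesis using L' by auto
qed

lemma hn_P_interval:
  assumes P: "orthogonal_slices P" and L: "hn C P L X" and X: "X \<in> P_interval C P I"
    and s: "s \<in> fst ` set L"
  shows "\<exists>t\<in>I. s \<le> t" "\<exists>t\<in>I. t \<le> s"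
proof -
  obtain t A where A: "A \<in> P t" "s \<le> t" "\<not> orth C A X" using hn_top[OF P L s] by blast
  obtain u where "u \<in> I" "t \<le> u" using P_interval_orth(1)[OF P X A(1)] A(3) by (meson not_le)
  then show "\<exists>t\<in>I. s \<le> t" using A(2) by (meson order_trans)
  obtain r B where B: "B \<in> P r" "r \<le> s" "\<not> orth C X B" using hn_bottom[OF P L s] by blast
  obtain v where "v \<in> I" "v \<le> r" using P_interval_orth(2)[OF P X B(1)] B(3) by (meson not_le)
  then show "\<exists>t\<in>I. t \<le> s" using B(2) by (meson order_trans)
qed

lemma hn_single_phase:
  assumes "hn C P L X" and eq: "\<And>s. s \<in> fst ` set L \<Longrightarrow> s = t"
  shows "L = [] \<or> (\<exists>A. L = [(t, A)])"
proof (cases L)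
  case (Cons x L')
  have "L' = []"
  proof (rule ccontr)
    assume "L' \<noteq> []"
    then obtain y where y: "y \<in> set L'" by (cases L') auto
    then have "fst y < fst x" using assms(1) Cons by (auto simp: hn_def)
    then show False using eq[of "fst y"] eq[of "fst x"] y Cons by simp
  qed
  then show ?thesis using eq[of "fst x"] Cons by (cases x) auto
qed simp

lemma hn_imp_P_interval:
  assumes P: "orthogonal_slices P" and L: "hn C P L X" "fst ` set L \<subseteq> I"
  shows "X \<in> P_interval C P I"
proof -
  have "A \<in> (\<Union>t\<in>I. P t)" if "A \<in> snd ` set L" for A
    using that L by (force simp: hn_def)
  then have "set (map snd L) \<subseteq> (\<Union>t\<in>I. P t)" by auto
  then show ?thesis using P_interval_iff_Filt[OF P] L(1) unfolding hn_def by blast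
qed

lemma HN_filtration_imp_hn:
  assumes "has_HN_filtration C P X"
  shows "\<exists>L. hn C P L X"
proof -
  obtain n :: nat and \<phi> :: "nat \<Rightarrow> real" and F A where
    *: "is_zero C (F 0) \<and> F n = X \<and> (\<forall>l m. l < m \<longrightarrow> m < n \<longrightarrow> \<phi> m < \<phi> l) \<and>
      (\<forall>l<n. A l \<in> P (\<phi> l) \<and> (\<exists>f g h. (F l, F (Suc l), A l, f, g, h) \<in> dist C))"
    using assms unfolding has_HN_filtration_def by (elim exE) (rule that)
  then have F0: "is_zero C (F 0)" and n: "F n = X" by auto
  have \<phi>: "\<phi> m < \<phi> l" if "l < m" "m < n" for l m using * that by blast
  have A: "A l \<in> P (\<phi> l)" "tri C (F l) (F (Suc l)) (A l)" if "l < n" for l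
    using * that unfolding tri_def by blast+
  have "\<exists>L. hn C P L (F m) \<and> fst ` set L \<subseteq> \<phi> ` {..<m}" if "m \<le> n" for m
    using that
  proof (induction m)
    case 0
    then show ?case using F0 by (intro exI[of _ "[]"]) (simp add: hn_def)
  next
    case (Suc m)
    then obtain L where L: "hn C P L (F m)" "fst ` set L \<subseteq> \<phi> ` {..<m}" by auto
    have t: "tri C (F m) (F (Suc m)) (A m)" using A(2) Suc by simp
    show ?case
    proof (cases "is_zero C (A m)")
      case True
      then have "hn C P L (F (Suc m))"
        using L(1) Filt_iso[OF _ tri_third_zero[OF t True] triD(2)[OF t]] unfolding hn_def by blast
      then show ?thesis using L(2) by (intro exI[of _ L]) auto
    next
      case False
      have "A m \<in> Filt C [A m]" using Filt_single_self triD(3)[OF t] by blast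
      then have "F (Suc m) \<in> Filt C (map snd L @ [A m])"
        using L(1) t Filt_append unfolding hn_def by blast
      moreover have "\<phi> m < s" if "s \<in> set (map fst L)" for s
      proof -
        have "s \<in> \<phi> ` {..<m}" using L(2) that by auto
        then show ?thesis using \<phi> Suc.prems by auto
      qed
      then have "sorted_wrt (>) (map fst L @ [\<phi> m])"
        using L(1) unfolding hn_def sorted_wrt_append by simp
      ultimately have "hn C P (L @ [(\<phi> m, A m)]) (F (Suc m))"
        using L(1) A(1)[of m] Suc.prems False unfolding hn_def by auto
      then show ?thesis using L(2) by (intro exI[of _ "L @ [(\<phi> m, A m)]"]) (auto simp: image_Un)
    qed
  qed
  then show ?thesis using n by blast
qed

lemma Filt_sequence:
  "X \<in> Filt C w \<Longrightarrow> \<exists>F. is_zero C (F 0) \<and> F (length w) = X \<and> (\<forall>l<length w. tri C (F l) (F (Suc l)) (w ! l))"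
proof (induction w arbitrary: X rule: rev_induct)
  case Nil
  then show ?case by auto
next
  case (snoc a w)
  then obtain Y a' where Y: "Y \<in> Filt C w" "a' \<in> Filt C [a]" "tri C Y X a'" using Filt_append by blast
  then have a: "a \<in> Ob C" using triD(1) by auto
  then have t: "tri C Y X a" using Y Filt_single tri_third_iso isomorphic_sym by blast
  obtain F where F: "is_zero C (F 0)" "F (length w) = Y" "\<forall>l<length w. tri C (F l) (F (Suc l)) (w ! l)"
    using snoc.IH Y by blast
  show ?case
    using F t by (intro exI[of _ "F(Suc (length w) := X)"]) (auto simp: less_Suc_eq nth_append)
qed

lemma hn_imp_HN_filtration:
  assumes "hn C P L X"
  shows "has_HN_filtration C P X"
proof -
  obtain F where F: "is_zero C (F 0)" "F (length L) = X" "\<forall>l<length L. tri C (F l) (F (Suc l)) (snd (L ! l))"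
    using Filt_sequence[of X "map snd L"] assms by (auto simp: hn_def)
  have "fst (L ! m) < fst (L ! l)" if "l < m" "m < length L" for l m
    using assms that by (auto simp: hn_def sorted_wrt_iff_nth_less)
  moreover have "snd (L ! l) \<in> P (fst (L ! l))" if "l < length L" for l
    using assms nth_mem[OF that] by (auto simp: hn_def case_prod_beta)
  ultimately show ?thesis
    unfolding has_HN_filtration_def using F
    by (intro exI[of _ "length L"] exI[of _ "\<lambda>l. fst (L ! l)"] exI[of _ F] exI[of _ "\<lambda>l. snd (L ! l)"])
      (auto simp: tri_def)
qed

end


section \<open>The slicing of a stability function\<close>

context stability_function
begin

lemma orthogonal_slice: "orthogonal_slices slice"
  unfolding orthogonal_slices_def
proof (intro conjI allI impI ballI)
  fix t show "slice t \<subseteq> Ob C" using slice_Ob by blast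
  show "slice (t + 1) = shift C ` slice t"
    using slice_shift_by[of t 1] shift_by_1 slice_Ob by (simp cong: image_cong_simp)
qed (use orth_slice in blast)

lemma zero_slice:
  assumes "is_zero C N"
  shows "N \<in> slice t"
proof -
  have "N \<in> sem s" if N: "is_zero C N" for s N
    unfolding sem_def
  proof (intro CollectI conjI ballI impI)
    fix A B assume AB: "A \<in> hrt 0" "B \<in> hrt 0" "tri C A N B"
    have "orth C (shift C A) B" using orth_hrt[of "shift C A" 1 B 0] AB hrt_shift_iff hrt_Ob by simp
    then have "is_zero C A" using tri_first_zero[OF AB(3)] orth_zero(2)[OF N] AB hrt_Ob by blast
    then show "tilt s (Z A) \<le> 0" using Z_zero by simp
  qed (use N Z_zero hrt_zero in auto)
  then have "shift_by C (- (\<lceil>t\<rceil> - 1)) N \<in> sem (t - of_int (\<lceil>t\<rceil> - 1))"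
    using assms shift_by_zero_iff is_zero_Ob by blast
  then show ?thesis
    unfolding slice_def using shift_by_inverse(2)[OF is_zero_Ob[OF assms]] by (metis image_eqI)
qed

text \<open>A filtration factor of phase above \<open>t\<close> has no maps to \<open>X\<close> and \<open>Y\<close>, hence none to \<open>E\<close>, and dually
  for phases below \<open>t\<close>.  So \<open>E\<close> has \<open>t\<close> as its only phase.\<close>

lemma slice_ext:
  assumes t: "tri C X E Y" and X: "X \<in> slice t" and Y: "Y \<in> slice t"
  shows "E \<in> slice t"
proof -
  obtain L where L: "hn C slice L E" using hn_exists triD(2)[OF t] by blast
  have eq: "s = t" if s: "s \<in> fst ` set L" for s
  proof (rule antisym)
    obtain r A where A: "A \<in> slice r" "s \<le> r" "\<not> orth C A E" using hn_top[OF orthogonal_slice L s] by blast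
    have "\<not> t < r"
      using orth_mid_right[OF t slice_Ob[OF A(1)]] orth_slice[OF A(1) X] orth_slice[OF A(1) Y] A(3) by blast
    then show "s \<le> t" using A(2) by simp
    obtain u B where B: "B \<in> slice u" "u \<le> s" "\<not> orth C E B" using hn_bottom[OF orthogonal_slice L s] by blast
    have "\<not> u < t"
      using orth_mid_left[OF t slice_Ob[OF B(1)]] orth_slice[OF X B(1)] orth_slice[OF Y B(1)] B(3) by blast
    then show "t \<le> s" using B(2) by simp
  qed
  consider "L = []" | A where "L = [(t, A)]" using hn_single_phase[OF L eq] by blast
  then show ?thesis
  proof cases
    case 1
    then show ?thesis using L zero_slice by (simp add: hn_def)
  next
    case (2 A)
    then have "A \<in> slice t" "E \<in> Filt C [A]" using L by (auto simp: hn_def)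
    then show ?thesis using Filt_single slice_Ob slice_iso by blast
  qed
qed

lemma additive_slice: "additive_subcat C (slice t)"
  unfolding additive_subcat_def
  using slice_Ob zero_slice ex_zero slice_iso slice_ext biproduct_tri by blast

lemma slicing_slice: "slicing C slice"
  unfolding slicing_def
proof (intro conjI allI impI ballI)
  fix s t :: real and X Y assume "t < s" "X \<in> slice s" "Y \<in> slice t"
  then show "Mor C X Y = {zerom C X Y}" using orth_slice unfolding orth_def by blast
next
  fix X assume "X \<in> Ob C"
  then show "has_HN_filtration C slice X" using hn_exists hn_imp_HN_filtration by blast
qed (use additive_slice orthogonal_slice in \<open>auto simp: orthogonal_slices_def\<close>)

lemma heart_slice: "P_interval C slice {0<..1} = hrt 0"
proof (intro equalityI subsetI)
  fix X assume "X \<in> P_interval C slice {0<..1}"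
  then obtain w where w: "set w \<subseteq> (\<Union>t\<in>{0<..1}. slice t)" "X \<in> Filt C w"
    using P_interval_iff_Filt[OF orthogonal_slice] by meson
  have "(\<Union>t\<in>{0<..1}. slice t) \<subseteq> hrt 0" using slice_unit by (auto simp: sem_def)
  with w(1) have "set w \<subseteq> hrt 0" by (rule order_trans)
  then show "X \<in> hrt 0" by (rule hrt_Filt[OF w(2)])
next
  fix X assume "X \<in> hrt 0"
  then show "X \<in> P_interval C slice {0<..1}"
    using hn_heart hn_imp_P_interval[OF orthogonal_slice] by blast
qed

end

section \<open>Local finiteness\<close>

lemma full_subcat_simps [simp]:
  "Ob (full_subcat C D) = D" "Hom (full_subcat C D) = Hom C" "ident (full_subcat C D) = ident C"
  "cmp (full_subcat C D) = cmp C" "shift (full_subcat C D) = shift C" "shiftm (full_subcat C D) = shiftm C"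
  "dist (full_subcat C D) = {(X, Y, Z, f, g, h) \<in> dist C. X \<in> D \<and> Y \<in> D \<and> Z \<in> D}"
  by (simp_all add: full_subcat_def)

context stability_function
begin

text \<open>As a quotient of \<open>A\<close> and a subobject of \<open>X\<close>, the image \<open>I\<close> has phases bounded below by those of
  \<open>A\<close> and above by those of \<open>X\<close>.\<close>

lemma image_in_interval:
  assumes D: "D = P_interval C slice J" "D \<subseteq> hrt p"
    and J: "\<And>s t u. s \<in> J \<Longrightarrow> u \<in> J \<Longrightarrow> s \<le> t \<Longrightarrow> t \<le> u \<Longrightarrow> t \<in> J"
    and A: "A \<in> D" and X: "X \<in> D"
    and t: "tri C U A I" "tri C I X V" "U \<in> hrt p" "V \<in> hrt p" "I \<in> hrt p"
  shows "I \<in> D"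
proof -
  note P = orthogonal_slice
  obtain L where L: "hn C slice L I" "fst ` set L \<subseteq> {of_int p<..of_int p + 1}" using hn_hrt[OF t(5)] by blast
  have L_hrt: "B \<in> hrt p \<and> B \<in> slice r" if B: "(r, B) \<in> set L" for r B
  proof -
    have r: "B \<in> slice r" using L(1) B by (auto simp: hn_def)
    have "of_int p < r" "r \<le> of_int p + 1" using L(2) B by force+
    then have "\<lceil>r\<rceil> - 1 = p" by linarith
    then show ?thesis using slice_hrt[OF r] r by simp
  qed
  have "s \<in> J" if s: "s \<in> fst ` set L" for s
  proof -
    obtain t0 A0 where A0: "(t0, A0) \<in> set L" "s \<le> t0" "\<not> orth C A0 I" using hn_top[OF P L(1) s] by blast
    have h0: "A0 \<in> hrt p" "A0 \<in> slice t0" using L_hrt A0(1) by auto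
    have "orth C A0 (shift_by C (- 1) V)"
      using orth_hrt[OF h0(1) hrt_shift_by[OF t(4), of "- 1"]] by simp
    then have "\<not> orth C A0 X"
      using orth_mid_right[OF tri_unshift_third[OF t(2)] hrt_Ob[OF h0(1)]] A0(3) by blast
    then obtain u where "u \<in> J" "t0 \<le> u" using P_interval_orth(1)[OF P _ h0(2)] X D(1) by (meson not_le)
    then have "\<exists>u\<in>J. s \<le> u" using A0(2) by (meson order_trans)
    moreover obtain t1 A1 where A1: "(t1, A1) \<in> set L" "t1 \<le> s" "\<not> orth C I A1"
      using hn_bottom[OF P L(1) s] by blast
    have h1: "A1 \<in> hrt p" "A1 \<in> slice t1" using L_hrt A1(1) by auto
    have "orth C (shift C U) A1"
      using orth_hrt[of "shift C U" "p + 1" A1 p] h1(1) t(3) hrt_shift_iff hrt_Ob by simp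
    then have "\<not> orth C A A1"
      using orth_mid_left[OF tri_rotate[OF t(1)] hrt_Ob[OF h1(1)]] A1(3) by blast
    then obtain v where "v \<in> J" "v \<le> t1" using P_interval_orth(2)[OF P _ h1(2)] A D(1) by (meson not_le)
    then have "\<exists>u\<in>J. u \<le> s" using A1(2) by (meson order_trans)
    ultimately show ?thesis using J by blast
  qed
  then show ?thesis using hn_imp_P_interval[OF P L(1)] D(1) by blast
qed

text \<open>Let \<open>u : A \<rightarrow> X\<close> be a kernel of \<open>q\<close> in the category of the interval, and \<open>I\<close> its image in the heart.
  Then \<open>q\<close> also kills the inclusion of \<open>I\<close>, which therefore factors through \<open>u\<close>.  So \<open>A\<close> and \<open>I\<close> are
  the same subobject, and the cone of \<open>u\<close> is a quotient in the heart.\<close>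

lemma strict_subobject_cone:
  assumes D: "D = P_interval C slice J" "D \<subseteq> hrt p"
    and J: "\<And>s t u. s \<in> J \<Longrightarrow> u \<in> J \<Longrightarrow> s \<le> t \<Longrightarrow> t \<le> u \<Longrightarrow> t \<in> J"
    and X: "X \<in> D" and sub: "strict_subobject (full_subcat C D) X (A, u)"
  shows "A \<in> hrt p \<and> u \<in> Mor C A X \<and> (\<exists>B\<in>hrt p. \<exists>g h. (A, X, B, u, g, h) \<in> dist C)"
proof -
  obtain Q q where A: "A \<in> D" "u \<in> Mor C A X" and Q: "Q \<in> D" "q \<in> Mor C X Q"
    and qu: "q \<cdot> u = zerom C A Q"
    and ker: "\<And>W w. W \<in> D \<Longrightarrow> w \<in> Mor C W X \<Longrightarrow> q \<cdot> w = zerom C W Q \<Longrightarrow> \<exists>!v. v \<in> Mor C W A \<and> u \<cdot> v = w"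
    using sub unfolding strict_subobject_def is_kernel_def is_cokernel_def by auto
  have hX: "X \<in> hrt p" "A \<in> hrt p" "Q \<in> hrt p" using X A Q D by auto
  have Ob: "X \<in> Ob C" "A \<in> Ob C" "Q \<in> Ob C" using hX hrt_Ob by auto
  obtain I U V e m a b c d where I: "I \<in> hrt p" "U \<in> hrt p" "V \<in> hrt p"
    and d: "(U, A, I, a, e, b) \<in> dist C" "(I, X, V, m, c, d) \<in> dist C" and ume: "u = m \<cdot> e"
    using image_factorization[OF A(2) hX(2,1)] by blast
  have ID: "I \<in> D" using image_in_interval[OF D J A(1) X triI[OF d(1)] triI[OF d(2)] I(2,3,1)] .
  note e = distD(5)[OF d(1)] and m = distD(4)[OF d(2)] and IOb = distD(3)[OF d(1)]
  have qm: "q \<cdot> m \<in> Mor C I Q" using cmp_in[of I X Q q m] Q m Ob IOb by blast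
  \<comment> \<open>The map from \<open>A\<close> onto its image is an epimorphism onto objects of the heart.\<close>
  have "(q \<cdot> m) \<cdot> e = zerom C A Q" using cmp_assoc[of A I X Q q m e] Ob IOb Q m e qu ume by simp
  then obtain v where v: "v \<in> Mor C (shift C U) Q" "v \<cdot> b = q \<cdot> m"
    using dist_extend'[OF d(1) Ob(3) qm] by blast
  have oUQ: "orth C (shift C U) Q"
    using orth_hrt[of "shift C U" "p + 1" Q p] I(2) hX(3) hrt_shift_iff hrt_Ob by simp
  then have "v = zerom C (shift C U) Q" using v orthD by blast
  then have "q \<cdot> m = zerom C I Q"
    using v(2) distD(6)[OF d(1)] Ob(3) IOb cmp_zero_left[of b I "shift C U" Q] distD(1)[OF d(1)] by simp
  then obtain r where r: "r \<in> Mor C I A" "u \<cdot> r = m" using ker[OF ID m] by blast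
  have re: "r \<cdot> e \<in> Mor C A A" using cmp_in[of A I A r e] r e Ob IOb by blast
  have "u \<cdot> (r \<cdot> e) = u" using cmp_assoc[of A I A X u r e] r A e Ob IOb ume by simp
  moreover have "u \<cdot> ident C A = u" using A Ob ident_right by blast
  ultimately have re1: "r \<cdot> e = ident C A" using ker[OF A qu] re ident_in[OF Ob(2)] by blast
  have er: "e \<cdot> r \<in> Mor C I I" using cmp_in[of I A I e r] r e Ob IOb by blast
  \<comment> \<open>The inclusion of the image is a monomorphism on objects of the heart.\<close>
  have er1: "e \<cdot> r = ident C I"
  proof -
    have "m \<cdot> (e \<cdot> r) = m"
      using cmp_assoc[of I A I X m e r] r e m Ob IOb ume by simp
    define w where "w = (e \<cdot> r) \<oplus>\<^bsub>Hom C I I\<^esub> (\<ominus>\<^bsub>Hom C I I\<^esub> ident C I)"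
    have w: "w \<in> Mor C I I" unfolding w_def using er IOb ident_in by simp
    have "m \<cdot> w = zerom C I X"
      unfolding w_def using cmp_add_right[of I I X m "e \<cdot> r" "\<ominus>\<^bsub>Hom C I I\<^esub> ident C I"]
        cmp_uminus_right[of I I X m "ident C I"] \<open>m \<cdot> (e \<cdot> r) = m\<close> er m Ob IOb ident_in
        cmp_ident[of m I X] by simp
    obtain V' where V': "V' \<in> Ob C" "V = shift C V'" using shift_surj distD(3)[OF d(2)] by blast
    obtain f' where f': "(V', I, X, f', m, c) \<in> dist C"
      using dist_unrotate[of I X V' m c d] d(2) V' by blast
    obtain v where v: "v \<in> Mor C I V'" "f' \<cdot> v = w"
      using dist_lift[OF f' IOb w \<open>m \<cdot> w = zerom C I X\<close>] by blast
    have "V' \<in> hrt (p - 1)" using V' I(3) hrt_shift_iff by simp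
    then have "orth C I V'" using orth_hrt[OF I(1)] by simp
    then have "v = zerom C I V'" using v orthD by blast
    then have "w = zerom C I I" using v(2) distD(4)[OF f'] V'(1) IOb by simp
    then show ?thesis using diff_zero_imp_eq[OF IOb IOb er ident_in[OF IOb]] unfolding w_def by blast
  qed
  have iso: "is_iso C I A r" unfolding is_iso_def using r e re1 er1 by blast
  have VOb: "V \<in> Ob C" using distD(3)[OF d(2)] .
  have "(A, X, V, u, c, shiftm C r \<cdot> d) \<in> dist C"
  proof (rule TR1_iso[OF d(2) _ iso is_iso_ident[OF Ob(1)] is_iso_ident[OF VOb]])
    have "shiftm C r \<cdot> d \<in> Mor C V (shift C A)"
      using cmp_in[of V "shift C I" "shift C A" "shiftm C r" d] r(1) distD(6)[OF d(2)] VOb Ob IOb by simp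
    then show "triangle C A X V u c (shiftm C r \<cdot> d)"
      unfolding triangle_def using Ob VOb A distD(5)[OF d(2)] by blast
    show "ident C X \<cdot> m = u \<cdot> r" using m r Ob IOb by simp
    show "ident C V \<cdot> c = c \<cdot> ident C X" using distD(5)[OF d(2)] Ob VOb by simp
    have "shiftm C r \<cdot> d \<in> Mor C V (shift C A)" by fact
    then show "shiftm C r \<cdot> d = (shiftm C r \<cdot> d) \<cdot> ident C V"
      using Ob VOb cmp_ident[of "shiftm C r \<cdot> d" V "shift C A"] by simp
  qed
  then show ?thesis using hX A I by blast
qed

text \<open>By the octahedral axiom, the cone of an inclusion between two subobjects \<open>A' \<subseteq> A \<subseteq> X\<close> is the fibre of
  \<open>X/A' \<rightarrow> X/A\<close>, hence it lies in the heart.  Its length measures the difference.\<close>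

lemma cone_of_subobjects:
  assumes t: "(A, X, B, u, g, h) \<in> dist C" "(A', X, B', u', g', h') \<in> dist C"
    and h: "A \<in> hrt p" "B \<in> hrt p" "A' \<in> hrt p" "B' \<in> hrt p"
    and w: "w \<in> Mor C A' A" "u \<cdot> w = u'"
  shows "len A' \<le> len A" and "len A \<le> len A' \<Longrightarrow> \<exists>v\<in>Mor C A A'. u' \<cdot> v = u"
proof -
  have Ob: "A \<in> Ob C" "A' \<in> Ob C" "X \<in> Ob C" using distD t by blast+
  obtain W x y where W: "(A', A, W, w, x, y) \<in> dist C" using TR1_cone[OF Ob(2,1) w(1)] by blast
  have "tri C W B' B" using TR4[OF W t(1)] t(2) w(2) unfolding tri_def by blast
  note W2 = tri_unshift_third[OF this]
  have hW: "W \<in> hrt p"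
  proof (rule hrt_squeeze[OF tri_rotate[OF triI[OF W]] h(1) _ W2 _ h(4)])
    show "shift C A' \<in> hrt (p + 1)" using hrt_shift_iff[OF Ob(2)] h(3) by simp
    show "shift_by C (- 1) B \<in> hrt (p - 1)" using hrt_shift_by[OF h(2), of "- 1"] by simp
  qed
  have len: "len A = len A' + len W" using len_tri[OF triI[OF W] h(3) hW] .
  then show "len A' \<le> len A" by simp
  assume "len A \<le> len A'"
  then have "is_zero C W" using len len_zero[OF hW] by simp
  then have "is_iso C A' A w" using dist_third_zero_iso[OF W] by blast
  then obtain v where v: "v \<in> Mor C A A'" "w \<cdot> v = ident C A" unfolding is_iso_def by blast
  have "u' \<cdot> v = u \<cdot> (w \<cdot> v)"
    using cmp_assoc[of A A' A X u w v] Ob w v distD(4)[OF t(1)] by simp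
  then have "u' \<cdot> v = u" using v(2) distD(4)[OF t(1)] Ob by simp
  then show "\<exists>v\<in>Mor C A A'. u' \<cdot> v = u" using v(1) by blast
qed

text \<open>Along a chain of strict subobjects of \<open>X\<close> the length is monotone and at most the length of
  \<open>X\<close>, so it becomes constant, and then the inclusions are invertible.\<close>

lemma finite_length_interval:
  assumes D: "D = P_interval C slice J" "D \<subseteq> hrt p"
    and J: "\<And>s t u. s \<in> J \<Longrightarrow> u \<in> J \<Longrightarrow> s \<le> t \<Longrightarrow> t \<le> u \<Longrightarrow> t \<in> J"
  shows "finite_length (full_subcat C D)"
proof -
  have cone: "fst x \<in> hrt p \<and> (\<exists>B\<in>hrt p. \<exists>g h. (fst x, X, B, snd x, g, h) \<in> dist C)"
    if "X \<in> D" "strict_subobject (full_subcat C D) X x" for X x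
    using strict_subobject_cone[OF D J that(1), where A = "fst x" and u = "snd x"] that(2) by simp
  have chain: "len (fst x') \<le> len (fst x)"
      "len (fst x) \<le> len (fst x') \<Longrightarrow> subobject_le (full_subcat C D) x x'"
    if X: "X \<in> D" and s: "strict_subobject (full_subcat C D) X x" "strict_subobject (full_subcat C D) X x'"
      and le: "subobject_le (full_subcat C D) x' x" for X x x'
  proof -
    obtain B g h where B: "fst x \<in> hrt p" "B \<in> hrt p" "(fst x, X, B, snd x, g, h) \<in> dist C"
      using cone[OF X s(1)] by blast
    obtain B' g' h' where B': "fst x' \<in> hrt p" "B' \<in> hrt p" "(fst x', X, B', snd x', g', h') \<in> dist C"
      using cone[OF X s(2)] by blast
    obtain w where w: "w \<in> Mor C (fst x') (fst x)" "snd x \<cdot> w = snd x'"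
      using le unfolding subobject_le_def by (cases x, cases x') auto
    note c = cone_of_subobjects[OF B(3) B'(3) B(1,2) B'(1,2) w]
    show "len (fst x') \<le> len (fst x)" by (rule c(1))
    show "subobject_le (full_subcat C D) x x'" if "len (fst x) \<le> len (fst x')"
      using c(2)[OF that] unfolding subobject_le_def by (cases x, cases x') auto
  qed
  show ?thesis
    unfolding finite_length_def artinian_cat_def noetherian_cat_def
  proof (intro conjI ballI allI impI)
    fix X and s :: "nat \<Rightarrow> 'o \<times> 'm"
    assume X: "X \<in> Ob (full_subcat C D)" and s: "\<forall>n. strict_subobject (full_subcat C D) X (s n)"
      and le: "\<forall>n. subobject_le (full_subcat C D) (s (Suc n)) (s n)"
    have X': "X \<in> D" using X by simp
    obtain N where N: "\<And>n. len (fst (s N)) \<le> len (fst (s n))"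
      using ex_has_least_nat[of "\<lambda>_. True" 0 "\<lambda>n. len (fst (s n))"] by blast
    have mono: "len (fst (s n)) \<le> len (fst (s N))" if "N \<le> n" for n
      using that
    proof (induction n rule: dec_induct)
      case (step n)
      have "len (fst (s (Suc n))) \<le> len (fst (s n))"
        by (rule chain(1)[OF X' s[rule_format] s[rule_format] le[rule_format]])
      then show ?case using step by simp
    qed simp
    show "\<exists>N. \<forall>n\<ge>N. subobject_le (full_subcat C D) (s n) (s (Suc n))"
    proof (intro exI[of _ N] allI impI)
      fix n assume "N \<le> n"
      then have "len (fst (s n)) \<le> len (fst (s (Suc n)))" using mono N order_trans by blast
      then show "subobject_le (full_subcat C D) (s n) (s (Suc n))" using chain(2) X' s le by blast
    qed
  next
    fix X and s :: "nat \<Rightarrow> 'o \<times> 'm"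
    assume X: "X \<in> Ob (full_subcat C D)" and s: "\<forall>n. strict_subobject (full_subcat C D) X (s n)"
      and le: "\<forall>n. subobject_le (full_subcat C D) (s n) (s (Suc n))"
    have X': "X \<in> D" using X by simp
    have bound: "len (fst (s n)) \<le> len X" for n
      using cone[OF X' s[rule_format, of n]] len_tri[OF triI] by (metis le_add1)
    obtain N where N: "\<And>n. len (fst (s n)) \<le> len (fst (s N))"
      using ex_has_greatest_nat[of "\<lambda>_. True" 0 "\<lambda>n. len (fst (s n))" "Suc (len X)"] bound le_imp_less_Suc by blast
    have mono: "len (fst (s N)) \<le> len (fst (s n))" if "N \<le> n" for n
      using that
    proof (induction n rule: dec_induct)
      case (step n)
      have "len (fst (s n)) \<le> len (fst (s (Suc n)))"
        by (rule chain(1)[OF X' s[rule_format] s[rule_format] le[rule_format]])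
      then show ?case using step by simp
    qed simp
    show "\<exists>N. \<forall>n\<ge>N. subobject_le (full_subcat C D) (s (Suc n)) (s n)"
    proof (intro exI[of _ N] allI impI)
      fix n assume "N \<le> n"
      then have "len (fst (s (Suc n))) \<le> len (fst (s n))" using mono N order_trans by blast
      then show "subobject_le (full_subcat C D) (s (Suc n)) (s n)" using chain(2) X' s le by blast
    qed
  qed
qed

text \<open>The finitely many simple objects have phases at least some \<open>c > 0\<close>, hence so do all objects
  of the heart.  An interval of length at most \<open>c\<close> therefore meets the phases of a single
  shift of the heart only.\<close>

lemma phase_gap:
  shows "\<exists>c>0. c \<le> 1 \<and> (\<forall>t X. 0 < t \<longrightarrow> t \<le> 1 \<longrightarrow> X \<in> sem t \<longrightarrow> \<not> is_zero C X \<longrightarrow> c \<le> t)"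
proof -
  define c where "c = Min (insert 1 ((\<lambda>S. phase (z S)) ` \<S>))"
  have fin: "finite (insert 1 ((\<lambda>S. phase (z S)) ` \<S>))" using finite_S by simp
  have c1: "c \<le> 1" unfolding c_def using fin by (intro Min_le) auto
  have "c \<in> insert 1 ((\<lambda>S. phase (z S)) ` \<S>)" unfolding c_def using fin by (intro Min_in) auto
  then have c0: "0 < c" using upperE(3)[OF z_upper] by auto
  have cS: "0 \<le> tilt c (z S)" if "S \<in> \<S>" for S
  proof -
    have "c \<le> phase (z S)" unfolding c_def using fin that by (intro Min_le) auto
    then show ?thesis using tilt_iff(1)[OF z_upper[OF that] c0 c1] by simp
  qed
  have "c \<le> t" if X: "0 < t" "t \<le> 1" "X \<in> sem t" "\<not> is_zero C X" for t X
  proof -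
    have hX: "X \<in> hrt 0" using X(3) by (simp add: sem_def)
    then obtain w where w: "is_word w" "\<And>x. x \<in> set w \<Longrightarrow> snd x = 0" "X \<in> wfilt w" by (rule hrtE) blast
    have "0 \<le> tilt c (weight z w)"
      using w(1,2)
    proof (induction w)
      case (Cons x w)
      have "snd x = 0" using Cons.prems(2) by simp
      then obtain S where "x = (S, 0)" "S \<in> \<S>" using Cons.prems(1) by (cases x) auto
      then show ?case using Cons cS by simp
    qed simp
    then have "0 \<le> tilt c (Z X)" using charge_eq[OF w(1,3)] by simp
    then have "c \<le> phase (Z X)" using tilt_iff(1)[OF Z_upper[OF hX X(4)] c0 c1] by simp
    then show ?thesis using sem_phase[OF X(3,4,1,2)] by simp
  qed
  then show ?thesis using c0 c1 by blast
qed

lemma locally_finite_slice: "locally_finite C slice"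
proof -
  obtain c where c: "0 < c" "c \<le> 1"
    "\<And>t X. 0 < t \<Longrightarrow> t \<le> 1 \<Longrightarrow> X \<in> sem t \<Longrightarrow> \<not> is_zero C X \<Longrightarrow> c \<le> t" using phase_gap by blast
  \<comment> \<open>An interval of length \<open>2 \<eta> \<le> c\<close> fits into the gap; the second bound keeps \<open>\<eta>\<close> below \<open>1 / 2\<close>.\<close>
  define \<eta> where "\<eta> = min (c / 2) (1 / 4)"
  have \<eta>: "0 < \<eta>" "\<eta> < 1 / 2" "2 * \<eta> \<le> c" using c by (auto simp: \<eta>_def)
  have "finite_length (full_subcat C (P_interval C slice {t - \<eta><..<t + \<eta>}))" for t
  proof (rule finite_length_interval[OF refl])
    \<comment> \<open>The phases of the interval in \<open>(p, p + 1]\<close> belong to the heart of degree \<open>p\<close>.  Those beyond \<open>p + 1\<close>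
      lie in the gap above \<open>p + 1\<close>.\<close>
    define p where "p = \<lfloor>t - \<eta>\<rfloor>"
    have p: "of_int p \<le> t - \<eta>" "t - \<eta> < of_int p + 1" unfolding p_def by linarith+
    have "slice s \<subseteq> hrt p" if s: "s \<in> {t - \<eta><..<t + \<eta>}" for s
    proof
      fix X assume X: "X \<in> slice s"
      show "X \<in> hrt p"
      proof (cases "s \<le> of_int p + 1")
        case True
        then have "\<lceil>s\<rceil> = p + 1" using s p by (intro ceiling_unique) auto
        then show ?thesis using slice_hrt[OF X] by simp
      next
        case False
        then have s': "of_int p + 1 < s" "s < of_int p + 1 + c" using s p \<eta> by auto
        then have "\<lceil>s\<rceil> = p + 2" using c(2) by (intro ceiling_unique) auto
        then have e: "\<lceil>s\<rceil> - 1 = p + 1" by simp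
        obtain X0 where X0: "X = shift_by C (p + 1) X0" "X0 \<in> sem (s - of_int (p + 1))"
          using X unfolding slice_def e by blast
        have "is_zero C X0"
        proof (rule ccontr)
          assume "\<not> is_zero C X0"
          then have "c \<le> s - of_int (p + 1)" using c(2) s' X0(2) by (intro c(3)) auto
          then show False using s' by simp
        qed
        then show ?thesis using X0 shift_by_zero_iff is_zero_Ob hrt_zero by blast
      qed
    qed
    then have sub: "(\<Union>s\<in>{t - \<eta><..<t + \<eta>}. slice s) \<subseteq> hrt p" by blast
    show "P_interval C slice {t - \<eta><..<t + \<eta>} \<subseteq> hrt p"
    proof
      fix X assume "X \<in> P_interval C slice {t - \<eta><..<t + \<eta>}"
      then obtain w where w: "set w \<subseteq> (\<Union>s\<in>{t - \<eta><..<t + \<eta>}. slice s)" "X \<in> Filt C w"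
        using P_interval_iff_Filt[OF orthogonal_slice] by meson
      show "X \<in> hrt p" by (rule hrt_Filt[OF w(2) order_trans[OF w(1) sub]])
    qed
  qed auto
  then show ?thesis unfolding locally_finite_def using \<eta> by blast
qed


section \<open>Stability conditions with a given heart\<close>

theorem stability_condition_exists:
  "\<exists>W. (slice, W) \<in> Stab C \<and> P_interval C slice {0<..1} = ext_closure C \<S> \<and>
     (\<forall>S\<in>\<S>. W (K_class C S) = z S)"
proof -
  obtain W where W: "W \<in> hom (K_group C) complex_add_group" "W \<in> extensional (carrier (K_group C))"
    "\<And>X. X \<in> Ob C \<Longrightarrow> W (K_class C X) = Z X"
    using K_hom_exists[OF additive_charge] by blast
  have "(slice, W) \<in> Stab C"
    unfolding Stab_def using slicing_slice locally_finite_slice W Z_slice slice_Ob by auto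
  then show ?thesis using heart_slice hrt_0 W(3) S_Ob' charge_S by metis
qed

text \<open>It suffices to compare \<open>P t\<close> with the semistable objects of the heart for \<open>0 < t \<le> 1\<close>.  A subobject
  \<open>A\<close> of \<open>X \<in> P t\<close> has no filtration factors of phase above \<open>t\<close>, since they would map to \<open>X\<close>.
  Conversely, the factors of a semistable \<open>X\<close> have phases at most \<open>t\<close>, because the first is a
  subobject, and as the charges of the factors add up to one of phase \<open>t\<close> there is only one factor.\<close>

theorem stability_condition_slices:
  assumes st: "(P, W) \<in> Stab C" and heart: "P_interval C P {0<..1} = ext_closure C \<S>"
    and Wz: "\<And>S. S \<in> \<S> \<Longrightarrow> W (K_class C S) = z S"
  shows "P = slice"
proof -
  have sl: "slicing C P" and W: "W \<in> hom (K_group C) complex_add_group"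
    and pol: "\<And>t X. X \<in> P t \<Longrightarrow> \<not> is_zero C X \<Longrightarrow>
       \<exists>m>0. W (K_class C X) = complex_of_real m * exp (\<i> * complex_of_real (pi * t))"
    using st unfolding Stab_def by auto
  note O = slicing_orthogonal[OF sl]
  have WZ: "W (K_class C X) = Z X" if "X \<in> Ob C" for X
    using additive_eq_charge[OF K_hom_additive[OF W] that Wz] .
  have hrtP: "P_interval C P {0<..1} = hrt 0" using heart hrt_0 by simp
  have P_hrt: "X \<in> hrt 0" if "X \<in> P t" "0 < t" "t \<le> 1" for X t
    using P_interval_base[of X P t "{0<..1}"] that hrtP by auto
  have P_phase: "Z X \<in> upper" "phase (Z X) = t" if X: "X \<in> P t" "\<not> is_zero C X" "0 < t" "t \<le> 1" for X t
  proof -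
    obtain m where "m > 0" "W (K_class C X) = complex_of_real m * exp (\<i> * complex_of_real (pi * t))"
      using pol[OF X(1,2)] by blast
    then have "m > 0" "Z X = of_real m * cis (pi * t)"
      using WZ[OF orthogonal_slicesD(1)[OF O X(1)]] by (metis polar_cis)+
    then show "Z X \<in> upper" "phase (Z X) = t" using upper_polar phase_polar X by auto
  qed
  have hnP: "\<exists>L. hn C P L X \<and> fst ` set L \<subseteq> {0<..1}" if X: "X \<in> hrt 0" for X
  proof -
    have "\<exists>L. hn C P L X"
    proof (cases "is_zero C X")
      case True
      then show ?thesis using hn_Nil by blast
    next
      case False
      then have "has_HN_filtration C P X" using sl X hrt_Ob unfolding slicing_def by blast
      then show ?thesis by (rule HN_filtration_imp_hn)
    qed
    then obtain L where L: "hn C P L X" by blast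
    have "fst ` set L \<subseteq> {0<..1}"
    proof
      fix s assume s: "s \<in> fst ` set L"
      show "s \<in> {0<..1}" using hn_P_interval[OF O L _ s, of "{0<..1}"] X hrtP by auto
    qed
    then show ?thesis using L by blast
  qed
  have hn_factor: "A \<in> P s" "\<not> is_zero C A" "A \<in> hrt 0" "Z A \<in> upper" "phase (Z A) = s" "0 < s" "s \<le> 1"
    if L: "hn C P L X" "fst ` set L \<subseteq> {0<..1}" "(s, A) \<in> set L" for L X s A
  proof -
    show s: "0 < s" "s \<le> 1" using L by force+
    show A: "A \<in> P s" "\<not> is_zero C A" using L by (auto simp: hn_def)
    show "A \<in> hrt 0" "Z A \<in> upper" "phase (Z A) = s" using P_hrt[OF A(1) s] P_phase[OF A s] by auto
  qed
  have tilt_hn: "tilt t (Z X) = (\<Sum>x\<leftarrow>L. tilt t (Z (snd x)))" if "hn C P L X" for t L X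
  proof -
    have "Z X = (\<Sum>A\<leftarrow>map snd L. Z A)" using that additive_Filt[OF additive_charge] by (auto simp: hn_def)
    then show ?thesis using tilt_sum_list[of t Z "map snd L"] by (simp add: comp_def)
  qed
  have unit: "P t = sem t" if t: "0 < t" "t \<le> 1" for t
  proof (intro equalityI subsetI)
    fix X assume X: "X \<in> P t"
    show "X \<in> sem t"
      unfolding sem_def
    proof (intro CollectI conjI ballI impI)
      show "X \<in> hrt 0" using P_hrt X t by blast
      show "tilt t (Z X) = 0"
        using Z_zero P_phase[OF X _ t] tilt_iff(3)[OF _ t] by (cases "is_zero C X") auto
      fix A B assume AB: "A \<in> hrt 0" "B \<in> hrt 0" "tri C A X B"
      obtain L where L: "hn C P L A" "fst ` set L \<subseteq> {0<..1}" using hnP[OF AB(1)] by blast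
      note B1 = tri_unshift_third[OF AB(3)]
      have le: "s \<le> t" if s: "s \<in> fst ` set L" for s
      proof -
        obtain r D where D: "(r, D) \<in> set L" "s \<le> r" "\<not> orth C D A" using hn_top[OF O L(1) s] by blast
        note f = hn_factor[OF L D(1)]
        have "orth C D (shift_by C (- 1) B)"
          using orth_hrt[OF f(3) hrt_shift_by[OF AB(2), of "- 1"]] by simp
        then have "\<not> orth C D X" using orth_mid_right[OF B1 hrt_Ob[OF f(3)]] D(3) by blast
        then have "\<not> t < r" using orthogonal_slicesD(3)[OF O f(1) X] by blast
        then show ?thesis using D(2) by simp
      qed
      have "tilt t (Z (snd x)) \<le> 0" if "x \<in> set L" for x
        using hn_factor[OF L, of "fst x" "snd x"] tilt_iff(2)[OF _ t, of "Z (snd x)"] le[of "fst x"] that by simp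
      then have "(\<Sum>x\<leftarrow>L. tilt t (Z (snd x))) \<le> 0" by (induction L) (auto simp: add_nonpos_nonpos)
      then show "tilt t (Z A) \<le> 0" using tilt_hn[OF L(1)] by simp
    qed
  next
    fix X assume X: "X \<in> sem t"
    then have hX: "X \<in> hrt 0" and XOb: "X \<in> Ob C" and tX: "tilt t (Z X) = 0"
      using hrt_Ob by (auto simp: sem_def)
    have Pt: "additive_subcat C (P t)" using sl unfolding slicing_def by blast
    obtain L where L: "hn C P L X" "fst ` set L \<subseteq> {0<..1}" using hnP[OF hX] by blast
    have L_hrt: "snd ` set L \<subseteq> hrt 0" using hn_factor(3)[OF L] by auto
    have le: "s \<le> t" if s: "s \<in> fst ` set L" for s
    proof -
      obtain t0 A0 L' where L': "L = (t0, A0) # L'" using s by (cases L) auto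
      note f = hn_factor[OF L, of t0 A0]
      obtain R where R: "R \<in> Filt C (map snd L')" "tri C A0 X R" using L L' by (auto simp: hn_def)
      have "R \<in> hrt 0" using hrt_Filt[OF R(1)] L_hrt L' by simp
      moreover have "A0 \<in> hrt 0" using f L' by simp
      ultimately have "tilt t (Z A0) \<le> 0" using X R(2) unfolding sem_def by blast
      then have "t0 \<le> t" using f L' tilt_iff(2)[OF _ t, of "Z A0"] by simp
      moreover have "s \<le> t0" using s L(1) L' by (auto simp: hn_def)
      ultimately show ?thesis by simp
    qed
    have nonneg: "0 \<le> - tilt t (Z (snd x))" if "x \<in> set L" for x
      using hn_factor[OF L, of "fst x" "snd x"] tilt_iff(2)[OF _ t, of "Z (snd x)"] le[of "fst x"] that by simp
    have "(\<Sum>x\<leftarrow>L. - tilt t (Z (snd x))) = 0"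
      using tilt_hn[OF L(1), of t] tX uminus_sum_list_map[of "\<lambda>x. tilt t (Z (snd x))" L] by (simp add: comp_def)
    moreover have "0 \<le> y" if "y \<in> set (map (\<lambda>x. - tilt t (Z (snd x))) L)" for y
      using that nonneg by auto
    ultimately have "\<forall>y\<in>set (map (\<lambda>x. - tilt t (Z (snd x))) L). y = 0"
      using sum_list_nonneg_eq_0_iff by blast
    then have "\<forall>x\<in>set L. tilt t (Z (snd x)) = 0" by auto
    then have "fst x = t" if "x \<in> set L" for x
      using hn_factor[OF L, of "fst x" "snd x"] tilt_iff(3)[OF _ t, of "Z (snd x)"] that by simp
    then have "s = t" if "s \<in> fst ` set L" for s using that by auto
    then consider "L = []" | A where "L = [(t, A)]" using hn_single_phase[OF L(1)] by blast
    then show "X \<in> P t"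
    proof cases
      case 1
      then have "is_zero C X" using L by (simp add: hn_def)
      then show ?thesis using Pt isomorphic_zeros XOb unfolding additive_subcat_def by blast
    next
      case (2 A)
      then have A: "X \<in> Filt C [A]" "A \<in> P t" using L(1) by (auto simp: hn_def)
      then show ?thesis
        using Filt_single[OF orthogonal_slicesD(1)[OF O A(2)]] Pt XOb unfolding additive_subcat_def by blast
    qed
  qed
  have shift: "P (t + of_int p) = shift_by C p ` P t" for t p
  proof (induction p rule: shift_by_induct)
    case (2 p)
    have sh1: "P (t + of_int (p + 1)) = shift C ` P (t + of_int p)"
      using O unfolding orthogonal_slices_def by (simp add: add.assoc[symmetric])
    have sh2: "shift_by C (p + 1) ` P t = shift C ` shift_by C p ` P t"
      unfolding image_image using orthogonal_slicesD(1)[OF O] shift_shift_by by (intro image_cong) auto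
    have sub: "P (t + of_int p) \<subseteq> Ob C" "shift_by C p ` P t \<subseteq> Ob C"
      using orthogonal_slicesD(1)[OF O] by auto
    have "inj_on (shift C) (Ob C)" using shift_bij unfolding bij_betw_def by blast
    then have "shift C ` P (t + of_int p) = shift C ` shift_by C p ` P t \<longleftrightarrow> P (t + of_int p) = shift_by C p ` P t"
      using sub by (rule inj_on_image_eq_iff)
    then show ?case unfolding sh1 sh2 using 2 by simp
  qed simp
  show ?thesis
  proof
    fix t
    have "P t = shift_by C (\<lceil>t\<rceil> - 1) ` P (t - of_int (\<lceil>t\<rceil> - 1))"
      using shift[of "t - of_int (\<lceil>t\<rceil> - 1)" "\<lceil>t\<rceil> - 1"] by simp
    then show "P t = slice t" unfolding slice_def using unit[OF ceiling_unit] by simp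
  qed
qed

end

context simple_minded
begin

text \<open>Conversely the simple objects of the heart of a stability condition have charges in the
  upper half plane, being filtered by semistable objects with phases in \<open>(0,1]\<close>.\<close>

lemma stability_condition_upper:
  assumes st: "(P, W) \<in> Stab C" and heart: "P_interval C P {0<..1} = ext_closure C \<S>" and S: "S \<in> \<S>"
  shows "W (K_class C S) \<in> upper"
proof -
  have sl: "slicing C P" and W: "W \<in> hom (K_group C) complex_add_group"
    and pol: "\<And>t X. X \<in> P t \<Longrightarrow> \<not> is_zero C X \<Longrightarrow>
       \<exists>m>0. W (K_class C X) = complex_of_real m * exp (\<i> * complex_of_real (pi * t))"
    using st unfolding Stab_def by auto
  note O = slicing_orthogonal[OF sl]
  have "has_HN_filtration C P S" using sl S S_Ob' S_nonzero unfolding slicing_def by blast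
  then obtain L where L: "hn C P L S" using HN_filtration_imp_hn by blast
  have ne: "L \<noteq> []" using L S S_nonzero by (auto simp: hn_def)
  have SP: "S \<in> P_interval C P {0<..1}" unfolding heart by (rule ext_closure.base[OF S])
  have up: "W (K_class C (snd x)) \<in> upper" if x: "x \<in> set L" for x
  proof -
    have "fst x \<in> fst ` set L" using x by simp
    then have s: "0 < fst x" "fst x \<le> 1" using hn_P_interval[OF O L SP, of "fst x"] by auto
    have A: "snd x \<in> P (fst x)" "\<not> is_zero C (snd x)" using L x by (auto simp: hn_def)
    obtain m where "m > 0" "W (K_class C (snd x)) = of_real m * cis (pi * fst x)"
      using pol[OF A] by (metis polar_cis)
    then show ?thesis using upper_polar s by simp
  qed
  have "(\<Sum>x\<leftarrow>L. W (K_class C (snd x))) \<in> upper"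
    using ne up
  proof (induction L)
    case (Cons x L)
    then show ?case using upper_add by (cases "L = []") auto
  qed simp
  moreover have "W (K_class C S) = (\<Sum>A\<leftarrow>map snd L. W (K_class C A))"
    using additive_Filt[OF K_hom_additive[OF W]] L unfolding hn_def by blast
  ultimately show ?thesis by (simp add: comp_def)
qed

end

context simple_minded
begin

text \<open>The charges of the simple objects determine the central charge, and with the heart this
  determines the slices.\<close>

lemma stability_condition_unique:
  assumes st: "(P, W) \<in> Stab C" "P_interval C P {0<..1} = ext_closure C \<S>"
    and st': "(P', W') \<in> Stab C" "P_interval C P' {0<..1} = ext_closure C \<S>"
    and eq: "\<And>S. S \<in> \<S> \<Longrightarrow> W (K_class C S) = W' (K_class C S)"
  shows "(P, W) = (P', W')"
proof -
  define z where "z = (\<lambda>S. W (K_class C S))"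
  interpret stability_function k C \<S> z
    by unfold_locales (use stability_condition_upper[OF st] z_def in simp)
  have W: "W \<in> hom (K_group C) complex_add_group" "W \<in> extensional (carrier (K_group C))"
    using st(1) by (auto simp: Stab_def)
  have W': "W' \<in> hom (K_group C) complex_add_group" "W' \<in> extensional (carrier (K_group C))"
    using st'(1) by (auto simp: Stab_def)
  have "W (K_class C X) = W' (K_class C X)" if "X \<in> Ob C" for X
    using additive_eq_charge[OF K_hom_additive[OF W(1)] that, of z]
      additive_eq_charge[OF K_hom_additive[OF W'(1)] that, of z] eq by (simp add: z_def)
  then have "W = W'" by (rule K_hom_unique[OF W W'])
  moreover have "P = slice" "P' = slice"
    using stability_condition_slices[OF st] stability_condition_slices[OF st'] eq by (auto simp: z_def)
  ultimately show ?thesis by simp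
qed

end


section \<open>Full triangulated subcategories\<close>

lemma full_subcat_iso [simp]:
  "is_iso (full_subcat C D) X Y f \<longleftrightarrow> is_iso C X Y f"
  "isomorphic (full_subcat C D) X Y \<longleftrightarrow> isomorphic C X Y"
  by (simp_all add: is_iso_def isomorphic_def)

lemma full_subcat_triangle:
  "triangle (full_subcat C D) X Y Z f g h \<Longrightarrow> D \<subseteq> Ob C \<Longrightarrow> triangle C X Y Z f g h \<and> X \<in> D \<and> Y \<in> D \<and> Z \<in> D"
  by (auto simp: triangle_def)

lemma full_subcat_tri: "tri (full_subcat C D) X Y Z \<longleftrightarrow> tri C X Y Z \<and> X \<in> D \<and> Y \<in> D \<and> Z \<in> D"
  by (auto simp: tri_def)

lemma full_subcat_biproduct:
  "D \<subseteq> Ob C \<Longrightarrow> is_biproduct (full_subcat C D) X Y B \<longleftrightarrow> is_biproduct C X Y B \<and> X \<in> D \<and> Y \<in> D \<and> B \<in> D"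
  by (auto simp: is_biproduct_def)

lemma full_subcat_orth [simp]: "orth (full_subcat C D) X Y \<longleftrightarrow> orth C X Y"
  by (simp add: orth_def)

context triangulated_category
begin

lemma full_subcat_is_zero:
  assumes D: "D \<subseteq> Ob C"
  shows "is_zero (full_subcat C D) X \<longleftrightarrow> is_zero C X \<and> X \<in> D"
proof
  assume *: "is_zero (full_subcat C D) X"
  then have X: "X \<in> D" "Mor C X X = {zerom C X X}" by (auto simp: is_zero_def)
  then show "is_zero C X \<and> X \<in> D" using D orth_self_iff[of X] unfolding orth_def by blast
next
  assume "is_zero C X \<and> X \<in> D"
  then show "is_zero (full_subcat C D) X" using D by (auto simp: is_zero_def)
qed

lemma linear_full_subcat:
  assumes D: "D \<subseteq> Ob C"
  shows "linear_category k (full_subcat C D)"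
proof -
  have Ob: "\<And>X. X \<in> D \<Longrightarrow> X \<in> Ob C" using D by blast
  show ?thesis
  proof (rule linear_category.intro, unfold full_subcat_simps, goal_cases)
    case 1
    show ?case by (rule field_k)
  next
    case 2
    then show ?case using module_Hom Ob by blast
  next
    case 3
    then show ?case using ident_in Ob by blast
  next
    case 4
    then show ?case using cmp_in Ob by blast
  next
    case 5
    then show ?case using ident_left Ob by blast
  next
    case 6
    then show ?case using ident_right Ob by blast
  next
    case 7
    then show ?case using cmp_assoc Ob by blast
  next
    case 8
    then show ?case using cmp_add_right Ob by blast
  next
    case 9
    then show ?case using cmp_add_left Ob by blast
  next
    case 10
    then show ?case using cmp_smult_right Ob by blast
  next
    case 11
    then show ?case using cmp_smult_left Ob by blast
  qed
qed

lemma triangulated_full_subcat: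
  assumes D: "triangulated_subcat C D"
  shows "triangulated_category k (full_subcat C D)"
proof -
  let ?C = "full_subcat C D"
  have sub: "D \<subseteq> Ob C" using subcat_Ob[OF D] by blast
  interpret L: linear_category k ?C by (rule linear_full_subcat[OF sub])
  have Ob: "\<And>X. X \<in> D \<Longrightarrow> X \<in> Ob C" using sub by blast
  have sh: "\<And>X. X \<in> D \<Longrightarrow> shift C X \<in> D" using subcat_shift[OF D] Ob by blast
  show ?thesis
  proof unfold_locales
    show "\<exists>X. is_zero ?C X"
      using ex_zero subcat_zero[OF D] full_subcat_is_zero[OF sub] by blast
  next
    fix X Y assume "X \<in> Ob ?C" "Y \<in> Ob ?C"
    then have XY: "X \<in> D" "Y \<in> D" by simp_all
    then obtain B where B: "is_biproduct C X Y B" using ex_biproduct Ob by blast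
    then have "B \<in> D" using XY D unfolding triangulated_subcat_def additive_subcat_def by blast
    then show "\<exists>B. is_biproduct ?C X Y B" using full_subcat_biproduct[OF sub] B XY by blast
  next
    have "shift C ` D = D"
    proof (intro equalityI subsetI)
      fix Y assume "Y \<in> D"
      then obtain X where "X \<in> Ob C" "Y = shift C X" using shift_surj Ob by blast
      then show "Y \<in> shift C ` D" using \<open>Y \<in> D\<close> subcat_shift[OF D] by blast
    qed (use sh in blast)
    moreover have "inj_on (shift C) D" using shift_bij sub unfolding bij_betw_def by (blast intro: inj_on_subset)
    ultimately show "bij_betw (shift ?C) (Ob ?C) (Ob ?C)"
      by (simp add: bij_betw_def)
  next
    fix X Z assume "X \<in> Ob ?C" "is_zero ?C Z"
    then show "(X, X, Z, ident ?C X, zerom ?C X Z,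
        zerom ?C Z (shift ?C X)) \<in> dist ?C"
      using TR1_ident Ob full_subcat_is_zero[OF sub] by simp
  next
    fix X Y f assume "X \<in> Ob ?C" "Y \<in> Ob ?C" "f \<in> Mor ?C X Y"
    then have XY: "X \<in> D" "Y \<in> D" "f \<in> Mor C X Y" by simp_all
    then obtain Z g h where Z: "(X, Y, Z, f, g, h) \<in> dist C" using TR1_cone Ob by blast
    then have "Z \<in> D" using subcat_third[OF D triI[OF Z]] XY by blast
    then show "\<exists>Z g h. (X, Y, Z, f, g, h) \<in> dist ?C" using XY Z by auto
  next
    fix X Y Z f g h assume "triangle ?C X Y Z f g h"
    then have "triangle C X Y Z f g h" "X \<in> D" "Y \<in> D" "Z \<in> D"
      using full_subcat_triangle[OF _ sub] by blast+
    then show "((X, Y, Z, f, g, h) \<in> dist ?C) =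
        ((Y, Z, shift ?C X, g, h,
          \<ominus>\<^bsub>Hom ?C (shift ?C X) (shift ?C Y)\<^esub>
            shiftm ?C f) \<in> dist ?C)"
      using TR2 sh by simp
  next
    fix X Y Z f g h X' Y' Z' f' g' h' a b c
    assume "(X, Y, Z, f, g, h) \<in> dist ?C" "triangle ?C X' Y' Z' f' g' h'"
      "is_iso ?C X X' a" "is_iso ?C Y Y' b" "is_iso ?C Z Z' c"
      "cmp ?C b f = cmp ?C f' a"
      "cmp ?C c g = cmp ?C g' b"
      "cmp ?C (shiftm ?C a) h = cmp ?C h' c"
    then show "(X', Y', Z', f', g', h') \<in> dist ?C"
      using full_subcat_triangle[OF _ sub, of X' Y' Z' f' g' h'] TR1_iso[of X Y Z f g h X' Y' Z' f' g' h' a b c] by simp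
  next
    fix X Y Z f g h X' Y' Z' f' g' h' a b
    assume "(X, Y, Z, f, g, h) \<in> dist ?C" "(X', Y', Z', f', g', h') \<in> dist ?C"
      "a \<in> Mor ?C X X'" "b \<in> Mor ?C Y Y'"
      "cmp ?C b f = cmp ?C f' a"
    then show "\<exists>c\<in>Mor ?C Z Z'. cmp ?C c g = cmp ?C g' b \<and>
        cmp ?C (shiftm ?C a) h = cmp ?C h' c"
      using TR3[of X Y Z f g h X' Y' Z' f' g' h' a b] by simp
  next
    fix X Y Z' f u u' Z X' g v v' Y' w w'
    assume "(X, Y, Z', f, u, u') \<in> dist ?C" "(Y, Z, X', g, v, v') \<in> dist ?C"
      "(X, Z, Y', cmp ?C g f, w, w') \<in> dist ?C"
    then show "\<exists>a b. (Z', Y', X', a, b, cmp ?C (shiftm ?C u) v') \<in> dist ?C \<and>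
        cmp ?C a u = cmp ?C w g \<and> cmp ?C w' a = u' \<and>
        cmp ?C b w = v \<and> cmp ?C v' b = cmp ?C (shiftm ?C f) w'"
      using TR4[of X Y Z' f u u' Z X' g v v' Y' w w'] by simp
  next
    fix X Y Z f g h assume "(X, Y, Z, f, g, h) \<in> dist ?C"
    then show "triangle ?C X Y Z f g h"
      using dist_triangle[of X Y Z f g h] by (simp add: triangle_def)
  next
    fix X Y Z g f
    assume "X \<in> Ob ?C" "Y \<in> Ob ?C" "Z \<in> Ob ?C"
      "g \<in> Mor ?C Y Z" "f \<in> Mor ?C X Y"
    then show "shiftm ?C (cmp ?C g f) =
        cmp ?C (shiftm ?C g) (shiftm ?C f)"
      using shiftm_cmp[of X Y Z g f] Ob by simp
  qed (use Ob shiftm_bij shiftm_ident shiftm_add shiftm_smult in auto)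
qed

context
  fixes D assumes D: "triangulated_subcat C D"
begin

interpretation Sub: triangulated_category k "full_subcat C D"
  by (rule triangulated_full_subcat[OF D])

lemma full_subcat_shift_by:
  assumes X: "X \<in> D"
  shows "shift_by (full_subcat C D) p X = shift_by C p X"
proof (induction p rule: shift_by_induct)
  case 1
  show ?case using Sub.shift_by_0 by simp
next
  case (2 p)
  have "shift_by (full_subcat C D) (p + 1) X = shift C (shift_by (full_subcat C D) p X)"
    using Sub.shift_shift_by[of X p] X unfolding full_subcat_simps by simp
  moreover have "shift_by C (p + 1) X = shift C (shift_by C p X)"
    using shift_shift_by[of X p] X subcat_Ob[OF D] by simp
  moreover have "shift_by (full_subcat C D) p X \<in> Ob C" "shift_by C p X \<in> Ob C"
    using Sub.shift_by_Ob[of X p] shift_by_Ob[of X p] X subcat_Ob[OF D] by simp_all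
  ultimately show ?case using shift_inj by simp
qed

lemma full_subcat_ext_closure:
  assumes S: "S \<subseteq> D"
  shows "ext_closure (full_subcat C D) S = ext_closure C S"
proof (intro equalityI subsetI)
  have sub: "D \<subseteq> Ob C" using subcat_Ob[OF D] by blast
  fix X assume "X \<in> ext_closure (full_subcat C D) S"
  then show "X \<in> ext_closure C S"
    by induction (auto simp: full_subcat_is_zero[OF sub] intro: ext_closure.intros)
next
  have sub: "D \<subseteq> Ob C" using subcat_Ob[OF D] by blast
  fix X assume "X \<in> ext_closure C S"
  then have "X \<in> ext_closure (full_subcat C D) S \<and> X \<in> D"
  proof induction
    case (zero X)
    then have "X \<in> D" by (rule subcat_zero[OF D])
    then show ?case using zero full_subcat_is_zero[OF sub] by (simp add: ext_closure.zero)
  next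
    case (base X)
    then show ?case using S by (auto intro: ext_closure.base)
  next
    case (ext X Y Z f g h)
    have "Y \<in> D" using subcat_mid[OF D triI[OF ext(1)]] ext by blast
    then have "(X, Y, Z, f, g, h) \<in> dist (full_subcat C D)" using ext by simp
    then show ?case using ext \<open>Y \<in> D\<close> ext_closure.ext by metis
  qed
  then show "X \<in> ext_closure (full_subcat C D) S" by blast
qed

text \<open>This transfers the minimality of the generated subcategory from \<open>C\<close> to the full subcategory.\<close>

lemma triangulated_subcat_trans:
  assumes D': "triangulated_subcat (full_subcat C D) D'"
  shows "triangulated_subcat C D'"
proof -
  have sub: "D \<subseteq> Ob C" using subcat_Ob[OF D] by blast
  have sub': "D' \<subseteq> D" using Sub.subcat_Ob[OF D'] by auto
  have D_iso: "Y \<in> D" if "X \<in> D" "Y \<in> Ob C" "isomorphic C X Y" for X Y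
    using D that unfolding triangulated_subcat_def additive_subcat_def by blast
  have D_bi: "B \<in> D" if "X \<in> D" "Y \<in> D" "is_biproduct C X Y B" for X Y B
    using D that unfolding triangulated_subcat_def additive_subcat_def by blast
  have "\<forall>X\<in>D'. \<forall>Y\<in>Ob (full_subcat C D). isomorphic (full_subcat C D) X Y \<longrightarrow> Y \<in> D'"
    using D' unfolding triangulated_subcat_def additive_subcat_def by blast
  then have D'_iso: "Y \<in> D'" if "X \<in> D'" "Y \<in> D" "isomorphic C X Y" for X Y
    using that by simp
  have D'_bi: "B \<in> D'" if "X \<in> D'" "Y \<in> D'" "is_biproduct (full_subcat C D) X Y B" for X Y B
    using D' that unfolding triangulated_subcat_def additive_subcat_def by blast
  show ?thesis
    unfolding triangulated_subcat_def additive_subcat_def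
  proof (intro conjI ballI allI impI)
    show "D' \<subseteq> Ob C" using sub sub' by blast
    obtain N where "is_zero (full_subcat C D) N" using Sub.ex_zero by blast
    then show "\<exists>X\<in>D'. is_zero C X"
      using Sub.subcat_zero[OF D'] full_subcat_is_zero[OF sub] by blast
  next
    fix X Y assume "X \<in> D'" "Y \<in> Ob C" "isomorphic C X Y"
    then show "Y \<in> D'" using D'_iso D_iso sub' by blast
  next
    fix X Y B assume *: "X \<in> D'" "Y \<in> D'" "is_biproduct C X Y B"
    then have "is_biproduct (full_subcat C D) X Y B"
      using full_subcat_biproduct[OF sub] D_bi sub' by blast
    then show "B \<in> D'" using D'_bi * by blast
  next
    fix X assume X: "X \<in> Ob C"
    show "(X \<in> D') = (shift C X \<in> D')"
    proof (cases "X \<in> D")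
      case True
      then show ?thesis using Sub.subcat_shift[OF D', of X] by simp
    next
      case False
      then show ?thesis using subcat_shift[OF D X] sub' by blast
    qed
  next
    fix X Y Z f g h assume *: "(X, Y, Z, f, g, h) \<in> dist C" "X \<in> D'" "Y \<in> D'"
    then have "Z \<in> D" using subcat_third[OF D triI[OF *(1)]] sub' by blast
    then have "tri (full_subcat C D) X Y Z"
      unfolding full_subcat_tri using triI[OF *(1)] *(2,3) sub' by blast
    then show "Z \<in> D'" by (rule Sub.subcat_third[OF D' _ *(2,3)])
  qed
qed

end

lemma full_subcat_generated:
  assumes S: "S \<subseteq> Ob C"
  shows "generated_obs (full_subcat C (generated_obs C S)) S = generated_obs C S"
proof -
  let ?D = "generated_obs C S"
  have D: "triangulated_subcat C ?D" by (rule triangulated_subcat_generated[OF S])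
  interpret Sub: triangulated_category k "full_subcat C ?D"
    by (rule triangulated_full_subcat[OF D])
  show ?thesis
  proof
    show "generated_obs (full_subcat C ?D) S \<subseteq> ?D"
      using Sub.generated_obs_least[OF Sub.triangulated_subcat_Ob] generated_obs_base by simp
    show "?D \<subseteq> generated_obs (full_subcat C ?D) S"
    proof (rule generated_obs_least[OF _ Sub.generated_obs_base])
      show "triangulated_subcat C (generated_obs (full_subcat C ?D) S)"
        using triangulated_subcat_trans[OF D Sub.triangulated_subcat_generated] generated_obs_base by simp
    qed
  qed
qed

end


section \<open>Restriction to the subcategory generated by some of the simple objects\<close>

context simple_minded
begin

lemma simple_minded_subset:
  assumes S': "\<S>' \<subseteq> \<S>"
  shows "simple_minded k (full_subcat C (generated_obs C \<S>')) \<S>'"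
proof -
  let ?C = "full_subcat C (generated_obs C \<S>')"
  have Ob: "\<S>' \<subseteq> Ob C" using S' S_Ob by blast
  note D = triangulated_subcat_generated[OF Ob]
  have sub: "generated_obs C \<S>' \<subseteq> Ob C" using subcat_Ob[OF D] by blast
  interpret Sub: triangulated_category k "full_subcat C (generated_obs C \<S>')"
    by (rule triangulated_full_subcat[OF D])
  show ?thesis
  proof
    show "finite \<S>'" using S' finite_S finite_subset by blast
    show "\<S>' \<subseteq> Ob ?C" using generated_obs_base by simp
    fix S assume S: "S \<in> \<S>'"
    show "\<not> is_zero ?C S"
      using S S' S_nonzero full_subcat_is_zero[OF sub] by blast
    show "f = zerom ?C S S \<or> is_iso ?C S S f"
      if "f \<in> Mor ?C S S" for f
      using that S S' S_brick by auto
    fix T assume T: "T \<in> \<S>'"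
    show "orth ?C S (shift_by ?C p T)"
      if "p < 0" for p
    proof -
      have "T \<in> generated_obs C \<S>'" using T generated_obs_base by blast
      then show ?thesis using full_subcat_shift_by[OF D] S_negative[of S T p] that S T S' by auto
    qed
    show "orth ?C S T" if "S \<noteq> T"
      using that S T S' S_distinct by auto
  next
    show "generated_obs ?C \<S>' = Ob ?C"
      using full_subcat_generated[OF Ob] by simp
  qed
qed

text \<open>The charge with these values is, on the heart, the multiplicity of the simple objects outside
  \<open>\<S>'\<close>.  Being additive and non-negative, it vanishes on the subobjects and quotients of an object
  on which it vanishes.\<close>

definition others :: "'o set \<Rightarrow> 'o \<Rightarrow> complex" where
  "others \<S>' S = (if S \<in> \<S>' then 0 else 1)"

lemma others_heart:
  assumes X: "X \<in> hrt 0"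
  shows "\<exists>n. charge (others \<S>') X = of_nat n"
    and "charge (others \<S>') X = 0 \<Longrightarrow> X \<in> ext_closure C (\<S> \<inter> \<S>')"
proof -
  obtain w where w: "is_word w" "\<And>x. x \<in> set w \<Longrightarrow> snd x = 0" "X \<in> wfilt w" using X by (rule hrtE) blast
  have "weight (others \<S>') w = of_nat (length (filter (\<lambda>x. fst x \<notin> \<S>') w))"
    using w(2)
  proof (induction w)
    case (Cons x w)
    have "snd x = 0" using Cons.prems by simp
    then obtain S where "x = (S, 0)" by (cases x) simp
    then show ?case using Cons by (simp add: others_def)
  qed simp
  then have eq: "charge (others \<S>') X = of_nat (length (filter (\<lambda>x. fst x \<notin> \<S>') w))"
    using charge_eq[OF w(1,3)] by simp
  then show "\<exists>n. charge (others \<S>') X = of_nat n" by blast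
  assume "charge (others \<S>') X = 0"
  then have "\<forall>x\<in>set w. fst x \<in> \<S>'" using eq by (auto simp: filter_empty_conv)
  then have "set (map fst w) \<subseteq> \<S> \<inter> \<S>'" using w(1) by (auto simp: is_word_def)
  moreover have "map (letter C) w = map fst w" using w(2) by (intro map_cong) (force simp: letter_def)+
  moreover have "\<S> \<inter> \<S>' \<subseteq> Ob C" using S_Ob by blast
  ultimately show "X \<in> ext_closure C (\<S> \<inter> \<S>')" using ext_closure_iff_Filt w(3) by metis
qed

end

context stability_function
begin

context
  fixes \<S>' D C' assumes S': "\<S>' \<subseteq> \<S>"
  defines "D \<equiv> generated_obs C \<S>'" and "C' \<equiv> full_subcat C D"
begin

lemma stability_function_subset: "stability_function k C' \<S>' z"
proof -
  interpret R: simple_minded k C' \<S>'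
    unfolding C'_def D_def by (rule simple_minded_subset[OF S'])
  show ?thesis by unfold_locales (use S' z_upper in blast)
qed

interpretation Sub: stability_function k C' \<S>' z
  by (rule stability_function_subset)

lemma triangulated_D: "triangulated_subcat C D"
  unfolding D_def using S' S_Ob by (intro triangulated_subcat_generated) blast

lemma Sub_charge:
  assumes "X \<in> D" "\<And>S. S \<in> \<S>' \<Longrightarrow> y S = y' S"
  shows "Sub.charge y X = charge y' X"
proof -
  have "tri_additive C' (charge y')"
    unfolding tri_additive_def C'_def using charge_tri full_subcat_tri by metis
  moreover have "X \<in> Ob C'" using assms by (simp add: C'_def)
  moreover have "charge y' S = y S" if "S \<in> \<S>'" for S using charge_S S' assms(2) that by auto
  ultimately show ?thesis using Sub.additive_eq_charge[of "charge y'" X y] by simp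
qed

lemma others_D: "X \<in> D \<Longrightarrow> charge (others \<S>') X = 0"
proof -
  assume X: "X \<in> D"
  have "Sub.charge (\<lambda>_. 0) X = charge (others \<S>') X" by (rule Sub_charge[OF X]) (simp add: others_def)
  moreover have "Sub.charge (\<lambda>_. 0) X = 0"
  proof -
    have "tri_additive C' (\<lambda>_. 0)" by (simp add: tri_additive_def)
    then show ?thesis using Sub.additive_eq_charge[of "\<lambda>_. 0" X "\<lambda>_. 0"] X by (simp add: C'_def)
  qed
  ultimately show ?thesis by simp
qed

lemma Sub_hrt_iff: "X \<in> Sub.hrt 0 \<longleftrightarrow> X \<in> hrt 0 \<and> charge (others \<S>') X = 0"
proof -
  have SD: "\<S>' \<subseteq> D" unfolding D_def by (rule generated_obs_base)
  have eq: "Sub.hrt 0 = ext_closure C \<S>'"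
    using Sub.hrt_0 full_subcat_ext_closure[OF triangulated_D SD] by (simp add: C'_def)
  have int: "\<S> \<inter> \<S>' = \<S>'" using S' by blast
  have "ext_closure C \<S>' \<subseteq> D" by (rule subcat_ext_closure[OF triangulated_D SD])
  moreover have "ext_closure C \<S>' \<subseteq> hrt 0"
  proof
    fix X assume "X \<in> ext_closure C \<S>'"
    then obtain w where "set w \<subseteq> \<S>'" "X \<in> Filt C w" using ext_closure_iff_Filt S' S_Ob by (metis subset_trans)
    then show "X \<in> hrt 0" unfolding hrt_0 using ext_closure_iff_Filt[OF S_Ob] S' by blast
  qed
  ultimately show ?thesis using eq others_D others_heart(2)[of X \<S>'] int by auto
qed

lemma Sub_hrt_D: "X \<in> Sub.hrt 0 \<Longrightarrow> X \<in> D"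
  using Sub.hrt_Ob by (simp add: C'_def)

text \<open>The heart of the subcategory is closed under subobjects and quotients in the heart, so both
  hearts test semistability against the same subobjects.\<close>

lemma Sub_sem: "Sub.sem t = sem t \<inter> D"
proof (intro equalityI subsetI)
  fix X assume X: "X \<in> Sub.sem t"
  then have hX: "X \<in> Sub.hrt 0" by (simp add: Sub.sem_def)
  note XD = Sub_hrt_D[OF hX]
  have "X \<in> sem t"
    unfolding sem_def
  proof (intro CollectI conjI ballI impI)
    show "X \<in> hrt 0" using hX Sub_hrt_iff by blast
    show "tilt t (Z X) = 0" using X Sub_charge[OF XD, of z z] by (simp add: Sub.sem_def)
    fix A B assume AB: "A \<in> hrt 0" "B \<in> hrt 0" "tri C A X B"
    have "charge (others \<S>') A + charge (others \<S>') B = 0"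
      using charge_tri[OF AB(3)] others_D[OF XD] by metis
    moreover obtain m n where "charge (others \<S>') A = of_nat m" "charge (others \<S>') B = of_nat n"
      using others_heart(1) AB by metis
    ultimately have "of_nat (m + n) = (0 :: complex)" "charge (others \<S>') A = of_nat m" "charge (others \<S>') B = of_nat n"
      by simp_all
    then have "charge (others \<S>') A = 0" "charge (others \<S>') B = 0"
      by (simp_all only: of_nat_eq_0_iff)
    then have AB': "A \<in> Sub.hrt 0" "B \<in> Sub.hrt 0" using AB Sub_hrt_iff by auto
    then have "tri C' A X B" using AB(3) XD Sub_hrt_D full_subcat_tri unfolding C'_def by metis
    then have "tilt t (Sub.charge z A) \<le> 0" using X AB' unfolding Sub.sem_def by blast
    then show "tilt t (Z A) \<le> 0" using Sub_charge[OF Sub_hrt_D[OF AB'(1)], of z z] by simp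
  qed
  then show "X \<in> sem t \<inter> D" using XD by blast
next
  fix X assume X: "X \<in> sem t \<inter> D"
  show "X \<in> Sub.sem t"
    unfolding Sub.sem_def
  proof (intro CollectI conjI ballI impI)
    show "X \<in> Sub.hrt 0" using X others_D Sub_hrt_iff by (auto simp: sem_def)
    show "tilt t (Sub.charge z X) = 0" using X Sub_charge[of X z z] by (simp add: sem_def)
    fix A B assume AB: "A \<in> Sub.hrt 0" "B \<in> Sub.hrt 0" "tri C' A X B"
    then have "tri C A X B" using full_subcat_tri unfolding C'_def by metis
    then have "tilt t (Z A) \<le> 0" using X AB Sub_hrt_iff unfolding sem_def by blast
    then show "tilt t (Sub.charge z A) \<le> 0" using Sub_charge[OF Sub_hrt_D[OF AB(1)], of z z] by simp
  qed
qed

lemma Sub_slice: "Sub.slice t = slice t \<inter> D"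
proof -
  define p where "p = \<lceil>t\<rceil> - 1"
  have "Sub.slice t = shift_by C' p ` (sem (t - of_int p) \<inter> D)"
    unfolding Sub.slice_def p_def Sub_sem ..
  also have "\<dots> = shift_by C p ` (sem (t - of_int p) \<inter> D)"
    unfolding C'_def using full_subcat_shift_by[OF triangulated_D] by (intro image_cong) auto
  also have "\<dots> = shift_by C p ` sem (t - of_int p) \<inter> D"
    using subcat_shift_by[OF triangulated_D] sem_Ob by auto
  finally show ?thesis unfolding slice_def p_def .
qed

end

end


section \<open>Ext-exceptional collections\<close>

text \<open>All endomorphisms of an exceptional object are scalar multiples of the identity.\<close>

lemma exceptional_object_scalar:
  assumes T: "triangulated_category k T" and E: "exceptional_object k T X"
  shows "\<not> is_zero T X" and "f \<in> Mor T X X \<Longrightarrow> f = zerom T X X \<or> is_iso T X X f"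
proof -
  interpret triangulated_category k T by (rule T)
  interpret k: field k by (rule field_k)
  have X: "X \<in> Ob T" using E by (simp add: exceptional_object_def)
  interpret M: module k "Hom T X X" using module_Hom X by blast
  let ?s = "\<lambda>c. c \<odot>\<^bsub>Hom T X X\<^esub> ident T X"
  have bij: "bij_betw ?s (carrier k) (Mor T X X)" using E by (simp add: exceptional_object_def)
  show "\<not> is_zero T X"
  proof
    assume "is_zero T X"
    then have "Mor T X X = {zerom T X X}" using X by (simp add: is_zero_def)
    then have "?s \<one>\<^bsub>k\<^esub> = ?s \<zero>\<^bsub>k\<^esub>" using bij bij_betwE[OF bij] by auto
    then have "\<one>\<^bsub>k\<^esub> = \<zero>\<^bsub>k\<^esub>" using bij unfolding bij_betw_def inj_on_def by blast
    then show False using k.one_not_zero by simp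
  qed
  show "f = zerom T X X \<or> is_iso T X X f" if f: "f \<in> Mor T X X"
  proof -
    obtain c where c: "c \<in> carrier k" "f = ?s c" using bij f unfolding bij_betw_def by blast
    show ?thesis
    proof (cases "c = \<zero>\<^bsub>k\<^esub>")
      case True
      then show ?thesis using c M.smult_l_null ident_in[OF X] by simp
    next
      case False
      then have u: "c \<in> Units k" using k.field_Units c by blast
      define d where "d = inv\<^bsub>k\<^esub> c"
      have d: "d \<in> carrier k" "d \<otimes>\<^bsub>k\<^esub> c = \<one>\<^bsub>k\<^esub>" "c \<otimes>\<^bsub>k\<^esub> d = \<one>\<^bsub>k\<^esub>"
        using u by (simp_all add: d_def)
      have scal: "?s a \<cdot>\<^bsub>T\<^esub> ?s b = ?s (a \<otimes>\<^bsub>k\<^esub> b)" if "a \<in> carrier k" "b \<in> carrier k" for a b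
        using cmp_smult_left[OF X X X ident_in[OF X] _ that(1), of "?s b"] that ident_in[OF X]
          ident_left[OF X X, of "?s b"] M.smult_closed M.smult_assoc1 by simp
      have "?s \<one>\<^bsub>k\<^esub> = ident T X" using M.smult_one ident_in[OF X] by simp
      then have "?s d \<cdot>\<^bsub>T\<^esub> f = ident T X" "f \<cdot>\<^bsub>T\<^esub> ?s d = ident T X"
        using scal c d by simp_all
      moreover have "?s d \<in> Mor T X X" using M.smult_closed d ident_in[OF X] by simp
      ultimately show ?thesis using f unfolding is_iso_def by blast
    qed
  qed
qed

lemma ext_exceptional_simple_minded:
  assumes T: "triangulated_category k T" and E: "ext_exceptional_collection k T E"
    and full: "full_collection T E"
  shows "simple_minded k T (set E)"
proof -
  interpret triangulated_category k T by (rule T)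
  have exc: "exceptional_object k T X" if "X \<in> set E" for X
    using E that unfolding ext_exceptional_collection_def exceptional_collection_def by blast
  have neg: "orth T X (shift_by T p Y)" if XY: "X \<in> set E" "Y \<in> set E" "X \<noteq> Y" "p \<le> 0" for X Y p
  proof -
    obtain a b where ab: "a < length E" "E ! a = X" "b < length E" "E ! b = Y"
      using XY by (auto simp: in_set_conv_nth)
    then have "a \<noteq> b" using XY by auto
    then show ?thesis using E ab XY(4) unfolding ext_exceptional_collection_def orth_def by blast
  qed
  show ?thesis
  proof
    show "set E \<subseteq> Ob T" using exc by (auto simp: exceptional_object_def)
    show "generated_obs T (set E) = Ob T" using full by (simp add: full_collection_def)
    fix S assume S: "S \<in> set E"
    show "\<not> is_zero T S" using exceptional_object_scalar(1)[OF T exc[OF S]] .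
    show "f = zerom T S S \<or> is_iso T S S f" if "f \<in> Mor T S S" for f
      using exceptional_object_scalar(2)[OF T exc[OF S] that] .
    fix S' assume S': "S' \<in> set E"
    show "orth T S (shift_by T p S')" if "p < 0" for p
      using neg[OF S S', of p] exc[OF S] that by (cases "S = S'") (auto simp: exceptional_object_def orth_def)
    show "orth T S S'" if "S \<noteq> S'" using neg[OF S S' that, of 0] by simp
  qed simp
qed

lemma set_subcollection: "set (subcollection E i j) = (\<lambda>l. E ! l) ` {i..j}"
  unfolding subcollection_def set_map set_upt atLeastLessThanSuc_atLeastAtMost ..

lemma charges_agree_iff:
  "charges_agree T E i j \<sigma> \<sigma>' \<longleftrightarrow>
    (\<forall>S\<in>set (subcollection E i j). snd \<sigma>' (K_class (T_sub T E i j) S) = snd \<sigma> (K_class T S))"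
  unfolding charges_agree_def set_subcollection by blast

theorem proposition3p17:
  fixes k :: "'k ring" and T :: "('k, 'o, 'm) tricat" and E :: "'o list" and n i j :: nat
  assumes "triangulated_category k T"
    and "length E = Suc n"
    and "ext_exceptional_collection k T E"
    and "full_collection T E"
    and "i < j" and "j \<le> n"
  shows "(\<forall>\<sigma>\<in>HH T E.
           \<exists>!\<sigma>'. \<sigma>' \<in> HH (T_sub T E i j) (subcollection E i j) \<and> charges_agree T E i j \<sigma> \<sigma>')
    \<and> proj_stab T E i j ` HH T E = HH (T_sub T E i j) (subcollection E i j)
    \<and> (\<forall>P Z P' Z'. (P, Z) \<in> HH T E \<longrightarrow>
         (P', Z') \<in> HH (T_sub T E i j) (subcollection E i j) \<longrightarrow>
         proj_stab T E i j (P, Z) = (P', Z') \<longrightarrow>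
         (\<forall>t. P' t = P t \<inter> Ob (T_sub T E i j)))"
proof -
  define S' where "S' = set (subcollection E i j)"
  define T' where "T' = T_sub T E i j"
  have S': "S' \<subseteq> set E" unfolding S'_def set_subcollection using assms(2,6) by auto
  have T': "T' = full_subcat T (generated_obs T S')"
    unfolding T'_def T_sub_def generated_def S'_def ..
  have sm: "simple_minded k T (set E)"
    using ext_exceptional_simple_minded assms(1,3,4) by blast
  have sm': "simple_minded k T' S'"
    unfolding T' by (rule simple_minded.simple_minded_subset[OF sm S'])
  have HH: "(P, W) \<in> HH T E \<longleftrightarrow> (P, W) \<in> Stab T \<and> P_interval T P {0<..1} = ext_closure T (set E)" for P W
    unfolding HH_def heart_def by auto
  have HH': "(P, W) \<in> HH T' (subcollection E i j) \<longleftrightarrow>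
      (P, W) \<in> Stab T' \<and> P_interval T' P {0<..1} = ext_closure T' S'" for P W
    unfolding HH_def heart_def S'_def by auto
  have agree: "charges_agree T E i j \<sigma> \<sigma>' \<longleftrightarrow> (\<forall>S\<in>S'. snd \<sigma>' (K_class T' S) = snd \<sigma> (K_class T S))" for \<sigma> \<sigma>'
    unfolding charges_agree_iff S'_def T'_def ..
  have ex1: "\<exists>!\<sigma>'. \<sigma>' \<in> HH T' (subcollection E i j) \<and> charges_agree T E i j \<sigma> \<sigma>'" if \<sigma>: "\<sigma> \<in> HH T E" for \<sigma>
  proof -
    obtain P W where PW: "\<sigma> = (P, W)" by fastforce
    define z where "z = (\<lambda>S. W (K_class T S))"
    have "z S \<in> upper" if "S \<in> S'" for S
      unfolding z_def using simple_minded.stability_condition_upper[OF sm] \<sigma> PW HH that S' by blast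
    then interpret R: stability_function k T' S' z
      using sm' by (simp add: stability_function_def stability_function_axioms_def)
    obtain W' where W': "(R.slice, W') \<in> HH T' (subcollection E i j)" "\<forall>S\<in>S'. W' (K_class T' S) = z S"
      using R.stability_condition_exists HH' by blast
    show ?thesis
    proof (rule ex1I[of _ "(R.slice, W')"])
      show "(R.slice, W') \<in> HH T' (subcollection E i j) \<and> charges_agree T E i j \<sigma> (R.slice, W')"
        using W' unfolding agree PW z_def by simp
      fix \<sigma>' assume \<sigma>': "\<sigma>' \<in> HH T' (subcollection E i j) \<and> charges_agree T E i j \<sigma> \<sigma>'"
      obtain P' V where PV: "\<sigma>' = (P', V)" by fastforce
      have "V (K_class T' S) = W' (K_class T' S)" if "S \<in> S'" for S
        using \<sigma>' W' that unfolding agree PW PV z_def by simp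
      then show "\<sigma>' = (R.slice, W')"
        unfolding PV using R.stability_condition_unique \<sigma>' W'(1) unfolding PV HH' by blast
    qed
  qed
  have proj: "proj_stab T E i j \<sigma> \<in> HH T' (subcollection E i j) \<and> charges_agree T E i j \<sigma> (proj_stab T E i j \<sigma>)"
    if "\<sigma> \<in> HH T E" for \<sigma>
    using theI'[OF ex1[OF that]] unfolding proj_stab_def T'_def .
  have surj: "\<exists>\<sigma>\<in>HH T E. \<sigma>' = proj_stab T E i j \<sigma>" if \<sigma>': "\<sigma>' \<in> HH T' (subcollection E i j)" for \<sigma>'
  proof -
    obtain P' V where PV: "\<sigma>' = (P', V)" by fastforce
    \<comment> \<open>The charges of the objects outside the subcollection are free, and \<open>- 1\<close> has phase \<open>1\<close>.\<close>
    define z where "z = (\<lambda>S. if S \<in> S' then V (K_class T' S) else - 1)"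
    have "z S \<in> upper" for S
    proof (cases "S \<in> S'")
      case True
      then show ?thesis
        using simple_minded.stability_condition_upper[OF sm', of P' V S] \<sigma>' PV HH' by (simp add: z_def)
    qed (simp add: z_def upper_def)
    then interpret R: stability_function k T "set E" z
      using sm by (simp add: stability_function_def stability_function_axioms_def)
    obtain W where W: "(R.slice, W) \<in> HH T E" "\<forall>S\<in>set E. W (K_class T S) = z S"
      using R.stability_condition_exists HH by blast
    have "charges_agree T E i j (R.slice, W) \<sigma>'"
      unfolding agree PV using W(2) S' by (auto simp: z_def)
    then have "\<sigma>' = proj_stab T E i j (R.slice, W)"
      using ex1[OF W(1)] proj[OF W(1)] \<sigma>' by blast
    then show ?thesis using W(1) by blast
  qed
  have slices: "P' t = P t \<inter> Ob T'"
    if \<sigma>: "(P, W) \<in> HH T E" and \<sigma>': "(P', W') \<in> HH T' (subcollection E i j)"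
      and eq: "proj_stab T E i j (P, W) = (P', W')" for P W P' W' t
  proof -
    define z where "z = (\<lambda>S. W (K_class T S))"
    have "z S \<in> upper" if "S \<in> set E" for S
      unfolding z_def using simple_minded.stability_condition_upper[OF sm] \<sigma> HH that by blast
    then interpret R: stability_function k T "set E" z
      using sm by (simp add: stability_function_def stability_function_axioms_def)
    interpret R': stability_function k T' S' z
      unfolding T' by (rule R.stability_function_subset[OF S'])
    have "charges_agree T E i j (P, W) (P', W')" using proj[OF \<sigma>] eq by simp
    then have Wz: "W' (K_class T' S) = z S" if "S \<in> S'" for S
      using that unfolding agree z_def by simp
    have "P = R.slice"
      using R.stability_condition_slices[of P W] \<sigma> HH by (simp add: z_def)
    moreover have "P' = R'.slice"
      using R'.stability_condition_slices[of P' W'] \<sigma>' HH' Wz by simp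
    moreover have "R'.slice t = R.slice t \<inter> Ob T'"
      using R.Sub_slice[OF S', of t] unfolding T' by simp
    ultimately show ?thesis by simp
  qed
  show ?thesis
    unfolding T'_def[symmetric] using ex1 proj surj slices by blast
qed

end
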